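(* Let $n\ge 1$ and let $\mathscr{Z}_n=\{(A,B)\in M_n(\mathbb{C})\times M_n(\mathbb{C}) : AB+BA=0\}$. Let $\mathcal{TP}_n=\{(p,m,r)\in\mathbb{Z}_{\ge 0}^3 : 2p+m+r=n\}$. Then the irreducible components of $\mathscr{Z}_n$ are exactly the subvarieties $\mathscr{Z}_{p,m,r}$, $(p,m,r)\in\mathcal{TP}_n$, one for each triple (distinct triples give distinct components), so that $\mathscr{Z}_n=\bigcup_{(p,m,r)\in\mathcal{TP}_n}\mathscr{Z}_{p,m,r}$. Moreover $\dim\mathscr{Z}_{p,m,r}=n^2+p$.
   Context: $G=GL_n(\mathbb{C})$ acts on pairs of matrices by simultaneous conjugation $g\cdot(A,B)=(gAg^{-1},gBg^{-1})$. For $(p,m,r)\in\mathcal{TP}_n$, let $\mathscr{Z}^\circ_{p,m,r}$ be the union of the $G$-orbits of all pairs $(A,B)\in\mathscr{Z}_n$ with $A=\mathrm{diag}(a_1,-a_1,a_2,-a_2,\dots,a_p,-a_p,a_{p+1},\dots,a_{p+m},0,\dots,0)$ ($r$ zeros at the end), where $a_i\in\mathbb{C}^*$ and $a_i\neq\pm a_j$ for all $1\le i\neq j\le p+m$. The variety $\mathscr{Z}_{p,m,r}$ is the Zariski closure of $\mathscr{Z}^\circ_{p,m,r}$ in $\mathscr{Z}_n$. *)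

theory Defs
  imports "Jordan_Normal_Form.Matrix" "HOL-Library.Extended_Nat"
begin

definition M2 :: "nat \<Rightarrow> (complex mat \<times> complex mat) set" where
  "M2 n = carrier_mat n n \<times> carrier_mat n n"

inductive_set poly_fun :: "nat \<Rightarrow> (complex mat \<times> complex mat \<Rightarrow> complex) set"
  for n :: nat where
  pf_const: "(\<lambda>x. c) \<in> poly_fun n"
| pf_coordA: "i < n \<Longrightarrow> j < n \<Longrightarrow> (\<lambda>x. fst x $$ (i, j)) \<in> poly_fun n"
| pf_coordB: "i < n \<Longrightarrow> j < n \<Longrightarrow> (\<lambda>x. snd x $$ (i, j)) \<in> poly_fun n"
| pf_add: "f \<in> poly_fun n \<Longrightarrow> g \<in> poly_fun n \<Longrightarrow> (\<lambda>x. f x + g x) \<in> poly_fun n"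
| pf_mult: "f \<in> poly_fun n \<Longrightarrow> g \<in> poly_fun n \<Longrightarrow> (\<lambda>x. f x * g x) \<in> poly_fun n"

definition zariski_closed :: "nat \<Rightarrow> (complex mat \<times> complex mat) set \<Rightarrow> bool" where
  "zariski_closed n S \<longleftrightarrow>
     (\<exists>F \<subseteq> poly_fun n. S = {x \<in> M2 n. \<forall>f\<in>F. f x = 0})"

definition zariski_closure :: "nat \<Rightarrow> (complex mat \<times> complex mat) set \<Rightarrow> (complex mat \<times> complex mat) set" where
  "zariski_closure n S = \<Inter>{C. zariski_closed n C \<and> S \<subseteq> C}"

definition zariski_irreducible :: "nat \<Rightarrow> (complex mat \<times> complex mat) set \<Rightarrow> bool" where
  "zariski_irreducible n Y \<longleftrightarrow> Y \<noteq> {} \<and>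
     (\<forall>C1 C2. zariski_closed n C1 \<longrightarrow> zariski_closed n C2 \<longrightarrow> Y \<subseteq> C1 \<union> C2 \<longrightarrow>
        Y \<subseteq> C1 \<or> Y \<subseteq> C2)"

definition irreducible_components :: "nat \<Rightarrow> (complex mat \<times> complex mat) set \<Rightarrow> (complex mat \<times> complex mat) set set" where
  "irreducible_components n X = {Y. Y \<subseteq> X \<and> zariski_irreducible n Y \<and>
     (\<forall>Y'. Y \<subseteq> Y' \<and> Y' \<subseteq> X \<and> zariski_irreducible n Y' \<longrightarrow> Y' = Y)}"

definition zariski_dim :: "nat \<Rightarrow> (complex mat \<times> complex mat) set \<Rightarrow> enat" where
  "zariski_dim n Y = Sup (enat ` {k. \<exists>ch :: nat \<Rightarrow> (complex mat \<times> complex mat) set.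
     (\<forall>i\<le>k. zariski_closed n (ch i) \<and> zariski_irreducible n (ch i) \<and> ch i \<subseteq> Y) \<and>
     (\<forall>i<k. ch i \<subset> ch (Suc i))})"

definition Zn :: "nat \<Rightarrow> (complex mat \<times> complex mat) set" where
  "Zn n = {(A, B) \<in> M2 n. A * B + B * A = 0\<^sub>m n n}"

definition TP :: "nat \<Rightarrow> (nat \<times> nat \<times> nat) set" where
  "TP n = {(p, m, r). 2 * p + m + r = n}"

text \<open>Diagonal entries diag(a_1,-a_1,...,a_p,-a_p,a_{p+1},...,a_{p+m},0,...,0),
  with a_1,...,a_{p+m} stored as a 0, ..., a (p+m-1).\<close>
definition diag_entry :: "nat \<Rightarrow> nat \<Rightarrow> (nat \<Rightarrow> complex) \<Rightarrow> nat \<Rightarrow> complex" where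
  "diag_entry p m a i =
     (if i < 2 * p then (if even i then a (i div 2) else - a (i div 2))
      else if i < 2 * p + m then a (i - p) else 0)"

definition diag_A :: "nat \<Rightarrow> nat \<Rightarrow> nat \<Rightarrow> (nat \<Rightarrow> complex) \<Rightarrow> complex mat" where
  "diag_A n p m a = mat n n (\<lambda>(i, j). if i = j then diag_entry p m a i else 0)"

definition good_params :: "nat \<Rightarrow> nat \<Rightarrow> (nat \<Rightarrow> complex) \<Rightarrow> bool" where
  "good_params p m a \<longleftrightarrow> (\<forall>i < p + m. a i \<noteq> 0) \<and>
     (\<forall>i < p + m. \<forall>j < p + m. i \<noteq> j \<longrightarrow> a i \<noteq> a j \<and> a i \<noteq> - a j)"

definition Zcirc :: "nat \<Rightarrow> nat \<Rightarrow> nat \<Rightarrow> nat \<Rightarrow> (complex mat \<times> complex mat) set" where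
  "Zcirc n p m r = {(g * A * h, g * B * h) | g h A B a.
      g \<in> carrier_mat n n \<and> h \<in> carrier_mat n n \<and> g * h = 1\<^sub>m n \<and> h * g = 1\<^sub>m n \<and>
      (A, B) \<in> Zn n \<and> good_params p m a \<and> A = diag_A n p m a}"

definition Zpmr :: "nat \<Rightarrow> nat \<Rightarrow> nat \<Rightarrow> nat \<Rightarrow> (complex mat \<times> complex mat) set" where
  "Zpmr n p m r = zariski_closure n (Zcirc n p m r)"

end

theory Submission
  imports Defs "Jordan_Normal_Form.Jordan_Normal_Form_Existence"
begin

text \<open>Pairs in \<open>Zcirc n p m r\<close> depend, up to closure, on \<open>n\<^sup>2 + p\<close> parameters: the off-diagonal entries
  of a conjugating matrix with unit diagonal, the eigenvalues \<open>a\<close> of \<open>A\<close>, and the entries \<open>z\<close> of \<open>B\<close> (antidiagonal in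
  the blocks \<open>a, - a\<close>, and diagonal on the kernel of \<open>A\<close>). Lines in the parameter space become rational curves, so each
  \<open>Zpmr n p m r\<close> is irreducible.

  The union of these sets is dense in \<open>Zn n\<close> by induction on \<open>n\<close>: \<open>A\<^sup>2\<close> and \<open>B\<^sup>2\<close> commute with \<open>A\<close> and \<open>B\<close>,
  so the pair splits into a direct sum as soon as one of them has two eigenvalues, and otherwise the pair is moved along a
  curve in \<open>Zn n\<close> on which this happens generically. The main such curve spreads the eigenvalues of a Jordan basis of \<open>A\<close>;
  the roots are nested over all blocks, which allows every anticommuting \<open>B\<close> to be carried along.

  For the dimension, choose along a chain of irreducible closed sets functions vanishing on one set but not on the next.
  Their monomials are linearly independent on the largest set, whereas pulled back to the parameters (and cleared of
  determinants) they lie in a space of polynomials in \<open>n\<^sup>2 + p\<close> variables; comparing the growth of both sides bounds the length.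
  Releasing the parameters one at a time gives a chain attaining the bound.

  Finally \<open>Zpmr n p m r \<subseteq> Zpmr n p' m' r'\<close> forces \<open>m \<le> m'\<close> and \<open>r \<le> r'\<close> by the ranks of the Hankel matrices of the
  odd moments \<open>tr (A\<^bsup>2k+1\<^esup>)\<close> and \<open>tr (B\<^bsup>2k+1\<^esup>)\<close>, and \<open>p \<le> p'\<close> by dimension.\<close>

subsection \<open>Polynomial functions and the Zariski topology\<close>

text \<open>The number \<open>n^2 + p\<close> arises because a diagonal \<open>A\<close> fixes its
  eigenbasis only up to a torus of scalings. Normalizing the diagonal of the conjugating matrix
  removes the torus and leaves (n^2 - n) + (p + m) + (2 p + r) coordinates. The obstacle to density
  is that moving the eigenvalues of a non-diagonalizable \<open>A\<close> destroys anticommutation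
  with a given \<open>B\<close>. Between blocks of opposite eigenvalues \<open>B\<close> is an
  alternating truncated Toeplitz matrix. Each power of the shift in it is replaced by a product of
  factors \<open>N - c\<close>, whose roots start at the number of rows of the block; then the
  truncation stays consistent for blocks of different sizes. A nilpotent \<open>A\<close> has no
  eigenvalue to spread; there \<open>B\<close> is first made invertible and the two matrices
  exchange roles. Odd moments are used because an odd power cancels the contributions of
  \<open>a\<close> and \<open>- a\<close>: only the unpaired eigenvalues are counted, and a Hankel
  determinant vanishing on a set vanishes on its closure. In the growth comparison, a chain of
  length k gives \<open>(N + 1)^k\<close> independent functions of degree O(N), while D parameters
  allow only O(N^D) monomials.\<close>

lemma poly_fun_sum: "(\<And>i. i \<in> I \<Longrightarrow> f i \<in> poly_fun n) \<Longrightarrow> (\<lambda>x. \<Sum>i\<in>I. f i x) \<in> poly_fun n"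
  by (induction I rule: infinite_finite_induct) (auto intro: pf_const pf_add)

lemma poly_fun_prod: "(\<And>i. i \<in> I \<Longrightarrow> f i \<in> poly_fun n) \<Longrightarrow> (\<lambda>x. \<Prod>i\<in>I. f i x) \<in> poly_fun n"
  by (induction I rule: infinite_finite_induct) (auto intro: pf_const pf_mult)

text \<open>Agreement with a polynomial function is required only on \<open>M2 n\<close>: the entry
  formula for a product needs the dimensions of its factors, whereas members of
  \<open>poly_fun n\<close> are functions on all pairs.\<close>

definition poly_mat :: "nat \<Rightarrow> (complex mat \<times> complex mat \<Rightarrow> complex mat) \<Rightarrow> bool" where
  "poly_mat n F \<longleftrightarrow> (\<forall>x\<in>M2 n. F x \<in> carrier_mat n n) \<and>
     (\<forall>i<n. \<forall>j<n. \<exists>f\<in>poly_fun n. \<forall>x\<in>M2 n. F x $$ (i, j) = f x)"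

lemma mat_mult_entry:
  assumes "A \<in> carrier_mat n k" "B \<in> carrier_mat k m" "i < n" "j < m"
  shows "(A * B) $$ (i, j) = (\<Sum>l<k. A $$ (i, l) * B $$ (l, j))"
  using assms by (simp add: scalar_prod_def lessThan_atLeast0)

lemma poly_mat_fst: "poly_mat n fst"
  unfolding poly_mat_def M2_def
proof (intro conjI ballI allI impI)
  fix i j assume "i < n" "j < n"
  from pf_coordA[OF this]
  show "\<exists>f\<in>poly_fun n. \<forall>x\<in>carrier_mat n n \<times> carrier_mat n n. fst x $$ (i, j) = f x" by (rule bexI[rotated]) simp
qed auto

lemma poly_mat_snd: "poly_mat n snd"
  unfolding poly_mat_def M2_def
proof (intro conjI ballI allI impI)
  fix i j assume "i < n" "j < n"
  from pf_coordB[OF this]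
  show "\<exists>f\<in>poly_fun n. \<forall>x\<in>carrier_mat n n \<times> carrier_mat n n. snd x $$ (i, j) = f x" by (rule bexI[rotated]) simp
qed auto

lemma poly_mat_const: "C \<in> carrier_mat n n \<Longrightarrow> poly_mat n (\<lambda>x. C)"
  unfolding poly_mat_def by (auto intro!: bexI[OF _ pf_const])

lemma poly_mat_add: "poly_mat n F \<Longrightarrow> poly_mat n G \<Longrightarrow> poly_mat n (\<lambda>x. F x + G x)"
  unfolding poly_mat_def
proof (safe, goal_cases)
  case (2 i j)
  then obtain f g where "f \<in> poly_fun n" "\<forall>x\<in>M2 n. F x $$ (i, j) = f x"
    "g \<in> poly_fun n" "\<forall>x\<in>M2 n. G x $$ (i, j) = g x" by meson
  with 2 show ?case by (intro bexI[OF _ pf_add[of f n g]]) (auto simp: carrier_matD)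
qed auto

lemma poly_mat_mult:
  assumes F: "poly_mat n F" and G: "poly_mat n G"
  shows "poly_mat n (\<lambda>x. F x * G x)"
  unfolding poly_mat_def
proof (safe, goal_cases)
  case (1 A B) then show ?case using F G unfolding poly_mat_def by auto
next
  case (2 i j)
  have "\<exists>f g. f \<in> poly_fun n \<and> g \<in> poly_fun n \<and> (\<forall>x\<in>M2 n. F x $$ (i, l) = f x \<and> G x $$ (l, j) = g x)" if "l < n" for l
  proof -
    from F 2 that obtain f where "f \<in> poly_fun n" "\<forall>x\<in>M2 n. F x $$ (i, l) = f x" unfolding poly_mat_def by meson
    moreover from G 2 that obtain g where "g \<in> poly_fun n" "\<forall>x\<in>M2 n. G x $$ (l, j) = g x" unfolding poly_mat_def by meson
    ultimately show ?thesis by blast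
  qed
  then obtain f g where fg: "\<And>l. l < n \<Longrightarrow> f l \<in> poly_fun n" "\<And>l. l < n \<Longrightarrow> g l \<in> poly_fun n"
    "\<And>l x. l < n \<Longrightarrow> x \<in> M2 n \<Longrightarrow> F x $$ (i, l) = f l x \<and> G x $$ (l, j) = g l x" by metis
  show ?case
  proof (rule bexI[where x = "\<lambda>x. \<Sum>l<n. f l x * g l x"], intro ballI)
    fix x assume x: "x \<in> M2 n"
    then have "F x \<in> carrier_mat n n" "G x \<in> carrier_mat n n" using F G unfolding poly_mat_def by blast+
    then show "(F x * G x) $$ (i, j) = (\<Sum>l<n. f l x * g l x)"
      using 2 x fg(3) by (simp add: mat_mult_entry del: index_mult_mat)
  qed (use fg(1,2) in \<open>intro poly_fun_sum pf_mult, auto\<close>)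
qed

lemma poly_mat_entry:
  assumes "poly_mat n F" "i < n" "j < n"
  obtains f where "f \<in> poly_fun n" "\<And>x. x \<in> M2 n \<Longrightarrow> F x $$ (i, j) = f x"
  using assms unfolding poly_mat_def by meson

lemma poly_mat_fun_det:
  assumes "\<And>i j. i < k \<Longrightarrow> j < k \<Longrightarrow> g i j \<in> poly_fun n"
  shows "(\<lambda>x. det (mat k k (\<lambda>(i, j). g i j x))) \<in> poly_fun n"
proof -
  have eq: "det (mat k k (\<lambda>(i, j). g i j x)) =
      (\<Sum>p | p permutes {0..<k}. signof p * (\<Prod>i = 0..<k. g i (p i) x))" for x
    unfolding det_def'[OF mat_carrier]
    by (intro sum.cong refl arg_cong2[where f = "(*)"] prod.cong)
      (auto simp: permutes_in_image[of _ "{0..<k}"] dest: permutes_in_image)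
  show ?thesis unfolding eq
  proof (intro poly_fun_sum pf_mult pf_const poly_fun_prod)
    fix p i assume "p \<in> {p. p permutes {0..<k}}" "i \<in> {0..<k}"
    then have "p i < k" using permutes_in_image[of p "{0..<k}" i] by auto
    with \<open>i \<in> {0..<k}\<close> show "g i (p i) \<in> poly_fun n" using assms by auto
  qed
qed

lemma poly_mat_det:
  assumes "poly_mat n F"
  obtains f where "f \<in> poly_fun n" "\<And>x. x \<in> M2 n \<Longrightarrow> det (F x) = f x"
proof -
  from assms obtain g where g: "\<And>i j. i < n \<Longrightarrow> j < n \<Longrightarrow> g i j \<in> poly_fun n"
    "\<And>i j x. i < n \<Longrightarrow> j < n \<Longrightarrow> x \<in> M2 n \<Longrightarrow> F x $$ (i, j) = g i j x"
    unfolding poly_mat_def by metis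
  have *: "det (F x) = det (mat n n (\<lambda>(i, j). g i j x))" if "x \<in> M2 n" for x
    using assms that g(2) unfolding poly_mat_def by (intro arg_cong[where f = det] eq_matI) auto
  show ?thesis
  proof (rule that)
    show "(\<lambda>x. det (mat n n (\<lambda>(i, j). g i j x))) \<in> poly_fun n" using g(1) by (rule poly_mat_fun_det)
  qed (rule *)
qed

lemma zariski_closed_M2: "zariski_closed n (M2 n)"
  unfolding zariski_closed_def by (rule exI[of _ "{}"]) auto

lemma zariski_closed_zero_set: "f \<in> poly_fun n \<Longrightarrow> zariski_closed n {x \<in> M2 n. f x = 0}"
  unfolding zariski_closed_def by (rule exI[of _ "{f}"]) auto

lemma zariski_closed_Inter:
  assumes "\<C> \<noteq> {}" "\<And>C. C \<in> \<C> \<Longrightarrow> zariski_closed n C"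
  shows "zariski_closed n (\<Inter>\<C>)"
proof -
  have "\<forall>C\<in>\<C>. \<exists>F. F \<subseteq> poly_fun n \<and> C = {x \<in> M2 n. \<forall>f\<in>F. f x = 0}"
    using assms(2) unfolding zariski_closed_def by auto
  from bchoice[OF this] obtain F where
    F: "\<forall>C\<in>\<C>. F C \<subseteq> poly_fun n \<and> C = {x \<in> M2 n. \<forall>f\<in>F C. f x = 0}" ..
  have "\<Inter>\<C> = {x \<in> M2 n. \<forall>f\<in>\<Union>(F ` \<C>). f x = 0}"
  proof -
    have mem: "x \<in> C \<longleftrightarrow> x \<in> M2 n \<and> (\<forall>f\<in>F C. f x = 0)" if "C \<in> \<C>" for x C
      using F that by auto
    show ?thesis using assms(1) mem by auto
  qed
  moreover have "\<Union>(F ` \<C>) \<subseteq> poly_fun n" by (rule UN_least) (use F in simp)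
  ultimately show ?thesis unfolding zariski_closed_def by (intro exI[of _ "\<Union>(F ` \<C>)"]) simp
qed

lemma zariski_closed_subset: "zariski_closed n C \<Longrightarrow> C \<subseteq> M2 n"
  unfolding zariski_closed_def by auto

lemma zariski_closed_Un:
  assumes "zariski_closed n C" "zariski_closed n D"
  shows "zariski_closed n (C \<union> D)"
proof -
  from assms obtain F G where F: "F \<subseteq> poly_fun n" "C = {x \<in> M2 n. \<forall>f\<in>F. f x = 0}"
    and G: "G \<subseteq> poly_fun n" "D = {x \<in> M2 n. \<forall>f\<in>G. f x = 0}" unfolding zariski_closed_def by auto
  have "C \<union> D = {x \<in> M2 n. \<forall>h\<in>{\<lambda>x. f x * g x | f g. f \<in> F \<and> g \<in> G}. h x = 0}"
  proof (intro equalityI subsetI)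
    fix x assume "x \<in> C \<union> D"
    then show "x \<in> {x \<in> M2 n. \<forall>h\<in>{\<lambda>x. f x * g x | f g. f \<in> F \<and> g \<in> G}. h x = 0}"
      unfolding F(2) G(2) by auto
  next
    fix x assume x: "x \<in> {x \<in> M2 n. \<forall>h\<in>{\<lambda>x. f x * g x | f g. f \<in> F \<and> g \<in> G}. h x = 0}"
    show "x \<in> C \<union> D"
    proof (rule ccontr)
      assume "x \<notin> C \<union> D"
      then obtain f g where fg: "f \<in> F" "g \<in> G" "f x \<noteq> 0" "g x \<noteq> 0" using x unfolding F(2) G(2) by auto
      then have "(\<lambda>x. f x * g x) x = 0" using x by fast
      with fg show False by simp
    qed
  qed
  moreover have "{\<lambda>x. f x * g x | f g. f \<in> F \<and> g \<in> G} \<subseteq> poly_fun n"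
    using F(1) G(1) by (auto intro: pf_mult)
  ultimately show ?thesis unfolding zariski_closed_def by blast
qed

lemma zariski_closed_UN:
  assumes "finite I" "I \<noteq> {}" "\<And>i. i \<in> I \<Longrightarrow> zariski_closed n (C i)"
  shows "zariski_closed n (\<Union>i\<in>I. C i)"
  using assms by (induction I rule: finite_ne_induct) (auto intro: zariski_closed_Un)

lemma zariski_closed_closure:
  assumes "S \<subseteq> M2 n" shows "zariski_closed n (zariski_closure n S)"
  unfolding zariski_closure_def using assms zariski_closed_M2 by (intro zariski_closed_Inter) auto

lemma closure_subset: "S \<subseteq> zariski_closure n S"
  unfolding zariski_closure_def by auto

lemma closure_minimal: "zariski_closed n C \<Longrightarrow> S \<subseteq> C \<Longrightarrow> zariski_closure n S \<subseteq> C"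
  unfolding zariski_closure_def by auto

lemma closure_mono: "S \<subseteq> T \<Longrightarrow> zariski_closure n S \<subseteq> zariski_closure n T"
  unfolding zariski_closure_def by auto

lemma closure_least: "T \<subseteq> M2 n \<Longrightarrow> S \<subseteq> zariski_closure n T \<Longrightarrow> zariski_closure n S \<subseteq> zariski_closure n T"
  by (meson closure_minimal zariski_closed_closure)

lemma closure_in_M2: "S \<subseteq> M2 n \<Longrightarrow> zariski_closure n S \<subseteq> M2 n"
  using closure_minimal zariski_closed_M2 by blast

lemma mem_closure_iff:
  assumes "S \<subseteq> M2 n"
  shows "x \<in> zariski_closure n S \<longleftrightarrow> x \<in> M2 n \<and> (\<forall>f\<in>poly_fun n. (\<forall>y\<in>S. f y = 0) \<longrightarrow> f x = 0)"
proof safe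
  assume "x \<in> zariski_closure n S" then show "x \<in> M2 n" using closure_in_M2 assms by blast
next
  fix f assume "x \<in> zariski_closure n S" "f \<in> poly_fun n" "\<forall>y\<in>S. f y = 0"
  then show "f x = 0"
    using closure_minimal[OF zariski_closed_zero_set[of f n], of S] assms by blast
next
  assume x: "x \<in> M2 n" and *: "\<forall>f\<in>poly_fun n. (\<forall>y\<in>S. f y = 0) \<longrightarrow> f x = 0"
  have "x \<in> C" if C: "zariski_closed n C" "S \<subseteq> C" for C
  proof -
    from C(1) obtain F where F: "F \<subseteq> poly_fun n" "C = {x \<in> M2 n. \<forall>f\<in>F. f x = 0}" unfolding zariski_closed_def by auto
    have "f x = 0" if "f \<in> F" for f
    proof -
      have "\<forall>y\<in>S. f y = 0" using C(2) F(2) that by auto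
      then show ?thesis using * F(1) that by auto
    qed
    then show ?thesis using F(2) x by auto
  qed
  then show "x \<in> zariski_closure n S" unfolding zariski_closure_def by auto
qed

lemma zero_on_closure: "S \<subseteq> M2 n \<Longrightarrow> f \<in> poly_fun n \<Longrightarrow> (\<And>y. y \<in> S \<Longrightarrow> f y = 0) \<Longrightarrow> x \<in> zariski_closure n S \<Longrightarrow> f x = 0"
  using mem_closure_iff by blast

text \<open>If \<open>Y\<close> lies in neither closed set, one defining function of each is nonzero
  somewhere on \<open>Y\<close>, while their product vanishes on all of it; conversely, zero sets of
  single functions are closed. Irreducibility can then be tested with two functions at a
  time.\<close>

lemma irreducible_iff_no_zero_divisors:
  assumes "Y \<subseteq> M2 n"
  shows "zariski_irreducible n Y \<longleftrightarrow> Y \<noteq> {} \<and>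
    (\<forall>f\<in>poly_fun n. \<forall>g\<in>poly_fun n. (\<forall>x\<in>Y. f x * g x = 0) \<longrightarrow> (\<forall>x\<in>Y. f x = 0) \<or> (\<forall>x\<in>Y. g x = 0))"
proof (intro iffI conjI ballI impI)
  assume "zariski_irreducible n Y" then show "Y \<noteq> {}" unfolding zariski_irreducible_def by auto
next
  fix f g assume irr: "zariski_irreducible n Y" and fg: "f \<in> poly_fun n" "g \<in> poly_fun n" "\<forall>x\<in>Y. f x * g x = 0"
  have "Y \<subseteq> {x \<in> M2 n. f x = 0} \<union> {x \<in> M2 n. g x = 0}" using fg assms by auto
  with irr fg have "Y \<subseteq> {x \<in> M2 n. f x = 0} \<or> Y \<subseteq> {x \<in> M2 n. g x = 0}"
    unfolding zariski_irreducible_def using zariski_closed_zero_set by blast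
  then show "(\<forall>x\<in>Y. f x = 0) \<or> (\<forall>x\<in>Y. g x = 0)" by auto
next
  assume r: "Y \<noteq> {} \<and> (\<forall>f\<in>poly_fun n. \<forall>g\<in>poly_fun n. (\<forall>x\<in>Y. f x * g x = 0) \<longrightarrow> (\<forall>x\<in>Y. f x = 0) \<or> (\<forall>x\<in>Y. g x = 0))"
  show "zariski_irreducible n Y"
    unfolding zariski_irreducible_def
  proof (intro conjI allI impI)
    fix C1 C2 assume C: "zariski_closed n C1" "zariski_closed n C2" "Y \<subseteq> C1 \<union> C2"
    from C obtain F where F: "F \<subseteq> poly_fun n" "C1 = {x \<in> M2 n. \<forall>f\<in>F. f x = 0}" unfolding zariski_closed_def by auto
    from C obtain G where G: "G \<subseteq> poly_fun n" "C2 = {x \<in> M2 n. \<forall>f\<in>G. f x = 0}" unfolding zariski_closed_def by auto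
    show "Y \<subseteq> C1 \<or> Y \<subseteq> C2"
    proof (rule ccontr)
      assume "\<not> ?thesis"
      then obtain x y where xy: "x \<in> Y" "x \<notin> C1" "y \<in> Y" "y \<notin> C2" by blast
      have "x \<in> M2 n" "y \<in> M2 n" using xy assms by auto
      then obtain f g where fg: "f \<in> F" "f x \<noteq> 0" "g \<in> G" "g y \<noteq> 0" using xy F(2) G(2) by auto
      have "\<forall>x\<in>Y. f x * g x = 0" using C(3) fg unfolding F(2) G(2) by fastforce
      with r fg F(1) G(1) have "(\<forall>x\<in>Y. f x = 0) \<or> (\<forall>x\<in>Y. g x = 0)" by blast
      with fg xy show False by blast
    qed
  qed (use r in auto)
qed

lemma irreducible_closure:
  assumes "S \<subseteq> M2 n" "zariski_irreducible n S"
  shows "zariski_irreducible n (zariski_closure n S)"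
  unfolding zariski_irreducible_def
proof (intro conjI allI impI)
  show "zariski_closure n S \<noteq> {}" using assms closure_subset[of S n] unfolding zariski_irreducible_def by auto
next
  fix C1 C2 assume C: "zariski_closed n C1" "zariski_closed n C2" "zariski_closure n S \<subseteq> C1 \<union> C2"
  then have "S \<subseteq> C1 \<or> S \<subseteq> C2"
    using assms(2) closure_subset[of S n] unfolding zariski_irreducible_def by (meson subset_trans)
  then show "zariski_closure n S \<subseteq> C1 \<or> zariski_closure n S \<subseteq> C2" using C closure_minimal by blast
qed

lemma irreducible_subset_UN:
  assumes "finite I" "\<And>i. i \<in> I \<Longrightarrow> zariski_closed n (C i)" "zariski_irreducible n Y" "Y \<subseteq> (\<Union>i\<in>I. C i)"
  shows "\<exists>i\<in>I. Y \<subseteq> C i"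
  using assms
proof (induction I rule: finite_induct)
  case empty then show ?case unfolding zariski_irreducible_def by auto
next
  case (insert i I)
  show ?case
  proof (cases "I = {}")
    case True with insert show ?thesis by auto
  next
    case False
    then have "zariski_closed n (\<Union>i\<in>I. C i)" using insert by (intro zariski_closed_UN) auto
    with insert.prems have "Y \<subseteq> C i \<or> Y \<subseteq> (\<Union>i\<in>I. C i)"
      unfolding zariski_irreducible_def by simp
    with insert show ?thesis by auto
  qed
qed

subsection \<open>Curves\<close>

text \<open>Stated for functions instead of polynomials, so that closure rules apply directly to
  matrix entries written as functions of the curve parameter.\<close>

definition polyf :: "(complex \<Rightarrow> complex) \<Rightarrow> bool" where
  "polyf h \<longleftrightarrow> (\<exists>p. h = poly p)"

lemma polyf_const [intro]: "polyf (\<lambda>t. c)"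
  unfolding polyf_def by (rule exI[of _ "[:c:]"]) auto

lemma polyf_id [intro]: "polyf (\<lambda>t. t)"
  unfolding polyf_def by (rule exI[of _ "[:0,1:]"]) auto

lemma polyf_add [intro]: "polyf f \<Longrightarrow> polyf g \<Longrightarrow> polyf (\<lambda>t. f t + g t)"
  unfolding polyf_def by (elim exE, rule_tac x = "p + pa" in exI) auto

lemma polyf_mult [intro]: "polyf f \<Longrightarrow> polyf g \<Longrightarrow> polyf (\<lambda>t. f t * g t)"
  unfolding polyf_def by (elim exE, rule_tac x = "p * pa" in exI) auto

lemma polyf_uminus [intro]: "polyf f \<Longrightarrow> polyf (\<lambda>t. - f t)"
  unfolding polyf_def by (elim exE, rule_tac x = "- p" in exI) auto

lemma polyf_diff [intro]: "polyf f \<Longrightarrow> polyf g \<Longrightarrow> polyf (\<lambda>t. f t - g t)"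
  unfolding polyf_def by (elim exE, rule_tac x = "p - pa" in exI) auto

lemma polyf_power [intro]: "polyf f \<Longrightarrow> polyf (\<lambda>t. f t ^ k)"
  unfolding polyf_def by (elim exE, rule_tac x = "p ^ k" in exI) auto

lemma polyf_sum [intro]: "(\<And>i. i \<in> I \<Longrightarrow> polyf (f i)) \<Longrightarrow> polyf (\<lambda>t. \<Sum>i\<in>I. f i t)"
  by (induction I rule: infinite_finite_induct) auto

lemma polyf_prod [intro]: "(\<And>i. i \<in> I \<Longrightarrow> polyf (f i)) \<Longrightarrow> polyf (\<lambda>t. \<Prod>i\<in>I. f i t)"
  by (induction I rule: infinite_finite_induct) auto

lemma polyf_if [intro]: "(b \<Longrightarrow> polyf f) \<Longrightarrow> (\<not> b \<Longrightarrow> polyf g) \<Longrightarrow> polyf (\<lambda>t. if b then f t else g t)"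
  by (cases b) simp_all

lemma polyf_finite_zeros: "polyf f \<Longrightarrow> f t0 \<noteq> 0 \<Longrightarrow> finite {t. f t = 0}"
  unfolding polyf_def by (elim exE, hypsubst, rule poly_roots_finite) auto

lemma infinite_compl_finite: "finite (S :: complex set) \<Longrightarrow> \<exists>t. t \<notin> S"
  using ex_new_if_finite infinite_UNIV_char_0 by blast

text \<open>Nothing is required where \<open>\<delta>\<close> vanishes.\<close>

definition ratf :: "(complex \<Rightarrow> complex) \<Rightarrow> (complex \<Rightarrow> complex) \<Rightarrow> bool" where
  "ratf \<delta> h \<longleftrightarrow> (\<exists>e q. polyf q \<and> (\<forall>t. \<delta> t \<noteq> 0 \<longrightarrow> \<delta> t ^ e * h t = q t))"

lemma ratf_polyf: "polyf h \<Longrightarrow> ratf \<delta> h"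
  unfolding ratf_def by (intro exI[of _ 0]) auto

lemma ratf_inverse: "ratf \<delta> (\<lambda>t. 1 / \<delta> t)"
  unfolding ratf_def by (rule exI[of _ 1]) (auto intro!: exI[of _ "\<lambda>t. 1"])

lemma ratf_mult:
  assumes "ratf \<delta> f" "ratf \<delta> g" shows "ratf \<delta> (\<lambda>t. f t * g t)"
proof -
  from assms obtain e q e' q' where *: "polyf q" "\<And>t. \<delta> t \<noteq> 0 \<Longrightarrow> \<delta> t ^ e * f t = q t"
    "polyf q'" "\<And>t. \<delta> t \<noteq> 0 \<Longrightarrow> \<delta> t ^ e' * g t = q' t" unfolding ratf_def by blast
  have "\<delta> t ^ (e + e') * (f t * g t) = q t * q' t" if "\<delta> t \<noteq> 0" for t
    unfolding *(2)[OF that, symmetric] *(4)[OF that, symmetric] by (simp add: power_add)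
  then show ?thesis
    unfolding ratf_def by (intro exI[of _ "e + e'"] exI[of _ "\<lambda>t. q t * q' t"]) (use * in auto)
qed

lemma ratf_add:
  assumes "polyf \<delta>" "ratf \<delta> f" "ratf \<delta> g" shows "ratf \<delta> (\<lambda>t. f t + g t)"
proof -
  from assms obtain e q e' q' where *: "polyf q" "\<And>t. \<delta> t \<noteq> 0 \<Longrightarrow> \<delta> t ^ e * f t = q t"
    "polyf q'" "\<And>t. \<delta> t \<noteq> 0 \<Longrightarrow> \<delta> t ^ e' * g t = q' t" unfolding ratf_def by blast
  have "\<delta> t ^ (e + e') * (f t + g t) = \<delta> t ^ e' * q t + \<delta> t ^ e * q' t" if "\<delta> t \<noteq> 0" for t
    unfolding *(2)[OF that, symmetric] *(4)[OF that, symmetric] by (simp add: power_add algebra_simps)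
  moreover have "polyf (\<lambda>t. \<delta> t ^ e' * q t + \<delta> t ^ e * q' t)"
    using * assms(1) by (intro polyf_add polyf_mult polyf_power)
  ultimately show ?thesis unfolding ratf_def
    by (intro exI[of _ "e + e'"] exI[of _ "\<lambda>t. \<delta> t ^ e' * q t + \<delta> t ^ e * q' t"]) simp
qed

text \<open>One denominator \<open>\<delta>\<close> for all entries suffices: conjugation by
  \<open>g t\<close> has \<open>det (g t)\<close> as its only denominator.\<close>

definition rational_curve :: "nat \<Rightarrow> (complex \<Rightarrow> complex) \<Rightarrow> (complex \<Rightarrow> complex mat \<times> complex mat) \<Rightarrow> bool" where
  "rational_curve n \<delta> \<gamma> \<longleftrightarrow> polyf \<delta> \<and>
     (\<forall>i<n. \<forall>j<n. ratf \<delta> (\<lambda>t. fst (\<gamma> t) $$ (i, j)) \<and> ratf \<delta> (\<lambda>t. snd (\<gamma> t) $$ (i, j)))"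

lemma rational_curve_poly_fun:
  assumes "rational_curve n \<delta> \<gamma>" "f \<in> poly_fun n"
  shows "ratf \<delta> (\<lambda>t. f (\<gamma> t))"
  using assms(2)
proof induction
  case (pf_add f g) then show ?case using assms(1) ratf_add unfolding rational_curve_def by blast
qed (use assms(1) in \<open>auto simp: rational_curve_def intro: ratf_mult ratf_polyf\<close>)

lemma ratf_finite_zeros:
  assumes "polyf \<delta>" "ratf \<delta> h" "\<delta> t0 \<noteq> 0" "h t0 \<noteq> 0"
  shows "finite {t. \<delta> t = 0 \<or> h t = 0}"
proof -
  from assms(2) obtain e q where q: "polyf q" "\<And>t. \<delta> t \<noteq> 0 \<Longrightarrow> \<delta> t ^ e * h t = q t" unfolding ratf_def by blast
  have "{t. \<delta> t = 0 \<or> h t = 0} \<subseteq> {t. \<delta> t = 0} \<union> {t. q t = 0}" using q(2) by force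
  moreover have "q t0 \<noteq> 0" using q(2)[of t0] assms(3,4) by (metis mult_eq_0_iff power_not_zero)
  then have "finite ({t. \<delta> t = 0} \<union> {t. q t = 0})"
    using polyf_finite_zeros assms(1,3) q(1) by blast
  ultimately show ?thesis by (rule finite_subset)
qed

text \<open>A polynomial function that vanishes on \<open>S\<close> but not at
  \<open>\<gamma> t0\<close> would pull back to a rational function with finitely many zeros, yet it
  vanishes at all but finitely many parameters. This is the substitute for taking limits.\<close>

lemma closure_rational_curve:
  assumes "S \<subseteq> M2 n" "rational_curve n \<delta> \<gamma>" "finite T" "\<And>t. t \<notin> T \<Longrightarrow> \<delta> t \<noteq> 0 \<Longrightarrow> \<gamma> t \<in> zariski_closure n S"
    and "\<delta> t0 \<noteq> 0" "\<gamma> t0 \<in> M2 n"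
  shows "\<gamma> t0 \<in> zariski_closure n S"
  unfolding mem_closure_iff[OF assms(1)]
proof (intro conjI ballI impI)
  fix f assume f: "f \<in> poly_fun n" "\<forall>y\<in>S. f y = 0"
  show "f (\<gamma> t0) = 0"
  proof (rule ccontr)
    assume "f (\<gamma> t0) \<noteq> 0"
    then have "finite {t. \<delta> t = 0 \<or> f (\<gamma> t) = 0}"
      using assms rational_curve_poly_fun[OF assms(2) f(1)] by (intro ratf_finite_zeros) (auto simp: rational_curve_def)
    then obtain t where "t \<notin> T \<union> {t. \<delta> t = 0 \<or> f (\<gamma> t) = 0}"
      using infinite_compl_finite finite_UnI[OF assms(3)] by blast
    with assms(4) f zero_on_closure[OF assms(1) f(1)] show False by blast
  qed
qed (use assms in auto)

lemma closure_poly_curve: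
  assumes "S \<subseteq> M2 n" "\<And>i j. i < n \<Longrightarrow> j < n \<Longrightarrow> polyf (\<lambda>t. fst (\<gamma> t) $$ (i, j))"
    "\<And>i j. i < n \<Longrightarrow> j < n \<Longrightarrow> polyf (\<lambda>t. snd (\<gamma> t) $$ (i, j))"
    "finite T" "\<And>t. t \<notin> T \<Longrightarrow> \<gamma> t \<in> zariski_closure n S" "\<gamma> t0 \<in> M2 n"
  shows "\<gamma> t0 \<in> zariski_closure n S"
proof (rule closure_rational_curve[OF assms(1), of "\<lambda>t. 1" _ T])
  show "rational_curve n (\<lambda>t. 1) \<gamma>" unfolding rational_curve_def using assms(2,3) by (auto intro: ratf_polyf)
qed (use assms in auto)

text \<open>On a curve through a point with \<open>f\<close> nonzero and a point with
  \<open>g\<close> nonzero, each of the two pullbacks has only finitely many zeros, so some point of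
  the curve in \<open>S\<close> has \<open>f\<close> and \<open>g\<close> both nonzero.\<close>

lemma irreducible_if_rational_curves:
  assumes "S \<subseteq> M2 n" "S \<noteq> {}"
    and "\<And>x y. x \<in> S \<Longrightarrow> y \<in> S \<Longrightarrow> \<exists>\<delta> \<gamma> T. rational_curve n \<delta> \<gamma> \<and> \<delta> 0 \<noteq> 0 \<and> \<delta> 1 \<noteq> 0 \<and> \<gamma> 0 = x \<and> \<gamma> 1 = y \<and>
       finite T \<and> (\<forall>t. t \<notin> T \<longrightarrow> \<delta> t \<noteq> 0 \<longrightarrow> \<gamma> t \<in> S)"
  shows "zariski_irreducible n S"
  unfolding irreducible_iff_no_zero_divisors[OF assms(1)]
proof (intro conjI ballI impI)
  fix f g assume fg: "f \<in> poly_fun n" "g \<in> poly_fun n" "\<forall>x\<in>S. f x * g x = 0"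
  show "(\<forall>x\<in>S. f x = 0) \<or> (\<forall>x\<in>S. g x = 0)"
  proof (rule ccontr)
    assume "\<not> ?thesis"
    then obtain x y where xy: "x \<in> S" "f x \<noteq> 0" "y \<in> S" "g y \<noteq> 0" by blast
    with assms(3) obtain \<delta> \<gamma> T where c: "rational_curve n \<delta> \<gamma>" "\<delta> 0 \<noteq> 0" "\<delta> 1 \<noteq> 0" "\<gamma> 0 = x" "\<gamma> 1 = y"
       "finite T" "\<And>t. t \<notin> T \<Longrightarrow> \<delta> t \<noteq> 0 \<Longrightarrow> \<gamma> t \<in> S" by metis
    have "polyf \<delta>" using c(1) unfolding rational_curve_def by auto
    then have "finite ({t. \<delta> t = 0 \<or> f (\<gamma> t) = 0} \<union> {t. \<delta> t = 0 \<or> g (\<gamma> t) = 0} \<union> T)"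
      using c xy fg by (intro finite_UnI ratf_finite_zeros[of \<delta> _ 0] ratf_finite_zeros[of \<delta> _ 1] rational_curve_poly_fun) auto
    from infinite_compl_finite[OF this] c(7) fg(3) show False by fastforce
  qed
qed (use assms in auto)

subsection \<open>Polynomial maps, conjugation and direct sums\<close>

definition poly_map :: "nat \<Rightarrow> nat \<Rightarrow> (complex mat \<times> complex mat \<Rightarrow> complex mat \<times> complex mat) \<Rightarrow> bool" where
  "poly_map n k \<phi> \<longleftrightarrow> (\<forall>x\<in>M2 n. \<phi> x \<in> M2 k) \<and> (\<forall>i<k. \<forall>j<k.
     (\<exists>f\<in>poly_fun n. \<forall>x\<in>M2 n. fst (\<phi> x) $$ (i, j) = f x) \<and>
     (\<exists>f\<in>poly_fun n. \<forall>x\<in>M2 n. snd (\<phi> x) $$ (i, j) = f x))"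

lemma poly_map_comp:
  assumes "poly_map n k \<phi>" "f \<in> poly_fun k"
  shows "\<exists>g\<in>poly_fun n. \<forall>x\<in>M2 n. f (\<phi> x) = g x"
  using assms(2)
proof induction
  case (pf_const c) show ?case by (rule bexI[OF _ poly_fun.pf_const]) auto
next
  case (pf_add f g)
  then obtain f' g' where "f' \<in> poly_fun n" "\<forall>x\<in>M2 n. f (\<phi> x) = f' x" "g' \<in> poly_fun n" "\<forall>x\<in>M2 n. g (\<phi> x) = g' x" by auto
  then show ?case by (intro bexI[OF _ poly_fun.pf_add[of f' n g']]) auto
next
  case (pf_mult f g)
  then obtain f' g' where "f' \<in> poly_fun n" "\<forall>x\<in>M2 n. f (\<phi> x) = f' x" "g' \<in> poly_fun n" "\<forall>x\<in>M2 n. g (\<phi> x) = g' x" by auto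
  then show ?case by (intro bexI[OF _ poly_fun.pf_mult[of f' n g']]) auto
qed (use assms(1) in \<open>auto simp: poly_map_def\<close>)

text \<open>Zariski continuity of polynomial maps, with the target allowed to be a closure already,
  so that applications can be iterated.\<close>

lemma poly_map_closure:
  assumes "poly_map n k \<phi>" "S \<subseteq> M2 n" "T \<subseteq> M2 k" "\<And>x. x \<in> S \<Longrightarrow> \<phi> x \<in> zariski_closure k T" "x \<in> zariski_closure n S"
  shows "\<phi> x \<in> zariski_closure k T"
  unfolding mem_closure_iff[OF assms(3)]
proof (intro conjI ballI impI)
  have x: "x \<in> M2 n" using assms(5) closure_in_M2[OF assms(2)] by auto
  then show "\<phi> x \<in> M2 k" using assms(1) unfolding poly_map_def by auto
  fix f assume f: "f \<in> poly_fun k" "\<forall>y\<in>T. f y = 0"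
  from poly_map_comp[OF assms(1) f(1)] obtain g where g: "g \<in> poly_fun n" "\<forall>x\<in>M2 n. f (\<phi> x) = g x" by auto
  have "g y = 0" if "y \<in> S" for y
    using that g(2) assms(2) zero_on_closure[OF assms(3) f(1) _ assms(4)[OF that]] f(2) by (metis subsetD)
  then have "g x = 0" using zero_on_closure[OF assms(2) g(1) _ assms(5)] by auto
  then show "f (\<phi> x) = 0" using g(2) x by auto
qed

text \<open>Both matrices are carried along, like \<open>g\<close> and \<open>h\<close> in
  \<open>Zcirc\<close>, so that conjugation needs no inversion operation.\<close>

definition inverse_mats :: "nat \<Rightarrow> complex mat \<Rightarrow> complex mat \<Rightarrow> bool" where
  "inverse_mats n P Q \<longleftrightarrow> P \<in> carrier_mat n n \<and> Q \<in> carrier_mat n n \<and> P * Q = 1\<^sub>m n \<and> Q * P = 1\<^sub>m n"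

lemma inverse_matsD:
  assumes "inverse_mats n P Q"
  shows "P \<in> carrier_mat n n" "Q \<in> carrier_mat n n" "P * Q = 1\<^sub>m n" "Q * P = 1\<^sub>m n"
  using assms unfolding inverse_mats_def by auto

lemma inverse_mats_sym: "inverse_mats n P Q \<Longrightarrow> inverse_mats n Q P"
  unfolding inverse_mats_def by auto

lemma inverse_mats_one: "inverse_mats n (1\<^sub>m n) (1\<^sub>m n)"
  unfolding inverse_mats_def by auto

lemma inverse_mats_cancel:
  assumes "inverse_mats n P Q" "X \<in> carrier_mat n n"
  shows "P * (Q * X) = X" "Q * (P * X) = X" "X * P * Q = X" "X * Q * P = X"
  using assms unfolding inverse_mats_def
  by (auto simp: assoc_mult_mat[symmetric, of P n n Q n X n] assoc_mult_mat[symmetric, of Q n n P n X n]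
      assoc_mult_mat[of X n n P n Q n] assoc_mult_mat[of X n n Q n P n])

lemma inverse_mats_det:
  assumes "P \<in> carrier_mat n n" "det P \<noteq> 0"
  shows "inverse_mats n P ((1 / det P) \<cdot>\<^sub>m adj_mat P)"
  unfolding inverse_mats_def
proof (intro conjI)
  note a = adj_mat[OF assms(1)]
  show "P * (1 / det P \<cdot>\<^sub>m adj_mat P) = 1\<^sub>m n"
    using mult_smult_distrib[OF assms(1) a(1), of "1 / det P"] a(2) assms
    by (auto intro!: eq_matI)
  show "1 / det P \<cdot>\<^sub>m adj_mat P * P = 1\<^sub>m n"
    using mult_smult_assoc_mat[OF a(1) assms(1), of "1 / det P"] a(3) assms
    by (auto intro!: eq_matI)
qed (use assms adj_mat(1)[OF assms(1)] in auto)

lemma inverse_mats_mult: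
  assumes "inverse_mats n P Q" "inverse_mats n R S"
  shows "inverse_mats n (P * R) (S * Q)"
proof -
  note a = inverse_matsD[OF assms(1)] and b = inverse_matsD[OF assms(2)]
  have "P * R * (S * Q) = P * (R * (S * Q))" using a b by (simp add: assoc_mult_mat[of P n n R n "S * Q" n])
  also have "\<dots> = 1\<^sub>m n" using a b inverse_mats_cancel[OF assms(2), of Q] by simp
  finally have 1: "P * R * (S * Q) = 1\<^sub>m n" .
  have "S * Q * (P * R) = S * (Q * (P * R))" using a b by (simp add: assoc_mult_mat[of S n n Q n "P * R" n])
  also have "\<dots> = 1\<^sub>m n" using a b inverse_mats_cancel[OF assms(1), of R] by simp
  finally show ?thesis using 1 a b unfolding inverse_mats_def by auto
qed

definition cj :: "complex mat \<Rightarrow> complex mat \<Rightarrow> complex mat \<times> complex mat \<Rightarrow> complex mat \<times> complex mat" where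
  "cj P Q x = (P * fst x * Q, P * snd x * Q)"

lemma conj_mult:
  assumes "inverse_mats n P Q" "X \<in> carrier_mat n n" "Y \<in> carrier_mat n n"
  shows "(P * X * Q) * (P * Y * Q) = P * (X * Y) * Q"
proof -
  note a = inverse_matsD[OF assms(1)]
  have "(P * X * Q) * (P * Y * Q) = P * X * (Q * (P * (Y * Q)))"
    using a(1,2) assms(2,3) by (simp add: assoc_mult_mat[of _ n n _ n _ n])
  also have "\<dots> = P * X * (Y * Q)" using inverse_mats_cancel[OF assms(1), of "Y * Q"] a assms by simp
  also have "\<dots> = P * (X * Y) * Q" using a(1,2) assms(2,3) by (simp add: assoc_mult_mat[of _ n n _ n _ n])
  finally show ?thesis .
qed

lemma conj_add:
  assumes "P \<in> carrier_mat n n" "Q \<in> carrier_mat n n" "X \<in> carrier_mat n n" "Y \<in> carrier_mat n n"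
  shows "P * X * Q + P * Y * Q = P * (X + Y) * Q"
  using assms by (simp add: mult_add_distrib_mat[of P n n X n Y] add_mult_distrib_mat[of "P * X" n n "P * Y" Q n])

lemma conj_conj:
  assumes "P \<in> carrier_mat n n" "Q \<in> carrier_mat n n" "R \<in> carrier_mat n n" "S \<in> carrier_mat n n" "X \<in> carrier_mat n n"
  shows "P * (R * X * S) * Q = (P * R) * X * (S * Q)"
  using assms by (simp add: assoc_mult_mat[of _ n n _ n _ n])

lemma conj_cancel:
  assumes "inverse_mats n P Q" "X \<in> carrier_mat n n"
  shows "P * (Q * X * P) * Q = X" "Q * (P * X * Q) * P = X"
proof -
  note a = inverse_matsD[OF assms(1)]
  show "P * (Q * X * P) * Q = X" "Q * (P * X * Q) * P = X"
    using a conj_conj[of P n Q Q P X] conj_conj[of Q n P P Q X] assms(2) by auto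
qed

lemma cj_cancel: "inverse_mats n P Q \<Longrightarrow> x \<in> M2 n \<Longrightarrow> cj P Q (cj Q P x) = x"
  unfolding cj_def M2_def by (auto simp only: fst_conv snd_conv mem_Times_iff conj_cancel prod.collapse)

lemma cj_cj:
  assumes "inverse_mats n P Q" "inverse_mats n R S" "x \<in> M2 n"
  shows "cj P Q (cj R S x) = cj (P * R) (S * Q) x"
proof -
  note a = inverse_matsD(1,2)[OF assms(1)] inverse_matsD(1,2)[OF assms(2)]
  from assms(3) have "fst x \<in> carrier_mat n n" "snd x \<in> carrier_mat n n" unfolding M2_def by auto
  from conj_conj[OF a this(1)] conj_conj[OF a this(2)] show ?thesis unfolding cj_def fst_conv snd_conv by (rule arg_cong2)
qed

lemma cj_M2: "inverse_mats n P Q \<Longrightarrow> x \<in> M2 n \<Longrightarrow> cj P Q x \<in> M2 n"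
  unfolding cj_def M2_def inverse_mats_def by auto

lemma Zn_M2: "Zn n \<subseteq> M2 n" unfolding Zn_def by auto

lemma Zn_iff: "(A, B) \<in> Zn n \<longleftrightarrow> A \<in> carrier_mat n n \<and> B \<in> carrier_mat n n \<and> A * B + B * A = 0\<^sub>m n n"
  unfolding Zn_def M2_def by auto

lemma Zn_swap: "(A, B) \<in> Zn n \<Longrightarrow> (B, A) \<in> Zn n"
  unfolding Zn_iff by (auto simp: comm_add_mat[of "B * A" n n "A * B"])

lemma Zn_cj: "inverse_mats n P Q \<Longrightarrow> x \<in> Zn n \<Longrightarrow> cj P Q x \<in> Zn n"
proof (cases x)
  case (Pair A B)
  assume PQ: "inverse_mats n P Q" and x: "x \<in> Zn n"
  note a = inverse_matsD[OF PQ]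
  have AB: "A \<in> carrier_mat n n" "B \<in> carrier_mat n n" "A * B + B * A = 0\<^sub>m n n" using x unfolding Pair Zn_iff by auto
  have "P * A * Q * (P * B * Q) + P * B * Q * (P * A * Q) = P * (A * B + B * A) * Q"
    using conj_mult[OF PQ AB(1,2)] conj_mult[OF PQ AB(2,1)] conj_add[OF a(1,2), of "A * B" "B * A"] AB by auto
  also have "\<dots> = 0\<^sub>m n n" using AB(3) a by auto
  finally show ?thesis using AB a unfolding Pair cj_def Zn_iff by auto
qed

lemma poly_map_if_poly_mats: "poly_mat n F \<Longrightarrow> poly_mat n G \<Longrightarrow> poly_map n n (\<lambda>x. (F x, G x))"
  unfolding poly_map_def poly_mat_def M2_def by auto

lemma poly_map_cj: "inverse_mats n P Q \<Longrightarrow> poly_map n n (cj P Q)"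
  unfolding cj_def by (intro poly_map_if_poly_mats poly_mat_mult poly_mat_const poly_mat_fst poly_mat_snd)
    (auto simp: inverse_mats_def)

lemma zariski_closed_Zn: "zariski_closed n (Zn n)"
proof -
  define F where "F = (\<lambda>x :: complex mat \<times> complex mat. fst x * snd x + snd x * fst x)"
  have F: "poly_mat n F" unfolding F_def
    by (intro poly_mat_add poly_mat_mult poly_mat_fst poly_mat_snd)
  then obtain f where f: "\<And>i j. i < n \<Longrightarrow> j < n \<Longrightarrow> f i j \<in> poly_fun n"
     "\<And>i j x. i < n \<Longrightarrow> j < n \<Longrightarrow> x \<in> M2 n \<Longrightarrow> F x $$ (i, j) = f i j x"
    unfolding poly_mat_def by metis
  have "x \<in> Zn n \<longleftrightarrow> (\<forall>i<n. \<forall>j<n. f i j x = 0)" if x: "x \<in> M2 n" for x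
  proof -
    have c: "F x \<in> carrier_mat n n" using F x unfolding poly_mat_def by auto
    have "x \<in> Zn n \<longleftrightarrow> F x = 0\<^sub>m n n" using x unfolding Zn_def F_def by (cases x) auto
    also have "\<dots> \<longleftrightarrow> (\<forall>i<n. \<forall>j<n. F x $$ (i, j) = 0)"
      using c by (auto intro!: eq_matI)
    finally show ?thesis using f(2) x by auto
  qed
  then have "Zn n = {x \<in> M2 n. \<forall>h\<in>{f i j | i j. i < n \<and> j < n}. h x = 0}" using Zn_M2 by blast
  moreover have "{f i j | i j. i < n \<and> j < n} \<subseteq> poly_fun n" using f(1) by auto
  ultimately show ?thesis unfolding zariski_closed_def by (intro exI[of _ "{f i j | i j. i < n \<and> j < n}"]) simp
qed

section \<open>Diagonal matrices and generic pairs\<close>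

definition diagm :: "nat \<Rightarrow> (nat \<Rightarrow> complex) \<Rightarrow> complex mat" where
  "diagm n d = mat n n (\<lambda>(i, j). if i = j then d i else 0)"

lemma diagm_carrier [simp]: "diagm n d \<in> carrier_mat n n" "dim_row (diagm n d) = n" "dim_col (diagm n d) = n"
  unfolding diagm_def by auto

lemma diagm_index [simp]: "i < n \<Longrightarrow> j < n \<Longrightarrow> diagm n d $$ (i, j) = (if i = j then d i else 0)"
  unfolding diagm_def by auto

lemma diagm_mult_entry:
  assumes "X \<in> carrier_mat n n" "i < n" "j < n"
  shows "(diagm n d * X) $$ (i, j) = d i * X $$ (i, j)" "(X * diagm n d) $$ (i, j) = X $$ (i, j) * d j"
proof -
  have "(diagm n d * X) $$ (i, j) = (\<Sum>l<n. (if i = l then d i else 0) * X $$ (l, j))"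
    using assms by (subst mat_mult_entry[of _ n n _ n]) (auto intro!: sum.cong)
  also have "\<dots> = (\<Sum>l<n. if i = l then d i * X $$ (l, j) else 0)" by (intro sum.cong) auto
  finally show "(diagm n d * X) $$ (i, j) = d i * X $$ (i, j)" using assms by simp
  have "(X * diagm n d) $$ (i, j) = (\<Sum>l<n. X $$ (i, l) * (if l = j then d l else 0))"
    using assms by (subst mat_mult_entry[of _ n n _ n]) (auto intro!: sum.cong)
  also have "\<dots> = (\<Sum>l<n. if l = j then X $$ (i, l) * d j else 0)" by (intro sum.cong) auto
  finally show "(X * diagm n d) $$ (i, j) = X $$ (i, j) * d j" using assms by simp
qed

text \<open>This is the union of all \<open>Zcirc n p m r\<close>: the triple is read off from which nonzero eigenvalues
  occur together with their negatives.\<close>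

definition Ugen :: "nat \<Rightarrow> (complex mat \<times> complex mat) set" where
  "Ugen n = {(A, B) \<in> Zn n. \<exists>P Q d. inverse_mats n P Q \<and> A = P * diagm n d * Q \<and>
      (\<forall>i<n. \<forall>j<n. i \<noteq> j \<longrightarrow> d i \<noteq> 0 \<longrightarrow> d i \<noteq> d j)}"

abbreviation good :: "nat \<Rightarrow> (complex mat \<times> complex mat) set" where
  "good n \<equiv> zariski_closure n (Ugen n)"

lemma Ugen_Zn: "Ugen n \<subseteq> Zn n" unfolding Ugen_def by auto

lemma Ugen_M2: "Ugen n \<subseteq> M2 n" using Ugen_Zn Zn_M2 by blast

lemma Ugen_cj:
  assumes PQ: "inverse_mats n P Q" and "x \<in> Ugen n" shows "cj P Q x \<in> Ugen n"
proof -
  from assms obtain A B R S d where x: "x = (A, B)" "(A, B) \<in> Zn n" "inverse_mats n R S" "A = R * diagm n d * S"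
    and d: "\<forall>i<n. \<forall>j<n. i \<noteq> j \<longrightarrow> d i \<noteq> 0 \<longrightarrow> d i \<noteq> d j" unfolding Ugen_def by blast
  have "P * A * Q = (P * R) * diagm n d * (S * Q)"
    unfolding x(4) using inverse_matsD[OF PQ] inverse_matsD[OF x(3)] by (intro conj_conj) auto
  moreover have "inverse_mats n (P * R) (S * Q)" using PQ x(3) by (rule inverse_mats_mult)
  moreover have "(P * A * Q, P * B * Q) \<in> Zn n" using Zn_cj[OF PQ x(2)] unfolding cj_def by auto
  ultimately show ?thesis using d unfolding Ugen_def cj_def x(1) by auto
qed

lemma good_cj: "inverse_mats n P Q \<Longrightarrow> x \<in> good n \<Longrightarrow> cj P Q x \<in> good n"
  by (rule poly_map_closure[OF poly_map_cj Ugen_M2 Ugen_M2])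
    (use Ugen_cj closure_subset in blast)+

lemma good_cj_iff:
  assumes "inverse_mats n P Q" "x \<in> M2 n" shows "cj P Q x \<in> good n \<longleftrightarrow> x \<in> good n"
  using good_cj[OF assms(1), of x] good_cj[OF inverse_mats_sym[OF assms(1)], of "cj P Q x"]
    cj_cancel[OF inverse_mats_sym[OF assms(1)] assms(2)] by metis

section \<open>Direct sums of pairs\<close>

definition dsum_mat :: "complex mat \<Rightarrow> complex mat \<Rightarrow> complex mat" where
  "dsum_mat A B = four_block_mat A (0\<^sub>m (dim_row A) (dim_col B)) (0\<^sub>m (dim_row B) (dim_col A)) B"

lemma dsum_mat_carrier: "A \<in> carrier_mat n n \<Longrightarrow> B \<in> carrier_mat k k \<Longrightarrow> dsum_mat A B \<in> carrier_mat (n + k) (n + k)"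
  unfolding dsum_mat_def by auto

lemma dsum_mat_index:
  assumes "A \<in> carrier_mat n n" "B \<in> carrier_mat k k" "i < n + k" "j < n + k"
  shows "dsum_mat A B $$ (i, j) = (if i < n \<and> j < n then A $$ (i, j) else
     if \<not> i < n \<and> \<not> j < n then B $$ (i - n, j - n) else 0)"
  using assms unfolding dsum_mat_def by auto

lemma dsum_mat_mult:
  assumes "A \<in> carrier_mat n n" "B \<in> carrier_mat k k" "C \<in> carrier_mat n n" "D \<in> carrier_mat k k"
  shows "dsum_mat A B * dsum_mat C D = dsum_mat (A * C) (B * D)"
  using assms unfolding dsum_mat_def
  by (subst mult_four_block_mat[of _ n n _ k _ k _ _ n _ k]) auto

lemma dsum_mat_add:
  assumes "A \<in> carrier_mat n n" "B \<in> carrier_mat k k" "C \<in> carrier_mat n n" "D \<in> carrier_mat k k"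
  shows "dsum_mat A B + dsum_mat C D = dsum_mat (A + C) (B + D)"
  using assms unfolding dsum_mat_def
  by (subst add_four_block_mat[of _ n n _ k _ k]) auto

lemma dsum_mat_zero: "dsum_mat (0\<^sub>m n n) (0\<^sub>m k k) = 0\<^sub>m (n + k) (n + k)"
  unfolding dsum_mat_def by simp

lemma dsum_mat_one: "dsum_mat (1\<^sub>m n) (1\<^sub>m k) = 1\<^sub>m (n + k)"
  unfolding dsum_mat_def by simp

definition dsum where "dsum x y = (dsum_mat (fst x) (fst y), dsum_mat (snd x) (snd y))"

lemma dsum_Zn:
  assumes "x \<in> Zn n" "y \<in> Zn k" shows "dsum x y \<in> Zn (n + k)"
proof -
  obtain A B C D where xy: "x = (A, B)" "y = (C, D)" by (cases x, cases y)
  have *: "A \<in> carrier_mat n n" "B \<in> carrier_mat n n" "A * B + B * A = 0\<^sub>m n n"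
    "C \<in> carrier_mat k k" "D \<in> carrier_mat k k" "C * D + D * C = 0\<^sub>m k k"
    using assms unfolding xy Zn_iff by auto
  show ?thesis unfolding dsum_def xy Zn_iff fst_conv snd_conv
    using * by (auto intro!: dsum_mat_carrier
      simp: dsum_mat_mult[of _ n _ k] dsum_mat_add[of _ n _ k] dsum_mat_zero)
qed

lemma dsum_diag: "dsum_mat (diagm n d) (diagm k e) = diagm (n + k) (\<lambda>i. if i < n then d i else e (i - n))"
  by (rule eq_matI) (auto simp: dsum_mat_index[of _ n _ k] dsum_mat_def)

lemma dsum_inverse:
  assumes "inverse_mats n P Q" "inverse_mats k R S" shows "inverse_mats (n + k) (dsum_mat P R) (dsum_mat Q S)"
  using inverse_matsD[OF assms(1)] inverse_matsD[OF assms(2)] unfolding inverse_mats_def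
  by (auto simp: dsum_mat_mult[of _ n _ k] dsum_mat_one intro!: dsum_mat_carrier)

lemma smult_conj:
  fixes c :: complex
  assumes "P \<in> carrier_mat n n" "Q \<in> carrier_mat n n" "X \<in> carrier_mat n n"
  shows "c \<cdot>\<^sub>m (P * X * Q) = P * (c \<cdot>\<^sub>m X) * Q"
  using assms by (simp add: mult_smult_distrib[of P n n X n] mult_smult_assoc_mat[of "P * X" n n Q n])

lemma Zn_smult: "(A, B) \<in> Zn n \<Longrightarrow> (c \<cdot>\<^sub>m A, B) \<in> Zn n"
proof -
  assume "(A, B) \<in> Zn n"
  then have *: "A \<in> carrier_mat n n" "B \<in> carrier_mat n n" "A * B + B * A = 0\<^sub>m n n" unfolding Zn_iff by auto
  have "c \<cdot>\<^sub>m A * B + B * (c \<cdot>\<^sub>m A) = c \<cdot>\<^sub>m (A * B + B * A)"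
    using *(1,2) by (simp add: mult_smult_distrib[of B n n A n] mult_smult_assoc_mat[of A n n B n] add_smult_distrib_left_mat[of "A * B" n n "B * A"])
  then show ?thesis using * unfolding Zn_iff by auto
qed

text \<open>The two spectra may meet. Scaling the first matrix of the second summand by
  \<open>1 + t\<close> keeps anticommutation and separates them for all but finitely many
  \<open>t\<close>.\<close>

lemma dsum_Ugen_good:
  assumes x: "x \<in> Ugen n" and y: "y \<in> Ugen k" shows "dsum x y \<in> good (n + k)"
proof -
  from x obtain A B P Q d where A: "x = (A, B)" "(A, B) \<in> Zn n" "inverse_mats n P Q" "A = P * diagm n d * Q"
    "\<forall>i<n. \<forall>j<n. i \<noteq> j \<longrightarrow> d i \<noteq> 0 \<longrightarrow> d i \<noteq> d j" unfolding Ugen_def by blast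
  from y obtain C D R S e where C: "y = (C, D)" "(C, D) \<in> Zn k" "inverse_mats k R S" "C = R * diagm k e * S"
    "\<forall>i<k. \<forall>j<k. i \<noteq> j \<longrightarrow> e i \<noteq> 0 \<longrightarrow> e i \<noteq> e j" unfolding Ugen_def by blast
  note a = inverse_matsD[OF A(3)] and c = inverse_matsD[OF C(3)]
  have cr: "A \<in> carrier_mat n n" "B \<in> carrier_mat n n" "C \<in> carrier_mat k k" "D \<in> carrier_mat k k"
    using A(2) C(2) unfolding Zn_iff by auto
  define \<gamma> where "\<gamma> t = dsum (A, B) ((1 + t) \<cdot>\<^sub>m C, D)" for t
  \<comment> \<open>The exceptional parameters: -1 would annihilate the second summand, the others
    solve \<open>d i = (1 + t) e j\<close>. A vanishing \<open>e j\<close> contributes only -1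
    again, by division by zero.\<close>
  define T where "T = insert (-1) ((\<lambda>(i, j). d i / e j - 1) ` ({..<n} \<times> {..<k}))"
  have Zn: "\<gamma> t \<in> Zn (n + k)" for t unfolding \<gamma>_def by (intro dsum_Zn A Zn_smult C)
  have "\<gamma> t \<in> Ugen (n + k)" if t: "t \<notin> T" for t
  proof -
    define h where "h i = (if i < n then d i else (1 + t) * e (i - n))" for i
    have "(1 + t) \<cdot>\<^sub>m diagm k e = diagm k (\<lambda>i. (1 + t) * e i)" by (rule eq_matI) auto
    then have "dsum_mat A ((1 + t) \<cdot>\<^sub>m C) = dsum_mat (P * diagm n d * Q) (R * diagm k (\<lambda>i. (1 + t) * e i) * S)"
      unfolding A(4) C(4) using c by (simp add: smult_conj[of _ k])
    also have "\<dots> = dsum_mat P R * diagm (n + k) h * dsum_mat Q S"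
      using a c by (simp add: dsum_mat_mult[of _ n _ k, symmetric] dsum_diag h_def[abs_def])
    finally have 1: "fst (\<gamma> t) = dsum_mat P R * diagm (n + k) h * dsum_mat Q S" unfolding \<gamma>_def dsum_def by simp
    have t1: "1 + t \<noteq> 0" using t unfolding T_def by (metis add.commute add_eq_0_iff2 insertI1)
    have ne: "d i \<noteq> (1 + t) * e j" if "i < n" "j < k" "e j \<noteq> 0 \<or> d i \<noteq> 0" for i j
    proof
      assume eq: "d i = (1 + t) * e j"
      then have "e j \<noteq> 0" using that t1 by auto
      then have "t = d i / e j - 1" using eq by (simp add: field_simps)
      then show False using t that unfolding T_def by auto
    qed
    have "\<forall>i<n+k. \<forall>j<n+k. i \<noteq> j \<longrightarrow> h i \<noteq> 0 \<longrightarrow> h i \<noteq> h j"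
    proof (intro allI impI)
      fix i j assume ij: "i < n + k" "j < n + k" "i \<noteq> j" "h i \<noteq> 0"
      show "h i \<noteq> h j"
        using A(5) C(5) ij t1 ne[of i "j - n"] ne[of j "i - n"] unfolding h_def
        by (cases "i < n"; cases "j < n") (auto, metis less_diff_conv2 diff_add_inverse2 add.commute eq_diff_iff not_less)
    qed
    with 1 Zn[of t] dsum_inverse[OF A(3) C(3)] show ?thesis
      unfolding Ugen_def by (cases "\<gamma> t") auto
  qed
  then have *: "t \<notin> T \<Longrightarrow> \<gamma> t \<in> good (n + k)" for t using closure_subset by blast
  have "\<gamma> 0 \<in> good (n + k)"
  proof (rule closure_poly_curve[OF Ugen_M2 _ _ _ *])
    show "finite T" unfolding T_def by auto
    show "\<gamma> 0 \<in> M2 (n + k)" using Zn Zn_M2 by blast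
    fix i j assume ij: "i < n + k" "j < n + k"
    have "fst (\<gamma> t) $$ (i, j) = (if i < n \<and> j < n then A $$ (i, j) else
        if \<not> i < n \<and> \<not> j < n then (1 + t) * C $$ (i - n, j - n) else 0)" for t
      unfolding \<gamma>_def dsum_def using cr ij by (auto simp add: dsum_mat_index[of _ n _ k])
    then show "polyf (\<lambda>t. fst (\<gamma> t) $$ (i, j))" by (simp only:, intro polyf_if polyf_mult polyf_add polyf_const polyf_id)
    have "snd (\<gamma> t) $$ (i, j) = dsum_mat B D $$ (i, j)" for t unfolding \<gamma>_def dsum_def by simp
    then show "polyf (\<lambda>t. snd (\<gamma> t) $$ (i, j))" by (simp only:, intro polyf_const)
  qed
  moreover have "1 \<cdot>\<^sub>m C = C" by (rule eq_matI) auto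
  then have "\<gamma> 0 = dsum x y" unfolding \<gamma>_def A(1) C(1) by simp
  ultimately show ?thesis by simp
qed

lemma poly_map_dsum:
  assumes "y \<in> M2 k"
  shows "poly_map n (n + k) (\<lambda>x. dsum x y)" "poly_map n (k + n) (\<lambda>x. dsum y x)"
proof -
  have y: "fst y \<in> carrier_mat k k" "snd y \<in> carrier_mat k k" using assms unfolding M2_def by auto
  have e: "\<exists>f\<in>poly_fun n. \<forall>x\<in>M2 n. (if b then fst x $$ (i, j) else c) = f x"
     "\<exists>f\<in>poly_fun n. \<forall>x\<in>M2 n. (if b then snd x $$ (i, j) else c) = f x" if "b \<Longrightarrow> i < n \<and> j < n" for i j b c
    using that bexI[OF _ pf_coordA[of i n j]] bexI[OF _ pf_coordB[of i n j]] bexI[OF _ pf_const[of c n]]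
    by (cases b; simp; blast)+
  show "poly_map n (n + k) (\<lambda>x. dsum x y)"
    unfolding poly_map_def
  proof (intro conjI ballI allI impI)
    fix x assume "x \<in> M2 n" then show "dsum x y \<in> M2 (n + k)" using y unfolding M2_def dsum_def by (auto intro: dsum_mat_carrier)
  next
    fix i j assume ij: "i < n + k" "j < n + k"
    have "i < n \<and> j < n \<Longrightarrow> i < n \<and> j < n" .
    from e(1)[where c = "if \<not> i < n \<and> \<not> j < n then fst y $$ (i - n, j - n) else 0", OF this]
      e(2)[where c = "if \<not> i < n \<and> \<not> j < n then snd y $$ (i - n, j - n) else 0", OF this] obtain f g where
      "f \<in> poly_fun n" "\<forall>x\<in>M2 n. (if i < n \<and> j < n then fst x $$ (i, j) else if \<not> i < n \<and> \<not> j < n then fst y $$ (i - n, j - n) else 0) = f x"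
      "g \<in> poly_fun n" "\<forall>x\<in>M2 n. (if i < n \<and> j < n then snd x $$ (i, j) else if \<not> i < n \<and> \<not> j < n then snd y $$ (i - n, j - n) else 0) = g x"
      by blast
    note fg = \<open>f \<in> poly_fun n\<close> this(2) \<open>g \<in> poly_fun n\<close> this(4)
    have "fst (dsum x y) $$ (i, j) = f x \<and> snd (dsum x y) $$ (i, j) = g x" if x: "x \<in> M2 n" for x
      unfolding fg(2)[rule_format, OF x, symmetric] fg(4)[rule_format, OF x, symmetric]
      using x y ij unfolding dsum_def M2_def by (auto simp: dsum_mat_index[of _ n _ k])
    then show "\<exists>f\<in>poly_fun n. \<forall>x\<in>M2 n. fst (dsum x y) $$ (i, j) = f x" "\<exists>f\<in>poly_fun n. \<forall>x\<in>M2 n. snd (dsum x y) $$ (i, j) = f x"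
      using fg(1,3) by blast+
  qed
  show "poly_map n (k + n) (\<lambda>x. dsum y x)"
    unfolding poly_map_def
  proof (intro conjI ballI allI impI)
    fix x assume "x \<in> M2 n" then show "dsum y x \<in> M2 (k + n)" using y unfolding M2_def dsum_def by (auto intro: dsum_mat_carrier)
  next
    fix i j assume ij: "i < k + n" "j < k + n"
    have "\<not> i < k \<and> \<not> j < k \<Longrightarrow> i - k < n \<and> j - k < n" using ij by auto
    from e(1)[where c = "if i < k \<and> j < k then fst y $$ (i, j) else 0", OF this]
      e(2)[where c = "if i < k \<and> j < k then snd y $$ (i, j) else 0", OF this] obtain f g where
      "f \<in> poly_fun n" "\<forall>x\<in>M2 n. (if \<not> i < k \<and> \<not> j < k then fst x $$ (i - k, j - k) else if i < k \<and> j < k then fst y $$ (i, j) else 0) = f x"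
      "g \<in> poly_fun n" "\<forall>x\<in>M2 n. (if \<not> i < k \<and> \<not> j < k then snd x $$ (i - k, j - k) else if i < k \<and> j < k then snd y $$ (i, j) else 0) = g x"
      by blast
    note fg = \<open>f \<in> poly_fun n\<close> this(2) \<open>g \<in> poly_fun n\<close> this(4)
    have "fst (dsum y x) $$ (i, j) = f x \<and> snd (dsum y x) $$ (i, j) = g x" if x: "x \<in> M2 n" for x
      unfolding fg(2)[rule_format, OF x, symmetric] fg(4)[rule_format, OF x, symmetric]
      using x y ij unfolding dsum_def M2_def by (auto simp: dsum_mat_index[of _ k _ n])
    then show "\<exists>f\<in>poly_fun n. \<forall>x\<in>M2 n. fst (dsum y x) $$ (i, j) = f x" "\<exists>f\<in>poly_fun n. \<forall>x\<in>M2 n. snd (dsum y x) $$ (i, j) = f x"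
      using fg(1,3) by blast+
  qed
qed

text \<open>The limit is taken in one argument at a time: first in \<open>x\<close> with
  \<open>y\<close> generic, then in \<open>y\<close> with \<open>x\<close> already in the
  closure.\<close>

lemma dsum_good:
  assumes "x \<in> good n" "y \<in> good k" shows "dsum x y \<in> good (n + k)"
proof -
  have "dsum x y \<in> good (n + k)" if y: "y \<in> Ugen k" for y
    by (rule poly_map_closure[OF poly_map_dsum(1) Ugen_M2 Ugen_M2 _ assms(1)]) (use y Ugen_M2 dsum_Ugen_good in auto)
  moreover have "x \<in> M2 n" using assms(1) closure_in_M2 Ugen_M2 by blast
  ultimately show ?thesis by (intro poly_map_closure[OF poly_map_dsum(2) Ugen_M2 Ugen_M2 _ assms(2)]) auto
qed

subsection \<open>Jordan bases and splitting along a central element\<close>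

text \<open>A Jordan matrix described entrywise: \<open>pos i\<close> and \<open>sz i\<close> are the position of the index \<open>i\<close>
  inside its block and the size of that block.\<close>

definition jdata :: "nat \<Rightarrow> (nat \<Rightarrow> complex) \<Rightarrow> (nat \<Rightarrow> nat) \<Rightarrow> (nat \<Rightarrow> nat) \<Rightarrow> bool" where
  "jdata n ev pos sz \<longleftrightarrow> (\<forall>i<n. pos i < sz i \<and> pos i \<le> i \<and> i - pos i + sz i \<le> n \<and>
     (\<forall>j. i - pos i \<le> j \<longrightarrow> j < i - pos i + sz i \<longrightarrow>
        pos j = j - (i - pos i) \<and> sz j = sz i \<and> ev j = ev i))"

text \<open>The diagonal \<open>dg\<close> is independent of the eigenvalues recorded in
  \<open>jdata\<close>, so the same block structure also describes matrices whose diagonal has been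
  deformed.\<close>

definition jmat :: "nat \<Rightarrow> (nat \<Rightarrow> complex) \<Rightarrow> (nat \<Rightarrow> nat) \<Rightarrow> (nat \<Rightarrow> nat) \<Rightarrow> complex mat" where
  "jmat n dg pos sz = mat n n (\<lambda>(i, j). if i = j then dg i else if j = Suc i \<and> Suc (pos i) < sz i then 1 else 0)"

lemma jmat_carrier [simp]: "jmat n dg pos sz \<in> carrier_mat n n" "dim_row (jmat n dg pos sz) = n" "dim_col (jmat n dg pos sz) = n"
  unfolding jmat_def by auto

lemma jmat_index: "i < n \<Longrightarrow> j < n \<Longrightarrow>
  jmat n dg pos sz $$ (i, j) = (if i = j then dg i else if j = Suc i \<and> Suc (pos i) < sz i then 1 else 0)"
  unfolding jmat_def by auto

lemma jdataD:
  assumes "jdata n ev pos sz" "i < n"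
  shows "pos i < sz i" "pos i \<le> i" "i - pos i + sz i \<le> n"
    "i - pos i \<le> j \<Longrightarrow> j < i - pos i + sz i \<Longrightarrow> pos j = j - (i - pos i)"
    "i - pos i \<le> j \<Longrightarrow> j < i - pos i + sz i \<Longrightarrow> sz j = sz i"
    "i - pos i \<le> j \<Longrightarrow> j < i - pos i + sz i \<Longrightarrow> ev j = ev i"
  using assms unfolding jdata_def by blast+

text \<open>\<open>i - pos i\<close> is the first index of the block containing \<open>i\<close>;
  adding an offset \<open>d\<close> below the block size reaches every index of that block.\<close>

lemma jdata_start:
  assumes "jdata n ev pos sz" "i < n" "d < sz i"
  shows "i - pos i + d < n" "pos (i - pos i + d) = d" "sz (i - pos i + d) = sz i" "ev (i - pos i + d) = ev i"
proof -
  show "i - pos i + d < n" using jdataD(1-3)[OF assms(1,2)] assms(3) by linarith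
  have *: "i - pos i \<le> i - pos i + d" "i - pos i + d < i - pos i + sz i" using assms(3) by auto
  show "pos (i - pos i + d) = d" using jdataD(4)[OF assms(1,2) *] by simp
  show "sz (i - pos i + d) = sz i" by (rule jdataD(5)[OF assms(1,2) *])
  show "ev (i - pos i + d) = ev i" by (rule jdataD(6)[OF assms(1,2) *])
qed

lemma jdata_next:
  assumes "jdata n ev pos sz" "i < n" "Suc (pos i) < sz i"
  shows "Suc i < n" "pos (Suc i) = Suc (pos i)" "sz (Suc i) = sz i" "ev (Suc i) = ev i"
proof -
  have "i - pos i + Suc (pos i) = Suc i" using jdataD(2)[OF assms(1,2)] by simp
  from jdata_start[OF assms, unfolded this]
  show "Suc i < n" "pos (Suc i) = Suc (pos i)" "sz (Suc i) = sz i" "ev (Suc i) = ev i" .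
qed

lemma jdata_prev:
  assumes "jdata n ev pos sz" "i < n" "0 < pos i"
  shows "0 < i" "Suc (pos (i - 1)) = pos i" "sz (i - 1) = sz i" "ev (i - 1) = ev i"
proof -
  show "0 < i" using jdataD(2)[OF assms(1,2)] assms(3) by simp
  have lt: "pos i - 1 < sz i" using jdataD(1)[OF assms(1,2)] by simp
  have "i - pos i + (pos i - 1) = i - 1" using jdataD(2)[OF assms(1,2)] assms(3) by simp
  from jdata_start[OF assms(1,2) lt, unfolded this]
  show "Suc (pos (i - 1)) = pos i" "sz (i - 1) = sz i" "ev (i - 1) = ev i" using assms(3) by simp_all
qed

lemma jmat_mult_left:
  assumes jd: "jdata n ev pos sz" and X: "X \<in> carrier_mat n n" and ij: "i < n" "j < n"
  shows "(jmat n dg pos sz * X) $$ (i, j) = dg i * X $$ (i, j) + (if Suc (pos i) < sz i then X $$ (Suc i, j) else 0)"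
proof -
  have "(jmat n dg pos sz * X) $$ (i, j) = (\<Sum>l<n. jmat n dg pos sz $$ (i, l) * X $$ (l, j))"
    using X ij by (intro mat_mult_entry) auto
  also have "\<dots> = (\<Sum>l<n. (if l = i then dg i * X $$ (i, j) else 0) + (if l = Suc i then if Suc (pos i) < sz i then X $$ (Suc i, j) else 0 else 0))"
    using ij by (intro sum.cong) (auto simp: jmat_index)
  also have "\<dots> = dg i * X $$ (i, j) + (if Suc i < n then if Suc (pos i) < sz i then X $$ (Suc i, j) else 0 else 0)"
    unfolding sum.distrib using ij by simp
  finally show ?thesis using jdata_next(1)[OF jd ij(1)] by auto
qed

lemma jmat_mult_right:
  assumes jd: "jdata n ev pos sz" and X: "X \<in> carrier_mat n n" and ij: "i < n" "j < n"
  shows "(X * jmat n dg pos sz) $$ (i, j) = X $$ (i, j) * dg j + (if 0 < pos j then X $$ (i, j - 1) else 0)"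
proof -
  have eq: "j > 0 \<and> Suc (pos (j - 1)) < sz (j - 1) \<longleftrightarrow> 0 < pos j"
  proof
    assume j: "0 < j \<and> Suc (pos (j - 1)) < sz (j - 1)"
    then have "j - 1 < n" "Suc (j - 1) = j" using ij by auto
    with jdata_next(2)[OF jd, of "j - 1"] j show "0 < pos j" by simp
  next
    assume "0 < pos j"
    from jdata_prev[OF jd ij(2) this] jdataD(1)[OF jd ij(2)] show "0 < j \<and> Suc (pos (j - 1)) < sz (j - 1)" by simp
  qed
  have "(X * jmat n dg pos sz) $$ (i, j) = (\<Sum>l<n. X $$ (i, l) * jmat n dg pos sz $$ (l, j))"
    using X ij by (intro mat_mult_entry) auto
  also have "\<dots> = (\<Sum>l<n. (if l = j then X $$ (i, j) * dg j else 0) + (if l = j - 1 then if 0 < pos j then X $$ (i, j - 1) else 0 else 0))"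
    using ij eq by (intro sum.cong) (auto simp: jmat_index)
  also have "\<dots> = X $$ (i, j) * dg j + (if 0 < pos j then X $$ (i, j - 1) else 0)"
    unfolding sum.distrib using ij by auto
  finally show ?thesis .
qed

lemma jdata_exists:
  assumes "\<And>k a. (k, a) \<in> set L \<Longrightarrow> 0 < k" "n = sum_list (map fst L)"
  shows "\<exists>ev pos sz. jdata n ev pos sz \<and> jordan_matrix L = jmat n ev pos sz"
  using assms
proof (induction L arbitrary: n)
  case Nil
  then show ?case unfolding jdata_def by (intro exI conjI) (auto intro!: eq_matI)
next
  case (Cons ka L)
  obtain k a where ka: "ka = (k, a)" by (cases ka)
  define m where "m = sum_list (map fst L)"
  have n: "n = k + m" using Cons.prems ka m_def by auto
  have "\<exists>ev pos sz. jdata m ev pos sz \<and> jordan_matrix L = jmat m ev pos sz"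
    using Cons.prems(1) m_def by (intro Cons.IH) (auto simp: ka)
  then obtain ev pos sz where IH: "jdata m ev pos sz" "jordan_matrix L = jmat m ev pos sz"
    by blast
  define ev' where "ev' i = (if i < k then a else ev (i - k))" for i
  define pos' where "pos' i = (if i < k then i else pos (i - k))" for i
  define sz' where "sz' i = (if i < k then k else sz (i - k))" for i
  have "jdata n ev' pos' sz'"
    unfolding jdata_def
  proof (intro allI impI)
    fix i assume i: "i < n"
    show "pos' i < sz' i \<and> pos' i \<le> i \<and> i - pos' i + sz' i \<le> n \<and>
         (\<forall>j. i - pos' i \<le> j \<longrightarrow> j < i - pos' i + sz' i \<longrightarrow>
              pos' j = j - (i - pos' i) \<and> sz' j = sz' i \<and> ev' j = ev' i)"
    proof (cases "i < k")
      case True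
      then show ?thesis unfolding pos'_def sz'_def ev'_def using n by auto
    next
      case False
      then have "i - k < m" using i n by auto
      note * = jdataD[OF IH(1) this]
      have "pos' j = j - (i - pos' i) \<and> sz' j = sz' i \<and> ev' j = ev' i"
        if j: "i - pos' i \<le> j" "j < i - pos' i + sz' i" for j
      proof -
        have jk: "\<not> j < k" using j *(2) False unfolding pos'_def by auto
        have p: "pos' i = pos (i - k)" "sz' i = sz (i - k)" using False unfolding pos'_def sz'_def by auto
        have "i - k - pos (i - k) \<le> j - k" "j - k < i - k - pos (i - k) + sz (i - k)"
          using j False jk *(2) unfolding p by linarith+
        from *(4-6)[OF this] show ?thesis using jk False *(2) unfolding pos'_def sz'_def ev'_def by auto
      qed
      moreover have "pos' i = pos (i - k)" "sz' i = sz (i - k)" using False unfolding pos'_def sz'_def by auto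
      moreover have "i - pos (i - k) + sz (i - k) \<le> n" "pos (i - k) \<le> i" using False *(2,3) n by linarith+
      ultimately show ?thesis using *(1) by metis
    qed
  qed
  moreover have "jordan_matrix (ka # L) = jmat n ev' pos' sz'"
  proof (rule eq_matI)
    show "dim_row (jordan_matrix (ka # L)) = dim_row (jmat n ev' pos' sz')"
      "dim_col (jordan_matrix (ka # L)) = dim_col (jmat n ev' pos' sz')" using Cons.prems by auto
    fix i j assume "i < dim_row (jmat n ev' pos' sz')" "j < dim_col (jmat n ev' pos' sz')"
    then have ij: "i < k + m" "j < k + m" using n by auto
    have "jordan_matrix (ka # L) $$ (i, j) = (if i < k then if j < k then jordan_block k a $$ (i, j) else 0
       else if j < k then 0 else jmat m ev pos sz $$ (i - k, j - k))"
      using ij unfolding ka jordan_matrix_Cons IH(2) m_def[symmetric] by (subst index_mat_four_block) auto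
    also have "\<dots> = jmat n ev' pos' sz' $$ (i, j)"
    proof (cases "k \<le> i \<and> k \<le> j")
      case True
      then obtain i' j' where "i = k + i'" "j = k + j'" using le_Suc_ex by blast
      then show ?thesis using ij n unfolding ev'_def pos'_def sz'_def by (simp add: jmat_index)
    next
      case False
      have eq: "jmat n ev' pos' sz' $$ (i, j) = (if i = j then ev' i else if j = Suc i \<and> Suc (pos' i) < sz' i then 1 else 0)"
        using ij n by (simp add: jmat_index)
      show ?thesis
      proof (cases "i < k")
        case True then show ?thesis using False ij unfolding eq ev'_def pos'_def sz'_def by simp
      next
        case i: False
        then have "j < i" using False by simp
        then show ?thesis using False i unfolding eq by simp
      qed
    qed
    finally show "jordan_matrix (ka # L) $$ (i, j) = jmat n ev' pos' sz' $$ (i, j)" .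
  qed
  ultimately show ?case by blast
qed

lemma jordan_basis:
  assumes A: "A \<in> carrier_mat n n"
  obtains P Q ev pos sz where "inverse_mats n P Q" "jdata n ev pos sz" "A = P * jmat n ev pos sz * Q"
proof -
  from char_poly_factorized[OF A] obtain as where "char_poly A = (\<Prod>a\<leftarrow>as. [:- a, 1:])" by auto
  from jordan_nf_exists[OF A this] obtain L where L: "jordan_nf A L" ..
  then obtain P Q where PQ: "similar_mat_wit A (jordan_matrix L) P Q" and L0: "0 \<notin> fst ` set L"
    unfolding jordan_nf_def similar_mat_def by auto
  note w = similar_mat_witD2[OF A PQ]
  have "n = sum_list (map fst L)" using w(5) carrier_matD(1)[OF w(5)] by simp
  moreover have "0 < k" if "(k, a) \<in> set L" for k a using L0 that by (metis fst_conv gr0I image_eqI)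
  ultimately obtain ev pos sz where "jdata n ev pos sz" "jordan_matrix L = jmat n ev pos sz"
    using jdata_exists by blast
  with w that[of P Q] show ?thesis unfolding inverse_mats_def by auto
qed

lemma jmat_upper: "upper_triangular (jmat n dg pos sz)"
  unfolding upper_triangular_def by (auto simp: jmat_index)

lemma upper_triangular_eigenvalue:
  assumes T: "T \<in> carrier_mat n n" "upper_triangular T" and PQ: "inverse_mats n P Q"
  shows "eigenvalue (P * T * Q) x \<longleftrightarrow> (\<exists>i<n. T $$ (i, i) = x)"
proof -
  note a = inverse_matsD[OF PQ]
  have c: "P * T * Q \<in> carrier_mat n n" using a T by auto
  have "similar_mat (P * T * Q) T" using a T by (intro similar_matI[of _ _ P Q n]) auto
  then have "char_poly (P * T * Q) = (\<Prod>a\<leftarrow>diag_mat T. [:- a, 1:])"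
    using char_poly_similar char_poly_upper_triangular[OF T] by metis
  then have "eigenvalue (P * T * Q) x \<longleftrightarrow> poly (\<Prod>a\<leftarrow>diag_mat T. [:- a, 1:]) x = 0"
    using eigenvalue_root_char_poly[OF c] by simp
  also have "\<dots> \<longleftrightarrow> x \<in> set (diag_mat T)" by (simp add: poly_prod_list prod_list_zero_iff o_def) (auto simp: image_iff)
  also have "\<dots> \<longleftrightarrow> (\<exists>i<n. T $$ (i, i) = x)" using T(1) unfolding diag_mat_def by (auto simp: image_iff)
  finally show ?thesis .
qed

text \<open>Used with \<open>s = 1\<close> for commuting and \<open>s = - 1\<close> for anticommuting matrices.\<close>

lemma jordan_intertwiner_zero:
  assumes jd: "jdata n ev pos sz" and X: "X \<in> carrier_mat n n"
    and eq: "jmat n ev pos sz * X = s \<cdot>\<^sub>m (X * jmat n ev pos sz)"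
    and ij: "i < n" "j < n" "ev i \<noteq> s * ev j"
  shows "X $$ (i, j) = 0"
  using ij
\<comment> \<open>Comparing entries expresses \<open>(ev i - s ev j) X_ij\<close> through the
  entries at \<open>(i + 1, j)\<close> and \<open>(i, j - 1)\<close>, present only inside the same
  blocks. They have the same eigenvalues and a smaller measure.\<close>
proof (induction "n - i + j" arbitrary: i j rule: less_induct)
  case less
  have "(jmat n ev pos sz * X) $$ (i, j) = s * (X * jmat n ev pos sz) $$ (i, j)"
    unfolding eq using X less.prems by simp
  then have e: "ev i * X $$ (i, j) + (if Suc (pos i) < sz i then X $$ (Suc i, j) else 0) =
     s * (X $$ (i, j) * ev j + (if 0 < pos j then X $$ (i, j - 1) else 0))"
    unfolding jmat_mult_left[OF jd X less.prems(1,2)] jmat_mult_right[OF jd X less.prems(1,2)] .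
  have "(if Suc (pos i) < sz i then X $$ (Suc i, j) else 0) = 0"
    using less.hyps[of "Suc i" j] jdata_next[OF jd less.prems(1)] less.prems by auto
  moreover have "(if 0 < pos j then X $$ (i, j - 1) else 0) = 0"
    using less.hyps[of i "j - 1"] jdata_prev[OF jd less.prems(2)] less.prems by auto
  ultimately have "(ev i - s * ev j) * X $$ (i, j) = 0" using e by (simp add: algebra_simps)
  then show ?case using less.prems(3) by simp
qed

lemma reindex_conj:
  assumes "bij_betw \<sigma> {..<n} {..<n}"
  obtains P Q where "inverse_mats n P Q" "\<And>X. X \<in> carrier_mat n n \<Longrightarrow> Q * X * P = mat n n (\<lambda>(i, j). X $$ (\<sigma> i, \<sigma> j))"
proof -
  define P :: "complex mat" where "P = mat n n (\<lambda>(i, j). if i = \<sigma> j then 1 else 0)"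
  define Q :: "complex mat" where "Q = mat n n (\<lambda>(i, j). if j = \<sigma> i then 1 else 0)"
  have c: "P \<in> carrier_mat n n" "Q \<in> carrier_mat n n" unfolding P_def Q_def by auto
  have s: "\<sigma> i < n" if "i < n" for i using assms that unfolding bij_betw_def by auto
  have inj: "\<sigma> i = \<sigma> j \<longleftrightarrow> i = j" if "i < n" "j < n" for i j using assms that unfolding bij_betw_def inj_on_def by auto
  have Xr: "(X * P) $$ (i, j) = X $$ (i, \<sigma> j)" if "X \<in> carrier_mat n n" "i < n" "j < n" for X i j
  proof -
    have "(X * P) $$ (i, j) = (\<Sum>l<n. X $$ (i, l) * P $$ (l, j))" using that c by (intro mat_mult_entry) auto
    also have "\<dots> = (\<Sum>l<n. if l = \<sigma> j then X $$ (i, l) else 0)" using that unfolding P_def by (intro sum.cong) auto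
    finally show ?thesis using s that by simp
  qed
  have Xl: "(Q * X) $$ (i, j) = X $$ (\<sigma> i, j)" if "X \<in> carrier_mat n n" "i < n" "j < n" for X i j
  proof -
    have "(Q * X) $$ (i, j) = (\<Sum>l<n. Q $$ (i, l) * X $$ (l, j))" using that c by (intro mat_mult_entry) auto
    also have "\<dots> = (\<Sum>l<n. if l = \<sigma> i then X $$ (l, j) else 0)" using that unfolding Q_def by (intro sum.cong) auto
    finally show ?thesis using s that by simp
  qed
  have QP: "Q * P = 1\<^sub>m n"
    using c s inj by (intro eq_matI) (auto simp: Xr simp del: index_mult_mat(1), auto simp: Q_def)
  then have "P * Q = 1\<^sub>m n" using mat_mult_left_right_inverse[OF c(2,1)] by auto
  then have "inverse_mats n P Q" using QP c unfolding inverse_mats_def by auto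
  moreover have "Q * X * P = mat n n (\<lambda>(i, j). X $$ (\<sigma> i, \<sigma> j))" if "X \<in> carrier_mat n n" for X
    using c s that by (intro eq_matI) (auto simp: Xr Xl simp del: index_mult_mat(1))
  ultimately show ?thesis using that by blast
qed

lemma bij_betw_partition:
  assumes "S \<subseteq> {..<n}"
  obtains \<sigma> where "bij_betw \<sigma> {..<n} {..<n}" "\<And>i. i < n \<Longrightarrow> \<sigma> i \<in> S \<longleftrightarrow> i < card S"
proof -
  define k where "k = card S"
  have fin: "finite S" using assms finite_subset by blast
  have k: "k \<le> n" unfolding k_def using card_mono[OF _ assms] by simp
  obtain f where f: "bij_betw f {..<k} S" using ex_bij_betw_nat_finite[OF fin] unfolding k_def atLeast0LessThan by auto
  have "card {k..<n} = card ({..<n} - S)" using assms fin k by (simp add: card_Diff_subset k_def)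
  from finite_same_card_bij[OF _ _ this] obtain g where g: "bij_betw g {k..<n} ({..<n} - S)" by auto
  define \<sigma> where "\<sigma> i = (if i \<in> {..<k} then f i else g i)" for i
  have "bij_betw \<sigma> ({..<k} \<union> {k..<n}) (S \<union> ({..<n} - S))"
    unfolding \<sigma>_def using f g by (intro bij_betw_disjoint_Un) auto
  moreover have "{..<k} \<union> {k..<n} = {..<n}" "S \<union> ({..<n} - S) = {..<n}" using k assms by auto
  ultimately have "bij_betw \<sigma> {..<n} {..<n}" by simp
  moreover have "\<sigma> i \<in> S \<longleftrightarrow> i < k" if "i < n" for i
  proof (cases "i < k")
    case True then show ?thesis using bij_betwE[OF f] unfolding \<sigma>_def by simp
  next
    case False then show ?thesis using bij_betwE[OF g] that unfolding \<sigma>_def by simp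
  qed
  ultimately show ?thesis using that unfolding k_def by blast
qed

text \<open>Reordering the indices so that \<open>S\<close> comes first turns the pair into a direct
  sum of two smaller pairs. Their anticommutation is read off blockwise, and
  \<open>dsum_good\<close> combines them.\<close>

lemma good_if_block_diagonal:
  assumes IH: "\<And>k. 0 < k \<Longrightarrow> k < n \<Longrightarrow> Zn k \<subseteq> good k" and AB: "(A, B) \<in> Zn n"
    and S: "S \<subseteq> {..<n}" "S \<noteq> {}" "S \<noteq> {..<n}"
    and z: "\<And>i j. i < n \<Longrightarrow> j < n \<Longrightarrow> (i \<in> S) \<noteq> (j \<in> S) \<Longrightarrow> A $$ (i, j) = 0 \<and> B $$ (i, j) = 0"
  shows "(A, B) \<in> good n"
proof -
  obtain \<sigma> where \<sigma>: "bij_betw \<sigma> {..<n} {..<n}" "\<And>i. i < n \<Longrightarrow> \<sigma> i \<in> S \<longleftrightarrow> i < card S"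
    by (rule bij_betw_partition[OF S(1)]) blast
  obtain P Q where PQ: "inverse_mats n P Q" "\<And>X. X \<in> carrier_mat n n \<Longrightarrow> Q * X * P = mat n n (\<lambda>(i, j). X $$ (\<sigma> i, \<sigma> j))"
    by (rule reindex_conj[OF \<sigma>(1)]) blast
  define k where "k = card S"
  define m where "m = n - k"
  have fin: "finite S" using S finite_subset by blast
  have "k > 0" "k < n" using S fin psubset_card_mono[of "{..<n}" S] unfolding k_def by (auto simp: card_gt_0_iff)
  then have km: "k > 0" "k < n" "m > 0" "m < n" "n = k + m" unfolding m_def by auto
  have c: "A \<in> carrier_mat n n" "B \<in> carrier_mat n n" "A * B + B * A = 0\<^sub>m n n" using AB unfolding Zn_iff by auto
  have s: "\<sigma> i < n" if "i < n" for i using \<sigma>(1) that unfolding bij_betw_def by auto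
  define bl where "bl X = (mat k k (\<lambda>(i, j). X $$ (\<sigma> i, \<sigma> j)), mat m m (\<lambda>(i, j). X $$ (\<sigma> (i + k), \<sigma> (j + k))))" for X :: "complex mat"
  have blc: "fst (bl X) \<in> carrier_mat k k" "snd (bl X) \<in> carrier_mat m m" for X unfolding bl_def by auto
  have ds: "Q * X * P = dsum_mat (fst (bl X)) (snd (bl X))"
    if X: "X \<in> carrier_mat n n" and zX: "\<And>i j. i < n \<Longrightarrow> j < n \<Longrightarrow> (i \<in> S) \<noteq> (j \<in> S) \<Longrightarrow> X $$ (i, j) = 0" for X
    unfolding PQ(2)[OF X]
  proof (rule eq_matI)
    fix i j assume "i < dim_row (dsum_mat (fst (bl X)) (snd (bl X)))" "j < dim_col (dsum_mat (fst (bl X)) (snd (bl X)))"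
    then have ij: "i < k + m" "j < k + m" using dsum_mat_carrier[OF blc, of X X] by auto
    have "X $$ (\<sigma> i, \<sigma> j) = 0" if "(i < k) \<noteq> (j < k)"
      using zX[of "\<sigma> i" "\<sigma> j"] s \<sigma>(2) ij km(5) that unfolding k_def by auto
    then show "mat n n (\<lambda>(i, j). X $$ (\<sigma> i, \<sigma> j)) $$ (i, j) = dsum_mat (fst (bl X)) (snd (bl X)) $$ (i, j)"
      using ij km unfolding dsum_mat_index[OF blc ij] by (auto simp: bl_def)
  qed (use dsum_mat_carrier[OF blc, of X X] km in auto)
  define x where "x = (fst (bl A), fst (bl B))"
  define y where "y = (snd (bl A), snd (bl B))"
  have d: "cj Q P (A, B) = dsum x y"
    unfolding cj_def dsum_def x_def y_def using ds[OF c(1)] ds[OF c(2)] z by auto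
  have "dsum x y \<in> Zn n" using Zn_cj[OF inverse_mats_sym[OF PQ(1)] AB] d by simp
  then have "dsum_mat (fst x * snd x + snd x * fst x) (fst y * snd y + snd y * fst y) = 0\<^sub>m (k + m) (k + m)"
    unfolding dsum_def Zn_iff x_def y_def using blc km(5)
      dsum_mat_add[OF mult_carrier_mat[OF blc(1) blc(1)] mult_carrier_mat[OF blc(2) blc(2)]
        mult_carrier_mat[OF blc(1) blc(1)] mult_carrier_mat[OF blc(2) blc(2)], of A B A B B A B A]
    by (simp add: dsum_mat_mult[of _ k _ m])
  then have zz: "dsum_mat (fst x * snd x + snd x * fst x) (fst y * snd y + snd y * fst y) $$ (i, j) = 0" if "i < k + m" "j < k + m" for i j
    using that by simp
  have cc: "fst x * snd x + snd x * fst x \<in> carrier_mat k k" "fst y * snd y + snd y * fst y \<in> carrier_mat m m"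
    using blc(1)[of A] blc(1)[of B] blc(2)[of A] blc(2)[of B] unfolding x_def y_def by auto
  have "fst x * snd x + snd x * fst x = 0\<^sub>m k k"
  proof (rule eq_matI)
    fix i j assume "i < dim_row (0\<^sub>m k k :: complex mat)" "j < dim_col (0\<^sub>m k k :: complex mat)"
    then show "(fst x * snd x + snd x * fst x) $$ (i, j) = 0\<^sub>m k k $$ (i, j)"
      using zz[of i j] dsum_mat_index[OF cc, of i j] by auto
  qed (use cc in auto)
  moreover have "fst y * snd y + snd y * fst y = 0\<^sub>m m m"
  proof (rule eq_matI)
    fix i j assume "i < dim_row (0\<^sub>m m m :: complex mat)" "j < dim_col (0\<^sub>m m m :: complex mat)"
    then show "(fst y * snd y + snd y * fst y) $$ (i, j) = 0\<^sub>m m m $$ (i, j)"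
      using zz[of "i + k" "j + k"] dsum_mat_index[OF cc, of "i + k" "j + k"] by auto
  qed (use cc in auto)
  ultimately have "x \<in> Zn k" "y \<in> Zn m" using blc unfolding x_def y_def Zn_iff by auto
  then have "dsum x y \<in> good (k + m)" using IH[of k] IH[of m] km(1-4) by (intro dsum_good) blast+
  then have "cj Q P (A, B) \<in> good n" using d km(5) by simp
  then show ?thesis using good_cj_iff[OF inverse_mats_sym[OF PQ(1)], of "(A, B)"] c unfolding M2_def by auto
qed

text \<open>In a Jordan basis of \<open>M\<close>, every matrix commuting with \<open>M\<close> has
  zero entries between different eigenvalues. Grouping the indices with eigenvalue \<open>x\<close>
  makes both \<open>A\<close> and \<open>B\<close> block diagonal.\<close>

lemma good_if_split:
  assumes IH: "\<And>k. 0 < k \<Longrightarrow> k < n \<Longrightarrow> Zn k \<subseteq> good k" and AB: "(A, B) \<in> Zn n"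
    and M: "M \<in> carrier_mat n n" "M * A = A * M" "M * B = B * M"
    and ev: "eigenvalue M x" "eigenvalue M y" "x \<noteq> y"
  shows "(A, B) \<in> good n"
proof -
  obtain P Q e pos sz where j: "inverse_mats n P Q" "jdata n e pos sz" "M = P * jmat n e pos sz * Q"
    by (rule jordan_basis[OF M(1)])
  note a = inverse_matsD[OF j(1)]
  have c: "A \<in> carrier_mat n n" "B \<in> carrier_mat n n" using AB unfolding Zn_iff by auto
  define S where "S = {i. i < n \<and> e i = x}"
  have es: "\<exists>i<n. e i = x" "\<exists>i<n. e i = y"
    using ev(1,2) upper_triangular_eigenvalue[OF jmat_carrier(1) jmat_upper j(1), of e pos sz] unfolding j(3)
    by (auto simp: jmat_index)
  have z: "(Q * X * P) $$ (i, l) = 0" if X: "X \<in> carrier_mat n n" "M * X = X * M" and il: "i < n" "l < n" "(i \<in> S) \<noteq> (l \<in> S)" for X i l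
  proof (rule jordan_intertwiner_zero[OF j(2), where s = 1])
    have J: "Q * M * P = jmat n e pos sz" unfolding j(3) using conj_cancel(2)[OF j(1)] by simp
    have "jmat n e pos sz * (Q * X * P) = Q * (M * X) * P"
      using conj_mult[OF inverse_mats_sym[OF j(1)] M(1) X(1)] unfolding J .
    also have "\<dots> = Q * X * P * jmat n e pos sz"
      using conj_mult[OF inverse_mats_sym[OF j(1)] X(1) M(1)] X(2) unfolding J by simp
    finally show "jmat n e pos sz * (Q * X * P) = 1 \<cdot>\<^sub>m (Q * X * P * jmat n e pos sz)"
      by (auto intro!: eq_matI)
    show "e i \<noteq> 1 * e l" using il unfolding S_def by auto
  qed (use il a X in auto)
  have "cj Q P (A, B) \<in> good n"
    unfolding cj_def fst_conv snd_conv
  proof (rule good_if_block_diagonal[OF IH, where S = S])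
    show "(Q * A * P, Q * B * P) \<in> Zn n" using Zn_cj[OF inverse_mats_sym[OF j(1)] AB] unfolding cj_def by simp
    obtain i1 i2 where "i1 \<in> S" "i2 < n" "i2 \<notin> S" using es ev(3) unfolding S_def by auto
    then show "S \<noteq> {}" "S \<noteq> {..<n}" by auto
    show "S \<subseteq> {..<n}" unfolding S_def by auto
    fix i l assume "i < n" "l < n" "(i \<in> S) \<noteq> (l \<in> S)"
    then show "(Q * A * P) $$ (i, l) = 0 \<and> (Q * B * P) $$ (i, l) = 0"
      using z[OF c(1) M(2)] z[OF c(2) M(3)] by blast
  qed
  then show ?thesis using good_cj_iff[OF inverse_mats_sym[OF j(1)], of "(A, B)"] c unfolding M2_def by auto
qed

subsection \<open>Deforming a Jordan basis together with an anticommuting matrix\<close>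

text \<open>Entry \<open>(i, j)\<close> of the product of the matrices \<open>N - s (k + e)\<close>, \<open>e < d\<close>, where \<open>N\<close> has diagonal
  \<open>0, s, 2 s, \<dots>\<close> and ones above it: an element of the commutant of \<open>N\<close> that deforms the \<open>d\<close>-th power of the shift.
  The roots are chosen such that the upper left \<open>k \<times> l\<close> corner still intertwines when \<open>d \<ge> l - k\<close>.\<close>

fun toe :: "nat \<Rightarrow> complex \<Rightarrow> nat \<Rightarrow> nat \<Rightarrow> nat \<Rightarrow> complex" where
  "toe k s 0 i j = (if i = j then 1 else 0)"
| "toe k s (Suc d) i j = (if 0 < j then toe k s d i (j - 1) else 0) + s * (of_nat j - of_nat (k + d)) * toe k s d i j"

text \<open>This is commutation with \<open>N\<close> read entrywise and solved for row
  \<open>i + 1\<close>; the diagonal entry of \<open>N\<close> at \<open>i\<close> is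
  \<open>s i\<close>.\<close>

lemma toe_commute:
  "toe k s d (Suc i) j = (if 0 < j then toe k s d i (j - 1) else 0) + s * (of_nat j - of_nat i) * toe k s d i j"
proof (induction d arbitrary: i j)
  case 0 then show ?case by auto
next
  case (Suc d)
  show ?case
  proof (cases j)
    case 0 then show ?thesis using Suc[of i 0] by simp
  next
    case (Suc j')
    define a b c where "a = toe k s d i j'" "b = toe k s d i (Suc j')" "c = (if 0 < j' then toe k s d i (j' - 1) else 0)"
    have "toe k s (Suc d) (Suc i) (Suc j') = (c + s * (of_nat j' - of_nat i) * a)
        + s * (of_nat (Suc j') - of_nat (k + d)) * (a + s * (of_nat (Suc j') - of_nat i) * b)"
      using Suc.IH[of i j'] Suc.IH[of i "Suc j'"] unfolding a_b_c_def by simp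
    also have "\<dots> = (c + s * (of_nat j' - of_nat (k + d)) * a) + s * (of_nat (Suc j') - of_nat i) *
        (a + s * (of_nat (Suc j') - of_nat (k + d)) * b)"
      by (simp add: algebra_simps)
    also have "\<dots> = toe k s (Suc d) i j' + s * (of_nat (Suc j') - of_nat i) * toe k s (Suc d) i (Suc j')"
      unfolding a_b_c_def by simp
    finally show ?thesis unfolding Suc by (simp del: toe.simps)
  qed
qed

text \<open>The roots are made for this row: row \<open>k + e\<close> of
  \<open>N - s (k + e)\<close> has zero diagonal entry, so each factor moves the unit row vector
  exactly one place to the right.\<close>

lemma toe_row_eq: "toe k s d k j = (if j = k + d then 1 else 0)"
  by (induction d arbitrary: j) auto

text \<open>Row \<open>k\<close> is the first one below a block of \<open>k\<close> rows. Its
  vanishing over \<open>l\<close> columns lets the truncated corner satisfy the same relation at its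
  bottom edge.\<close>

lemma toe_row:
  assumes "j < l" "l - k \<le> d" shows "toe k s d k j = 0"
  using assms by (simp add: toe_row_eq)

lemma toe_0: "toe k 0 d i j = (if j = i + d then 1 else 0)"
  by (induction d arbitrary: j) auto

lemma polyf_toe: "polyf (\<lambda>t. toe k (- t * c) d i j)"
proof (induction d arbitrary: j)
  case 0 show ?case by (simp only: toe.simps, rule polyf_const)
next
  case (Suc d)
  show ?case unfolding toe.simps
    by (intro polyf_add polyf_if polyf_mult polyf_const Suc polyf_uminus polyf_id)
qed

text \<open>Between blocks with opposite eigenvalues the equation becomes X(i+1, j) = - X(i, j-1),
  so entries alternate in sign along diagonals. A diagonal that meets the first column below its
  top, or the last row before its end, is zero. The surviving offsets \<open>pos j - pos i\<close>
  are those from max(0, sz j - sz i) up to \<open>sz j - 1\<close>.\<close>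

lemma jordan_anticommutant_toeplitz:
  assumes jd: "jdata n ev pos sz" and X: "X \<in> carrier_mat n n"
    and ac: "jmat n ev pos sz * X + X * jmat n ev pos sz = 0\<^sub>m n n"
    and ij: "i < n" "j < n"
  shows "ev i + ev j \<noteq> 0 \<Longrightarrow> X $$ (i, j) = 0"
    and "pos i \<le> pos j \<Longrightarrow> X $$ (i, j) = (- 1) ^ pos i * X $$ (i - pos i, j - pos i)"
    and "pos j < pos i \<Longrightarrow> X $$ (i, j) = 0"
    and "pos j + sz i < sz j + pos i \<Longrightarrow> X $$ (i, j) = 0"
proof -
  have e: "(ev i + ev j) * X $$ (i, j) + (if Suc (pos i) < sz i then X $$ (Suc i, j) else 0)
      + (if 0 < pos j then X $$ (i, j - 1) else 0) = 0" if "i < n" "j < n" for i j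
  proof -
    have "(jmat n ev pos sz * X + X * jmat n ev pos sz) $$ (i, j) =
        (jmat n ev pos sz * X) $$ (i, j) + (X * jmat n ev pos sz) $$ (i, j)"
      using that X by (intro index_add_mat) auto
    then have "(jmat n ev pos sz * X) $$ (i, j) + (X * jmat n ev pos sz) $$ (i, j) = 0"
      unfolding ac using that by simp
    then show ?thesis unfolding jmat_mult_left[OF jd X that] jmat_mult_right[OF jd X that] by (simp add: algebra_simps)
  qed
  have z: "X $$ (i, j) = 0" if "i < n" "j < n" "ev i + ev j \<noteq> 0" for i j
  proof (rule jordan_intertwiner_zero[OF jd X, where s = "- 1"])
    show "jmat n ev pos sz * X = - 1 \<cdot>\<^sub>m (X * jmat n ev pos sz)"
    proof (rule eq_matI)
      fix a b assume ab: "a < dim_row (- 1 \<cdot>\<^sub>m (X * jmat n ev pos sz))" "b < dim_col (- 1 \<cdot>\<^sub>m (X * jmat n ev pos sz))"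
      then have "(jmat n ev pos sz * X + X * jmat n ev pos sz) $$ (a, b) = 0" unfolding ac using X by simp
      then show "(jmat n ev pos sz * X) $$ (a, b) = (- 1 \<cdot>\<^sub>m (X * jmat n ev pos sz)) $$ (a, b)"
        using ab X by (simp add: eq_neg_iff_add_eq_0 del: index_mult_mat(1))
    qed (use X in auto)
    show "ev i \<noteq> - 1 * ev j" using that(3) by (simp add: eq_neg_iff_add_eq_0)
  qed (use that in auto)
  show "ev i + ev j \<noteq> 0 \<Longrightarrow> X $$ (i, j) = 0" using z ij .
  have up: "X $$ (i, j) = - (if 0 < pos j then X $$ (i - 1, j - 1) else 0)" if "i < n" "j < n" "0 < pos i" for i j
  proof (cases "ev i + ev j = 0")
    case True
    note p = jdata_prev[OF jd that(1,3)]
    have i: "Suc (i - 1) = i" using p(1) by simp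
    have "Suc (pos (i - 1)) < sz (i - 1)" using p jdataD(1)[OF jd that(1)] by simp
    then show ?thesis using e[of "i - 1" j] that p True unfolding i by (simp add: eq_neg_iff_add_eq_0)
  next
    case False
    have "X $$ (i - 1, j - 1) = 0" if "0 < pos j"
      using z[of "i - 1" "j - 1"] jdata_prev[OF jd \<open>i < n\<close> \<open>0 < pos i\<close>] jdata_prev[OF jd \<open>j < n\<close> that] False \<open>i < n\<close> \<open>j < n\<close>
      by auto
    then show ?thesis using z[OF that(1,2) False] by simp
  qed
  show "pos i \<le> pos j \<Longrightarrow> X $$ (i, j) = (- 1) ^ pos i * X $$ (i - pos i, j - pos i)"
    using ij
  proof (induction "pos i" arbitrary: i j)
    case (Suc a)
    then have pi: "0 < pos i" and pj: "0 < pos j" by auto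
    note p = jdata_prev[OF jd Suc.prems(2) pi] and q = jdata_prev[OF jd Suc.prems(3) pj]
    have a: "a = pos (i - 1)" using p(2) Suc.hyps(2) by simp
    have "X $$ (i - 1, j - 1) = (- 1) ^ pos (i - 1) * X $$ (i - 1 - pos (i - 1), j - 1 - pos (i - 1))"
      using Suc.prems p q by (intro Suc.hyps(1)[OF a]) auto
    moreover have "i - 1 - pos (i - 1) = i - pos i" "j - 1 - pos (i - 1) = j - pos i" using p(2) by auto
    ultimately have "X $$ (i - 1, j - 1) = (- 1) ^ pos (i - 1) * X $$ (i - pos i, j - pos i)" by simp
    moreover have "(- 1) ^ pos i = - ((- 1) ^ pos (i - 1) :: complex)" by (subst p(2)[symmetric]) simp
    ultimately show ?case using up[OF Suc.prems(2,3) pi] pj by simp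
  qed simp
  show "pos j < pos i \<Longrightarrow> X $$ (i, j) = 0"
    using ij
  proof (induction "pos j" arbitrary: i j)
    case 0 then show ?case using up[of i j] by simp
  next
    case (Suc a)
    then have pi: "0 < pos i" and pj: "0 < pos j" by auto
    note p = jdata_prev[OF jd Suc.prems(2) pi] and q = jdata_prev[OF jd Suc.prems(3) pj]
    have a: "a = pos (j - 1)" using q(2) Suc.hyps(2) by simp
    have "X $$ (i - 1, j - 1) = 0"
      using Suc.prems p q by (intro Suc.hyps(1)[OF a]) auto
    then show ?case using up[OF Suc.prems(2,3) pi] by simp
  qed
  show "pos j + sz i < sz j + pos i \<Longrightarrow> X $$ (i, j) = 0"
    using ij
  proof (induction "sz i - pos i" arbitrary: i j)
    case 0 then show ?case using jdataD(1)[OF jd, of i] by simp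
  next
    case (Suc a)
    have j: "Suc (pos j) < sz j" using Suc.prems Suc.hyps(2) by linarith
    note q = jdata_next[OF jd Suc.prems(3) j]
    show ?case
    proof (cases "ev i + ev j = 0")
      case True
      then have e': "(if Suc (pos i) < sz i then X $$ (Suc i, Suc j) else 0) + X $$ (i, j) = 0"
        using e[of i "Suc j"] Suc.prems q by simp
      show ?thesis
      proof (cases "Suc (pos i) < sz i")
        case i: True
        note p = jdata_next[OF jd Suc.prems(2) i]
        have x0: "X $$ (Suc i, Suc j) = 0" using p q Suc.prems Suc.hyps(2) by (intro Suc.hyps(1)) auto
        show ?thesis using e' unfolding x0 if_P[OF i] by (rule trans[OF add_0_left[symmetric]])
      qed (use e' in simp)
    next
      case False then show ?thesis using z Suc.prems by simp
    qed
  qed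
qed

text \<open>Each surviving Toeplitz diagonal \<open>d\<close> keeps its coefficient, read in the
  first row of the block, while the \<open>d\<close>-th power of the shift is replaced by
  \<open>toe\<close>. The sign turns a commuting matrix into an anticommuting one,
  \<open>sz i\<close> is the number of rows, and truncated subtraction in \<open>sz j - sz i\<close>
  supplies the maximum with 0.\<close>

definition deformed :: "nat \<Rightarrow> (nat \<Rightarrow> complex) \<Rightarrow> (nat \<Rightarrow> nat) \<Rightarrow> (nat \<Rightarrow> nat) \<Rightarrow> complex mat \<Rightarrow> complex \<Rightarrow> complex mat" where
  "deformed n ev pos sz X t = mat n n (\<lambda>(i, j). if ev i + ev j = 0 then
     (- 1) ^ pos i * (\<Sum>d\<in>{sz j - sz i..<sz j}. X $$ (i - pos i, j - pos j + d) * toe (sz i) (- t * ev i) d (pos i) (pos j)) else 0)"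

lemma deformed_0:
  assumes jd: "jdata n ev pos sz" and X: "X \<in> carrier_mat n n"
    and ac: "jmat n ev pos sz * X + X * jmat n ev pos sz = 0\<^sub>m n n"
  shows "deformed n ev pos sz X 0 = X"
proof (rule eq_matI)
  fix i j assume "i < dim_row X" "j < dim_col X"
  then have ij: "i < n" "j < n" using X by auto
  note t = jordan_anticommutant_toeplitz[OF jd X ac ij]
  show "deformed n ev pos sz X 0 $$ (i, j) = X $$ (i, j)"
  proof (cases "ev i + ev j = 0")
    case True
    let ?S = "{sz j - sz i..<sz j}"
    \<comment> \<open>At parameter 0 \<open>toe\<close> is a power of the shift, so only the summand
      \<open>d = pos j - pos i\<close> can contribute.\<close>
    have s: "deformed n ev pos sz X 0 $$ (i, j) = (- 1) ^ pos i *
       (\<Sum>d\<in>?S. X $$ (i - pos i, j - pos j + d) * (if pos j = pos i + d then 1 else 0))"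
      using ij True unfolding deformed_def by (simp add: toe_0)
    show ?thesis
    proof (cases "pos i \<le> pos j \<and> \<not> pos j + sz i < sz j + pos i")
      case le: True
      then have d: "pos j - pos i \<in> ?S" using jdataD(1)[OF jd ij(2)] by auto
      have "(\<Sum>d\<in>?S. X $$ (i - pos i, j - pos j + d) * (if pos j = pos i + d then 1 else 0)) =
        (\<Sum>d\<in>?S. if d = pos j - pos i then X $$ (i - pos i, j - pos j + d) else 0)"
        using le by (intro sum.cong) auto
      also have "\<dots> = X $$ (i - pos i, j - pos j + (pos j - pos i))" using d by simp
      also have "j - pos j + (pos j - pos i) = j - pos i" using le jdataD(2)[OF jd ij(2)] by auto
      finally show ?thesis unfolding s using t(2) le by simp
    next
      case False
      then have "X $$ (i, j) = 0" using t(3,4) by (meson not_le)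
      moreover have "(\<Sum>d\<in>?S. X $$ (i - pos i, j - pos j + d) * (if pos j = pos i + d then 1 else 0)) = 0"
        using False by (intro sum.neutral) auto
      ultimately show ?thesis unfolding s by simp
    qed
  next
    case False then show ?thesis using ij t(1) unfolding deformed_def by simp
  qed
qed (use X in \<open>auto simp: deformed_def\<close>)

text \<open>For opposite eigenvalues the diagonal entries add up to
  \<open>t * ev i * (pos i - pos j)\<close>. With \<open>s = - t * ev i\<close> this is the term
  that \<open>toe_commute\<close> cancels, for every offset \<open>d\<close> separately.\<close>

lemma deformed_anticommutes:
  assumes jd: "jdata n ev pos sz"
  shows "(jmat n (\<lambda>i. ev i * (1 + t * of_nat (pos i))) pos sz, deformed n ev pos sz X t) \<in> Zn n"
proof -
  define Y where "Y = deformed n ev pos sz X t"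
  define dg where "dg i = ev i * (1 + t * of_nat (pos i))" for i
  have Y: "Y \<in> carrier_mat n n" unfolding Y_def deformed_def by auto
  have "jmat n dg pos sz * Y + Y * jmat n dg pos sz = 0\<^sub>m n n"
  proof (rule eq_matI)
    fix i j assume "i < dim_row (0\<^sub>m n n :: complex mat)" "j < dim_col (0\<^sub>m n n :: complex mat)"
    then have ij: "i < n" "j < n" by auto
    have Y0: "Y $$ (a, b) = 0" if "a < n" "b < n" "ev a + ev b \<noteq> 0" for a b
      using that unfolding Y_def deformed_def by simp
    have "(jmat n dg pos sz * Y + Y * jmat n dg pos sz) $$ (i, j) =
        (jmat n dg pos sz * Y) $$ (i, j) + (Y * jmat n dg pos sz) $$ (i, j)"
      using ij Y by (intro index_add_mat) auto
    also have "\<dots> = (dg i + dg j) * Y $$ (i, j) + (if Suc (pos i) < sz i then Y $$ (Suc i, j) else 0)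
      + (if 0 < pos j then Y $$ (i, j - 1) else 0)"
      unfolding jmat_mult_left[OF jd Y ij] jmat_mult_right[OF jd Y ij] by (simp add: algebra_simps)
    also have "\<dots> = 0"
    proof (cases "ev i + ev j = 0")
      case False
      have "Suc (pos i) < sz i \<Longrightarrow> Y $$ (Suc i, j) = 0" using jdata_next[OF jd ij(1)] Y0[of "Suc i" j] ij False by simp
      moreover have "0 < pos j \<Longrightarrow> Y $$ (i, j - 1) = 0" using jdata_prev[OF jd ij(2)] Y0[of i "j - 1"] ij False by simp
      ultimately show ?thesis using Y0[OF ij False] by simp
    next
      case True
      define c where "c d = X $$ (i - pos i, j - pos j + d)" for d
      define T where "T d = toe (sz i) (- t * ev i) d" for d
      let ?S = "{sz j - sz i..<sz j}"
      have 1: "Y $$ (i, j) = (- 1) ^ pos i * (\<Sum>d\<in>?S. c d * T d (pos i) (pos j))"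
        using ij True unfolding Y_def deformed_def c_def T_def by simp
      have 2: "Y $$ (Suc i, j) = - ((- 1) ^ pos i * (\<Sum>d\<in>?S. c d * T d (Suc (pos i)) (pos j)))" if "Suc (pos i) < sz i"
      proof -
        note p = jdata_next[OF jd ij(1) that]
        have "Suc i - pos (Suc i) = i - pos i" using p(2) by simp
        then show ?thesis using ij True p unfolding Y_def deformed_def c_def T_def by simp
      qed
      \<comment> \<open>The formula persists in the last row of the block, where no entry lies
        below: \<open>toe_row\<close> makes the right-hand side vanish there.\<close>
      have 2: "(if Suc (pos i) < sz i then Y $$ (Suc i, j) else 0) = - ((- 1) ^ pos i * (\<Sum>d\<in>?S. c d * T d (Suc (pos i)) (pos j)))"
      proof (cases "Suc (pos i) < sz i")
        case False
        then have "Suc (pos i) = sz i" using jdataD(1)[OF jd ij(1)] by simp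
        then have "T d (Suc (pos i)) (pos j) = 0" if "d \<in> ?S" for d
          using toe_row[OF jdataD(1)[OF jd ij(2)], of "sz i" d] that unfolding T_def by simp
        then show ?thesis using False by simp
      qed (use 2 in simp)
      have 3: "(if 0 < pos j then Y $$ (i, j - 1) else 0) = (- 1) ^ pos i * (\<Sum>d\<in>?S. c d * (if 0 < pos j then T d (pos i) (pos j - 1) else 0))"
      proof (cases "0 < pos j")
        case pj: True
        note p = jdata_prev[OF jd ij(2) pj]
        have "j - 1 - pos (j - 1) = j - pos j" "pos (j - 1) = pos j - 1" using p(2) by auto
        then show ?thesis using ij True p pj unfolding Y_def deformed_def c_def T_def by simp
      qed simp
      have "ev j = - ev i" using True by (simp add: eq_neg_iff_add_eq_0 add.commute)
      then have dd: "dg i + dg j = t * ev i * (of_nat (pos i) - of_nat (pos j))" unfolding dg_def by (simp add: algebra_simps)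
      have "(dg i + dg j) * Y $$ (i, j) + (if Suc (pos i) < sz i then Y $$ (Suc i, j) else 0)
        + (if 0 < pos j then Y $$ (i, j - 1) else 0) =
        (- 1) ^ pos i * (\<Sum>d\<in>?S. c d * (t * ev i * (of_nat (pos i) - of_nat (pos j)) * T d (pos i) (pos j) - T d (Suc (pos i)) (pos j)
          + (if 0 < pos j then T d (pos i) (pos j - 1) else 0)))"
        unfolding 1 2 3 dd
        by (simp add: sum.distrib sum_subtractf sum_distrib_left distrib_left right_diff_distrib mult.assoc mult.left_commute)
      also have "\<dots> = 0"
        unfolding T_def toe_commute by (simp add: algebra_simps)
      finally show ?thesis .
    qed
    finally show "(jmat n dg pos sz * Y + Y * jmat n dg pos sz) $$ (i, j) = 0\<^sub>m n n $$ (i, j)" using ij by simp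
  qed (use Y in auto)
  then show ?thesis using Y unfolding Zn_iff Y_def dg_def[abs_def] by simp
qed

subsection \<open>Every anticommuting pair is a limit of pairs with simple spectrum\<close>

definition polymatf :: "nat \<Rightarrow> (complex \<Rightarrow> complex mat) \<Rightarrow> bool" where
  "polymatf n F \<longleftrightarrow> (\<forall>t. F t \<in> carrier_mat n n) \<and> (\<forall>i<n. \<forall>j<n. polyf (\<lambda>t. F t $$ (i, j)))"

lemma polymatf_const: "X \<in> carrier_mat n n \<Longrightarrow> polymatf n (\<lambda>t. X)"
  unfolding polymatf_def by (auto intro: polyf_const)

lemma polymatf_mat: "(\<And>i j. i < n \<Longrightarrow> j < n \<Longrightarrow> polyf (\<lambda>t. f t i j)) \<Longrightarrow> polymatf n (\<lambda>t. mat n n (\<lambda>(i, j). f t i j))"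
  unfolding polymatf_def by auto

lemma polymatf_mult:
  assumes "polymatf n F" "polymatf n G" shows "polymatf n (\<lambda>t. F t * G t)"
  unfolding polymatf_def
proof (intro conjI allI impI)
  fix i j assume ij: "i < n" "j < n"
  have "(F t * G t) $$ (i, j) = (\<Sum>l<n. F t $$ (i, l) * G t $$ (l, j))" for t
    using assms ij unfolding polymatf_def by (intro mat_mult_entry) auto
  moreover have "polyf (\<lambda>t. \<Sum>l<n. F t $$ (i, l) * G t $$ (l, j))"
    using assms ij unfolding polymatf_def by (intro polyf_sum polyf_mult) auto
  ultimately show "polyf (\<lambda>t. (F t * G t) $$ (i, j))" by simp
next
  fix t show "F t * G t \<in> carrier_mat n n" using assms mult_carrier_mat unfolding polymatf_def by blast
qed

lemma polymatf_det: "polymatf n F \<Longrightarrow> polyf (\<lambda>t. det (F t))"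
proof -
  assume F: "polymatf n F"
  have "det (F t) = (\<Sum>p | p permutes {0..<n}. signof p * (\<Prod>i = 0..<n. F t $$ (i, p i)))" for t
    using F unfolding polymatf_def by (intro det_def') auto
  moreover have "polyf (\<lambda>t. \<Sum>p | p permutes {0..<n}. signof p * (\<Prod>i = 0..<n. F t $$ (i, p i)))"
  proof (intro polyf_sum polyf_mult polyf_const polyf_prod)
    fix p i assume "p \<in> {p. p permutes {0..<n}}" "i \<in> {0..<n}"
    then have "i < n" "p i < n" using permutes_in_image[of p "{0..<n}" i] by auto
    then show "polyf (\<lambda>t. F t $$ (i, p i))" using F unfolding polymatf_def by auto
  qed
  ultimately show ?thesis by simp
qed

lemma polymatf_line:
  assumes "X \<in> carrier_mat n n" "Y \<in> carrier_mat n n"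
  shows "polymatf n (\<lambda>t. (1 - t) \<cdot>\<^sub>m X + t \<cdot>\<^sub>m Y)"
  unfolding polymatf_def
proof (intro conjI allI impI)
  fix i j assume ij: "i < n" "j < n"
  have "polyf (\<lambda>t. (1 - t) * X $$ (i, j) + t * Y $$ (i, j))"
    by (intro polyf_add polyf_mult polyf_diff polyf_const polyf_id)
  then show "polyf (\<lambda>t. ((1 - t) \<cdot>\<^sub>m X + t \<cdot>\<^sub>m Y) $$ (i, j))" using assms ij by simp
qed (use assms in auto)

lemma closure_polymat_curve:
  assumes "S \<subseteq> M2 n" "polymatf n F" "polymatf n G" "finite T" "\<And>t. t \<notin> T \<Longrightarrow> (F t, G t) \<in> zariski_closure n S"
  shows "(F u, G u) \<in> zariski_closure n S"
  by (rule closure_poly_curve[OF assms(1), where \<gamma> = "\<lambda>t. (F t, G t)" and T = T])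
    (use assms in \<open>auto simp: polymatf_def M2_def\<close>)

definition mtr :: "complex mat \<Rightarrow> complex" where
  "mtr A = (\<Sum>i<dim_row A. A $$ (i, i))"

lemma mtr_comm:
  assumes "A \<in> carrier_mat n n" "B \<in> carrier_mat n n" shows "mtr (A * B) = mtr (B * A)"
proof -
  have "mtr (A * B) = (\<Sum>i<n. \<Sum>l<n. A $$ (i, l) * B $$ (l, i))"
    unfolding mtr_def using assms by (intro sum.cong) (auto simp: mat_mult_entry[of A n n B n] simp del: index_mult_mat(1))
  also have "\<dots> = (\<Sum>l<n. \<Sum>i<n. B $$ (l, i) * A $$ (i, l))" by (subst sum.swap) (simp add: mult.commute)
  also have "\<dots> = mtr (B * A)"
    unfolding mtr_def using assms by (intro sum.cong) (auto simp: mat_mult_entry[of B n n A n] simp del: index_mult_mat(1))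
  finally show ?thesis .
qed

lemma mtr_conj:
  assumes "inverse_mats n P Q" "X \<in> carrier_mat n n" shows "mtr (P * X * Q) = mtr X"
proof -
  note a = inverse_matsD[OF assms(1)]
  have "mtr (P * X * Q) = mtr (Q * (P * X))" using a assms(2) by (intro mtr_comm) auto
  then show ?thesis using inverse_mats_cancel(2)[OF assms] by simp
qed

lemma polyf_mtr: "polymatf n F \<Longrightarrow> polyf (\<lambda>t. mtr (F t))"
proof -
  assume F: "polymatf n F"
  then have "mtr (F t) = (\<Sum>i<n. F t $$ (i, i))" for t unfolding mtr_def polymatf_def by (auto dest: spec[of _ t])
  moreover have "polyf (\<lambda>t. \<Sum>i<n. F t $$ (i, i))" using F unfolding polymatf_def by (intro polyf_sum) auto
  ultimately show ?thesis by simp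
qed

lemma jmat_square_diag:
  assumes "jdata n ev pos sz" "i < n"
  shows "(jmat n dg pos sz * jmat n dg pos sz) $$ (i, i) = dg i * dg i"
  using jdata_next(1)[OF assms] unfolding jmat_mult_left[OF assms(1) jmat_carrier(1) assms(2,2)]
  by (auto simp: jmat_index assms(2))

lemma jmat_square_upper:
  assumes "jdata n ev pos sz"
  shows "upper_triangular (jmat n dg pos sz * jmat n dg pos sz)"
  unfolding upper_triangular_def
proof (intro allI impI)
  fix i j assume "i < dim_row (jmat n dg pos sz * jmat n dg pos sz)" "j < i"
  then have ij: "i < n" "j < n" "j < i" by auto
  show "(jmat n dg pos sz * jmat n dg pos sz) $$ (i, j) = 0"
    using jdata_next(1)[OF assms ij(1)] ij
    unfolding jmat_mult_left[OF assms(1) jmat_carrier(1) ij(1,2)] by (auto simp: jmat_index)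
qed

lemma jordan_square_eigenvalue:
  assumes "jdata n ev pos sz" "inverse_mats n P Q" "i < n"
  shows "eigenvalue ((P * jmat n dg pos sz * Q) * (P * jmat n dg pos sz * Q)) (dg i * dg i)"
  unfolding conj_mult[OF assms(2) jmat_carrier(1) jmat_carrier(1)]
    upper_triangular_eigenvalue[OF mult_carrier_mat[OF jmat_carrier(1) jmat_carrier(1)] jmat_square_upper[OF assms(1)] assms(2)]
  using jmat_square_diag[OF assms(1,3)] assms(3) by blast

text \<open>If all eigenvalues equal e, the traces of M and M^2 are n e and n e^2. The criterion is
  polynomial in the entries of \<open>M\<close>, hence holds generically on a curve once it holds at
  one point.\<close>

lemma two_eigenvalues_if_trace:
  assumes M: "M \<in> carrier_mat n n" and ne: "of_nat n * mtr (M * M) \<noteq> mtr M * mtr M"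
  shows "\<exists>x y. eigenvalue M x \<and> eigenvalue M y \<and> x \<noteq> y"
proof (rule ccontr)
  assume *: "\<not> ?thesis"
  obtain P Q e pos sz where j: "inverse_mats n P Q" "jdata n e pos sz" "M = P * jmat n e pos sz * Q"
    by (rule jordan_basis[OF M])
  have e: "eigenvalue M (e i)" if "i < n" for i
    unfolding j(3) upper_triangular_eigenvalue[OF jmat_carrier(1) jmat_upper j(1)] using that by (auto simp: jmat_index)
  have eq: "e i = e 0" if "i < n" for i
  proof -
    have "0 < n" using that by simp
    then show ?thesis using * e[OF that] e[of 0] by blast
  qed
  have "mtr M = (\<Sum>i<n. e i)" unfolding j(3) mtr_conj[OF j(1) jmat_carrier(1)] by (simp add: mtr_def jmat_index)
  also have "\<dots> = (\<Sum>i<n. e 0)" by (intro sum.cong refl eq) (erule lessThan_iff[THEN iffD1])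
  finally have 1: "mtr M = of_nat n * e 0" by simp
  have "mtr (M * M) = (\<Sum>i<n. (jmat n e pos sz * jmat n e pos sz) $$ (i, i))"
    unfolding j(3) conj_mult[OF j(1) jmat_carrier(1) jmat_carrier(1)]
      mtr_conj[OF j(1) mult_carrier_mat[OF jmat_carrier(1) jmat_carrier(1)]] unfolding mtr_def by simp
  also have "\<dots> = (\<Sum>i<n. e i * e i)" by (intro sum.cong) (auto simp: jmat_square_diag[OF j(2)] simp del: index_mult_mat(1))
  also have "\<dots> = (\<Sum>i<n. e 0 * e 0)"
  proof (intro sum.cong refl)
    fix i assume "i \<in> {..<n}"
    then have "e i = e 0" by (intro eq) simp
    then show "e i * e i = e 0 * e 0" by (simp only:)
  qed
  finally have "mtr (M * M) = of_nat n * (e 0 * e 0)" by simp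
  with 1 ne show False by simp
qed

lemma Zn_square_commutes:
  assumes "(A, B) \<in> Zn n" shows "(A * A) * B = B * (A * A)"
proof -
  have c: "A \<in> carrier_mat n n" "B \<in> carrier_mat n n" "A * B + B * A = 0\<^sub>m n n" using assms unfolding Zn_iff by auto
  have ab: "A * B = - (B * A)"
  proof (rule eq_matI)
    fix i j assume "i < dim_row (- (B * A))" "j < dim_col (- (B * A))"
    then have ij: "i < n" "j < n" using c by auto
    have "(A * B + B * A) $$ (i, j) = 0" unfolding c(3) using ij by simp
    then show "(A * B) $$ (i, j) = (- (B * A)) $$ (i, j)" using ij c(1,2)
      by (simp add: eq_neg_iff_add_eq_0 del: index_mult_mat(1))
  qed (use c in auto)
  have "A * A * B = A * (A * B)" using c by (intro assoc_mult_mat) auto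
  also have "\<dots> = - (A * (B * A))" unfolding ab using c(1,2) by simp
  also have "A * (B * A) = A * B * A" using c(1,2) by (intro assoc_mult_mat[symmetric]) auto
  also have "A * B * A = - (B * A * A)" unfolding ab using c(1,2) by simp
  also have "- (- (B * A * A)) = B * A * A" by simp
  also have "\<dots> = B * (A * A)" using c by (intro assoc_mult_mat) auto
  finally show ?thesis .
qed

context
  fixes n :: nat
  assumes IH: "\<And>k. 0 < k \<Longrightarrow> k < n \<Longrightarrow> Zn k \<subseteq> good k"
begin

text \<open>Splitting treats the two matrices alike, but \<open>Ugen\<close> constrains only the
  first one. Both orders are recorded because the roles are exchanged later.\<close>

lemma good_if_square_splits:
  assumes AB: "(A, B) \<in> Zn n" and ev: "eigenvalue (A * A) x" "eigenvalue (A * A) y" "x \<noteq> y"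
  shows "(A, B) \<in> good n" "(B, A) \<in> good n"
proof -
  have c: "A \<in> carrier_mat n n" "B \<in> carrier_mat n n" using AB unfolding Zn_iff by auto
  then have M: "A * A \<in> carrier_mat n n" "(A * A) * A = A * (A * A)" "(A * A) * B = B * (A * A)"
    using Zn_square_commutes[OF AB] by auto
  show "(A, B) \<in> good n" by (rule good_if_split[OF IH AB M ev])
  show "(B, A) \<in> good n" by (rule good_if_split[OF IH Zn_swap[OF AB] M(1) M(3,2) ev])
qed

text \<open>Along the deformation the first two diagonal entries of the block are
  \<open>ev i\<close> and \<open>ev i * (1 + t)\<close>, so for generic \<open>t\<close> the square
  has two eigenvalues and the pair splits.\<close>

lemma good_if_nontrivial_block:
  assumes AB: "(A, B) \<in> Zn n" and jd: "jdata n ev pos sz" and PQ: "inverse_mats n P Q" and A: "A = P * jmat n ev pos sz * Q"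
    and i: "i < n" "ev i \<noteq> 0" "1 < sz i"
  shows "(A, B) \<in> good n" "(B, A) \<in> good n"
proof -
  note a = inverse_matsD[OF PQ]
  define J where "J t = jmat n (\<lambda>i. ev i * (1 + t * of_nat (pos i))) pos sz" for t
  define X where "X = Q * B * P"
  have c: "A \<in> carrier_mat n n" "B \<in> carrier_mat n n" using AB unfolding Zn_iff by auto
  then have X: "X \<in> carrier_mat n n" using a unfolding X_def by auto
  define F where "F t = P * J t * Q" for t
  define G where "G t = P * deformed n ev pos sz X t * Q" for t
  have J0: "J 0 = jmat n ev pos sz" unfolding J_def by simp
  have "(jmat n ev pos sz, X) \<in> Zn n"
    using Zn_cj[OF inverse_mats_sym[OF PQ] AB] conj_cancel(2)[OF PQ, of "jmat n ev pos sz"] unfolding cj_def A X_def by simp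
  then have ac: "jmat n ev pos sz * X + X * jmat n ev pos sz = 0\<^sub>m n n" unfolding Zn_iff by auto
  have 0: "F 0 = A" "G 0 = B"
    using deformed_0[OF jd X ac] conj_cancel(1)[OF PQ c(2)] unfolding F_def G_def J0 A X_def by auto
  have Z: "(F t, G t) \<in> Zn n" for t
    using Zn_cj[OF PQ deformed_anticommutes[OF jd, of t X]] unfolding cj_def F_def G_def J_def by simp
  have pF: "polymatf n F" unfolding F_def[abs_def] J_def jmat_def
    using a by (intro polymatf_mult polymatf_const polymatf_mat polyf_if polyf_add polyf_mult polyf_const polyf_id)
  have pG: "polymatf n G" unfolding G_def[abs_def] deformed_def
    using a by (intro polymatf_mult polymatf_const polymatf_mat polyf_if polyf_sum polyf_mult polyf_const polyf_id polyf_toe)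
  have st: "i - pos i + 0 < n" "pos (i - pos i + 0) = 0" "ev (i - pos i + 0) = ev i" using jdata_start[OF jd i(1), of 0] i(3) by auto
  have st': "i - pos i + 1 < n" "pos (i - pos i + 1) = 1" "ev (i - pos i + 1) = ev i" using jdata_start[OF jd i(1), of 1] i(3) by auto
  \<comment> \<open>The two excluded values are the roots of (1 + t)^2 = 1.\<close>
  have good: "(F t, G t) \<in> good n \<and> (G t, F t) \<in> good n" if t: "t \<notin> {0, -2}" for t
  proof -
    have e: "eigenvalue (F t * F t) (ev i * ev i)"
      using jordan_square_eigenvalue[OF jd PQ st(1), of "\<lambda>i. ev i * (1 + t * of_nat (pos i))"]
      unfolding st(2,3) F_def J_def by simp
    have e': "eigenvalue (F t * F t) (ev i * (1 + t) * (ev i * (1 + t)))"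
      using jordan_square_eigenvalue[OF jd PQ st'(1), of "\<lambda>i. ev i * (1 + t * of_nat (pos i))"]
      unfolding st'(2,3) F_def J_def by simp
    have "t * (t + 2) \<noteq> 0" using t by (auto simp: add_eq_0_iff2)
    then have "ev i * ev i * (t * (t + 2)) \<noteq> 0" using i(2) by simp
    then have "ev i * ev i \<noteq> ev i * (1 + t) * (ev i * (1 + t))" by (auto simp: algebra_simps)
    from good_if_square_splits[OF Z e e' this] show ?thesis by simp
  qed
  show "(A, B) \<in> good n" using closure_polymat_curve[OF Ugen_M2 pF pG, of "{0, -2}" 0] good unfolding 0 by auto
  show "(B, A) \<in> good n" using closure_polymat_curve[OF Ugen_M2 pG pF, of "{0, -2}" 0] good unfolding 0 by auto
qed

end

text \<open>All indices other than \<open>a\<close> and \<open>b\<close> are sent to zero. The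
  square is therefore a projection of rank two for distinct \<open>a\<close> and \<open>b\<close>
  below \<open>n\<close>, with both eigenvalues 0 and 1 as soon as \<open>n > 2\<close>.\<close>

definition exch :: "nat \<Rightarrow> nat \<Rightarrow> nat \<Rightarrow> complex mat" where
  "exch n a b = mat n n (\<lambda>(i, j). if i = a \<and> j = b \<or> i = b \<and> j = a then 1 else 0)"

lemma diag_anticommute_iff:
  assumes X: "X \<in> carrier_mat n n"
  shows "(diagm n d, X) \<in> Zn n \<longleftrightarrow> (\<forall>i<n. \<forall>j<n. (d i + d j) * X $$ (i, j) = 0)"
proof -
  have e: "(diagm n d * X + X * diagm n d) $$ (i, j) = (d i + d j) * X $$ (i, j)" if "i < n" "j < n" for i j
  proof -
    have "(diagm n d * X + X * diagm n d) $$ (i, j) = (diagm n d * X) $$ (i, j) + (X * diagm n d) $$ (i, j)"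
      using that X by (intro index_add_mat) auto
    then show ?thesis unfolding diagm_mult_entry[OF X that] by (simp add: algebra_simps)
  qed
  have "(diagm n d, X) \<in> Zn n \<longleftrightarrow> diagm n d * X + X * diagm n d = 0\<^sub>m n n" using X unfolding Zn_iff by auto
  also have "\<dots> \<longleftrightarrow> (\<forall>i<n. \<forall>j<n. (d i + d j) * X $$ (i, j) = 0)"
  proof
    assume 0: "diagm n d * X + X * diagm n d = 0\<^sub>m n n"
    show "\<forall>i<n. \<forall>j<n. (d i + d j) * X $$ (i, j) = 0"
    proof (intro allI impI)
      fix i j assume "i < n" "j < n"
      then show "(d i + d j) * X $$ (i, j) = 0" using e[of i j] unfolding 0 by simp
    qed
  next
    assume "\<forall>i<n. \<forall>j<n. (d i + d j) * X $$ (i, j) = 0"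
    then show "diagm n d * X + X * diagm n d = 0\<^sub>m n n"
      using X e by (intro eq_matI) (auto simp del: index_add_mat(1))
  qed
  finally show ?thesis .
qed

lemma exch_square_entry:
  assumes "a < n" "b < n" "a \<noteq> b" "i < n" "j < n"
  shows "(exch n a b * exch n a b) $$ (i, j) = (if i = j \<and> (i = a \<or> i = b) then 1 else 0)"
proof -
  have "(exch n a b * exch n a b) $$ (i, j) = (\<Sum>l<n. exch n a b $$ (i, l) * exch n a b $$ (l, j))"
    using assms by (intro mat_mult_entry) (auto simp: exch_def)
  also have "\<dots> = (\<Sum>l<n. (if l = b then if i = a \<and> j = a then 1 else 0 else 0) + (if l = a then if i = b \<and> j = b then 1 else 0 else 0))"
    using assms by (intro sum.cong) (auto simp: exch_def)
  also have "\<dots> = (if i = a \<and> j = a then 1 else 0) + (if i = b \<and> j = b then 1 else 0)"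
    unfolding sum.distrib using assms by simp
  finally show ?thesis using assms(3) by auto
qed

lemma two_by_two_entries:
  assumes "A \<in> carrier_mat 2 2" "B \<in> carrier_mat 2 2" "i < 2" "j < 2"
  shows "(A * B) $$ (i, j) = A $$ (i, 0) * B $$ (0, j) + A $$ (i, 1) * B $$ (1, j)"
  using mat_mult_entry[OF assms] by (simp add: numeral_2_eq_2 lessThan_Suc add.commute)

lemma less_2_cases: "i < (2::nat) \<Longrightarrow> (i = 0 \<Longrightarrow> P) \<Longrightarrow> (i = 1 \<Longrightarrow> P) \<Longrightarrow> P"
  by linarith

text \<open>The matrix with rows \<open>(0, x)\<close> and \<open>(y, 0)\<close> has eigenvalues \<open>\<plusminus>s\<close> with \<open>s\<^sup>2 = x y\<close> and eigenvectors \<open>(x, \<plusminus>s)\<close>.\<close>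

lemma antidiagonal_simple_spectrum:
  fixes x y :: complex
  assumes A: "A \<in> carrier_mat 2 2" "A $$ (0, 0) = 0" "A $$ (0, 1) = x" "A $$ (1, 0) = y" "A $$ (1, 1) = 0"
    and xy: "x * y \<noteq> 0" and Z: "(A, B) \<in> Zn 2"
  shows "(A, B) \<in> Ugen 2"
proof -
  define s where "s = csqrt (x * y)"
  have s: "s * s = x * y" unfolding s_def by (metis power2_csqrt power2_eq_square)
  have nz: "s \<noteq> 0" "x \<noteq> 0" using s xy by auto
  define P where "P = mat 2 2 (\<lambda>(i, j). if i = 0 then x else if j = 0 then s else - s)"
  define Q where "Q = mat 2 2 (\<lambda>(i, j). if j = 0 then 1 / (2 * x) else if i = (0::nat) then 1 / (2 * s) else - 1 / (2 * s))"
  define d where "d i = (if i = 0 then s else - s)" for i :: nat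
  have c: "P \<in> carrier_mat 2 2" "Q \<in> carrier_mat 2 2" unfolding P_def Q_def by auto
  have "P * Q = 1\<^sub>m 2"
  proof (rule eq_matI)
    fix i j assume "i < dim_row (1\<^sub>m 2 :: complex mat)" "j < dim_col (1\<^sub>m 2 :: complex mat)"
    then have ij: "i < 2" "j < 2" by auto
    then show "(P * Q) $$ (i, j) = 1\<^sub>m 2 $$ (i, j)" unfolding two_by_two_entries[OF c ij]
      by (elim less_2_cases) (use nz in \<open>simp_all add: P_def Q_def field_simps\<close>)
  qed (use c in auto)
  then have PQ: "inverse_mats 2 P Q" using c mat_mult_left_right_inverse[OF c] unfolding inverse_mats_def by auto
  have "A * P = P * diagm 2 d"
  proof (rule eq_matI)
    fix i j assume "i < dim_row (P * diagm 2 d)" "j < dim_col (P * diagm 2 d)"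
    then have ij: "i < 2" "j < 2" using c by auto
    then show "(A * P) $$ (i, j) = (P * diagm 2 d) $$ (i, j)"
      unfolding two_by_two_entries[OF A(1) c(1) ij] diagm_mult_entry(2)[OF c(1) ij]
      by (elim less_2_cases) (use s A in \<open>simp_all add: P_def d_def mult.commute\<close>)
  qed (use c A in auto)
  then have "A = P * diagm 2 d * Q" using inverse_mats_cancel(3)[OF PQ A(1)] by simp
  moreover have "\<forall>i<2. \<forall>j<2. i \<noteq> j \<longrightarrow> d i \<noteq> 0 \<longrightarrow> d i \<noteq> d j"
  proof (intro allI impI)
    fix i j :: nat assume "i < 2" "j < 2" "i \<noteq> j"
    then have "d i = s \<and> d j = - s \<or> d i = - s \<and> d j = s" unfolding d_def by auto
    moreover have "s \<noteq> - s" using nz(1) by simp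
    ultimately show "d i \<noteq> d j" by metis
  qed
  ultimately show ?thesis using Z PQ unfolding Ugen_def by blast
qed

lemma Ugen_one: "(A, B) \<in> Zn 1 \<Longrightarrow> (A, B) \<in> Ugen 1"
proof -
  assume Z: "(A, B) \<in> Zn 1"
  then have "A \<in> carrier_mat 1 1" unfolding Zn_iff by auto
  then have "A = 1\<^sub>m 1 * diagm 1 (\<lambda>_. A $$ (0, 0)) * 1\<^sub>m 1" by (intro eq_matI) (auto simp: left_mult_one_mat[of _ 1 1] right_mult_one_mat[of _ 1 1])
  then show ?thesis using Z inverse_mats_one[of 1] unfolding Ugen_def by blast
qed

lemma Zn_line:
  assumes "(A, B) \<in> Zn n" "(A, C) \<in> Zn n" shows "(A, (1 - t) \<cdot>\<^sub>m B + t \<cdot>\<^sub>m C) \<in> Zn n"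
proof -
  have c: "A \<in> carrier_mat n n" "B \<in> carrier_mat n n" "C \<in> carrier_mat n n" "A * B + B * A = 0\<^sub>m n n" "A * C + C * A = 0\<^sub>m n n"
    using assms unfolding Zn_iff by auto
  have e: "(A * ((1 - t) \<cdot>\<^sub>m B + t \<cdot>\<^sub>m C)) = (1 - t) \<cdot>\<^sub>m (A * B) + t \<cdot>\<^sub>m (A * C)"
    "((1 - t) \<cdot>\<^sub>m B + t \<cdot>\<^sub>m C) * A = (1 - t) \<cdot>\<^sub>m (B * A) + t \<cdot>\<^sub>m (C * A)"
    using c(1-3) by (simp_all add: mult_add_distrib_mat[of A n n _ n] add_mult_distrib_mat[of _ n n _ A n]
        mult_smult_distrib[of A n n _ n] mult_smult_assoc_mat[of _ n n A n])
  have z: "(A * B) $$ (i, j) + (B * A) $$ (i, j) = 0" "(A * C) $$ (i, j) + (C * A) $$ (i, j) = 0" if "i < n" "j < n" for i j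
  proof -
    have "(A * B + B * A) $$ (i, j) = 0" "(A * C + C * A) $$ (i, j) = 0" unfolding c(4,5) using that by auto
    then show "(A * B) $$ (i, j) + (B * A) $$ (i, j) = 0" "(A * C) $$ (i, j) + (C * A) $$ (i, j) = 0"
      using that c(1-3) by (simp_all del: index_mult_mat(1))
  qed
  have "A * ((1 - t) \<cdot>\<^sub>m B + t \<cdot>\<^sub>m C) + ((1 - t) \<cdot>\<^sub>m B + t \<cdot>\<^sub>m C) * A = 0\<^sub>m n n"
    unfolding e
  proof (rule eq_matI)
    fix i j assume "i < dim_row (0\<^sub>m n n :: complex mat)" "j < dim_col (0\<^sub>m n n :: complex mat)"
    then have ij: "i < n" "j < n" by auto
    have "((1 - t) \<cdot>\<^sub>m (A * B) + t \<cdot>\<^sub>m (A * C) + ((1 - t) \<cdot>\<^sub>m (B * A) + t \<cdot>\<^sub>m (C * A))) $$ (i, j) =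
       (1 - t) * ((A * B) $$ (i, j) + (B * A) $$ (i, j)) + t * ((A * C) $$ (i, j) + (C * A) $$ (i, j))"
      using ij c(1-3) by (simp add: algebra_simps del: index_mult_mat(1))
    then show "((1 - t) \<cdot>\<^sub>m (A * B) + t \<cdot>\<^sub>m (A * C) + ((1 - t) \<cdot>\<^sub>m (B * A) + t \<cdot>\<^sub>m (C * A))) $$ (i, j) = 0\<^sub>m n n $$ (i, j)"
      unfolding z[OF ij] using ij by simp
  qed (use c in auto)
  then show ?thesis using c(1-3) unfolding Zn_iff by auto
qed

context
  fixes n :: nat
  assumes IH: "\<And>k. 0 < k \<Longrightarrow> k < n \<Longrightarrow> Zn k \<subseteq> good k"
begin

text \<open>In the diagonal case \<open>d = \<plusminus>a\<close>, moving the anticommuting matrix towards an exchange of two indices of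
  opposite sign separates the eigenvalues of its square.\<close>

lemma good_if_diagonal:
  assumes Z: "(diagm n d, X) \<in> Zn n" and n: "0 < n"
    and d: "\<And>i. i < n \<Longrightarrow> d i \<noteq> 0" "\<And>i j. i < n \<Longrightarrow> j < n \<Longrightarrow> d i * d i = d j * d j"
  shows "(diagm n d, X) \<in> good n" "(X, diagm n d) \<in> good n"
proof -
  have X: "X \<in> carrier_mat n n" using Z unfolding Zn_iff by auto
  have Zd: "(d i + d j) * X $$ (i, j) = 0" if "i < n" "j < n" for i j
    using Z that unfolding diag_anticommute_iff[OF X] by blast
  have pm: "d j = d i \<or> d j = - d i" if "i < n" "j < n" for i j using d(2)[OF that] square_eq_iff[of "d i" "d j"] by auto
  consider "n = 1" | "\<And>i. i < n \<Longrightarrow> d i = d 0" "n \<noteq> 1" | i where "i < n" "d i \<noteq> d 0" by blast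
  then have "(diagm n d, X) \<in> good n \<and> (X, diagm n d) \<in> good n"
  proof cases
    case 1
    then show ?thesis using Ugen_one[of "diagm n d" X] Ugen_one[of X "diagm n d"] Z Zn_swap[OF Z] closure_subset[of "Ugen 1" 1] by auto
  next
    case 2
    have "X $$ (i, j) = 0" if "i < n" "j < n" for i j
      using Zd[OF that] 2(1)[OF that(1)] 2(1)[OF that(2)] d(1)[OF n] by simp
    then have X0: "X = 0\<^sub>m n n" using X by (intro eq_matI) auto
    have "X = 1\<^sub>m n * diagm n (\<lambda>_. 0) * 1\<^sub>m n" unfolding X0 by (intro eq_matI) auto
    then have "(X, diagm n d) \<in> Ugen n" using Zn_swap[OF Z] inverse_mats_one[of n] unfolding Ugen_def by blast
    moreover have "(diagm n d, X) \<in> good n"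
    proof -
      \<comment> \<open>Since \<open>X = 0\<close>, the diagonal can be spread freely; its entries
        at 0 and 1 then have different squares for generic \<open>t\<close>.\<close>
      define F where "F t = diagm n (\<lambda>i. d i * (1 + t * of_nat i))" for t
      have pF: "polymatf n F" unfolding F_def[abs_def] diagm_def
        by (intro polymatf_mat polyf_if polyf_add polyf_mult polyf_const polyf_id)
      have "(F t, X) \<in> good n" if t: "t \<notin> {0, -2}" for t
      proof -
        \<comment> \<open>A diagonal matrix is read as a Jordan matrix with all blocks of size one,
          to reuse the lemma on eigenvalues of squares.\<close>
        have F: "F t = 1\<^sub>m n * jmat n (\<lambda>i. d i * (1 + t * of_nat i)) (\<lambda>_. 0) (\<lambda>_. 1) * 1\<^sub>m n"
          unfolding F_def by (intro eq_matI) (auto simp: jmat_index)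
        have jd: "jdata n (\<lambda>i. d i * (1 + t * of_nat i)) (\<lambda>_. 0) (\<lambda>_. 1)" unfolding jdata_def by (auto simp: less_Suc_eq)
        have n1: "1 < n" using 2(2) n by simp
        have d1: "d 1 = d 0" by (rule 2(1)[OF n1])
        have e: "eigenvalue (F t * F t) (d 0 * d 0)" "eigenvalue (F t * F t) (d 0 * (1 + t) * (d 0 * (1 + t)))"
          using jordan_square_eigenvalue[OF jd inverse_mats_one n, of "\<lambda>i. d i * (1 + t * of_nat i)"]
            jordan_square_eigenvalue[OF jd inverse_mats_one n1, of "\<lambda>i. d i * (1 + t * of_nat i)"]
          unfolding F d1 by simp_all
        have "t * (t + 2) \<noteq> 0" using t by (auto simp: add_eq_0_iff2)
        then have "d 0 * d 0 * (t * (t + 2)) \<noteq> 0" using d(1)[OF n] by simp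
        then have ne: "d 0 * d 0 \<noteq> d 0 * (1 + t) * (d 0 * (1 + t))" by (auto simp: algebra_simps)
        have "(F t, X) \<in> Zn n" unfolding F_def diag_anticommute_iff[OF X] by (auto simp: X0)
        from good_if_square_splits(1)[OF IH this e ne] show ?thesis .
      qed
      moreover have "F 0 = diagm n d" unfolding F_def by simp
      ultimately show ?thesis using closure_polymat_curve[OF Ugen_M2 pF polymatf_const[OF X], of "{0, -2}" 0] by auto
    qed
    ultimately show ?thesis using closure_subset by blast
  next
    case (3 b)
    then have b: "b < n" "d b = - d 0" using pm[OF n 3(1)] by auto
    have b: "b < n" "d b = - d 0" "b \<noteq> 0" using b 3(2) by (auto intro: gr0I)
    define R where "R = exch n 0 b"
    have R: "R \<in> carrier_mat n n" unfolding R_def exch_def by auto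
    have ZR: "(diagm n d, R) \<in> Zn n" unfolding diag_anticommute_iff[OF R] using b by (auto simp: R_def exch_def)
    define F where "F t = (1 - t) \<cdot>\<^sub>m X + t \<cdot>\<^sub>m R" for t
    have pF: "polymatf n F" unfolding F_def[abs_def] using X R by (rule polymatf_line)
    have F0: "F 0 = X" and F1: "F 1 = R" unfolding F_def using X R by (auto intro!: eq_matI)
    have ZF: "(diagm n d, F t) \<in> Zn n" for t unfolding F_def using Z ZR by (rule Zn_line)
    show ?thesis
    \<comment> \<open>For \<open>n = 2\<close> the square of \<open>R\<close> is the identity and
      separates nothing. There \<open>diagm n d\<close> has simple spectrum already, and so has
      \<open>F t\<close> for generic \<open>t\<close>.\<close>
    proof (cases "n = 2")
      case True
      then have b1: "b = 1" using b by auto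
      have "d i \<noteq> d j" if "i < n" "j < n" "i \<noteq> j" for i j
      proof -
        have "i = 0 \<and> j = 1 \<or> i = 1 \<and> j = 0" using that True by linarith
        then show ?thesis using b d(1)[OF n] unfolding b1 by auto
      qed
      moreover have "diagm n d = 1\<^sub>m n * diagm n d * 1\<^sub>m n" by (intro eq_matI) auto
      ultimately have "(diagm n d, X) \<in> Ugen n" using Z inverse_mats_one[of n] unfolding Ugen_def by blast
      moreover have "(X, diagm n d) \<in> good n"
      proof -
        define f where "f t = F t $$ (0, 1) * F t $$ (1, 0)" for t
        have pf: "polyf f" unfolding f_def[abs_def] using pF True unfolding polymatf_def by (intro polyf_mult) auto
        have "f 1 \<noteq> 0" unfolding f_def F1 R_def exch_def b1 True by simp
        then have fin: "finite {t. f t = 0}" by (rule polyf_finite_zeros[OF pf])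
        have "(F t, diagm n d) \<in> good n" if "t \<notin> {t. f t = 0}" for t
        proof -
          have Ft: "F t \<in> carrier_mat n n" using pF unfolding polymatf_def by auto
          have di: "F t $$ (i, i) = 0" if "i < n" for i
          proof -
            have "(d i + d i) * F t $$ (i, i) = 0" using ZF[of t] that unfolding diag_anticommute_iff[OF Ft] by blast
            then show ?thesis using d(1)[OF that] by simp
          qed
          have "(F t, diagm n d) \<in> Ugen n"
          proof -
            have "F t $$ (0, 0) = 0" "F t $$ (1, 1) = 0" using di[of 0] di[of 1] True by auto
            moreover have "F t $$ (0, 1) * F t $$ (1, 0) \<noteq> 0" using that unfolding f_def by simp
            ultimately show ?thesis
              using antidiagonal_simple_spectrum[OF Ft[unfolded True] _ refl refl _ _ Zn_swap[OF ZF[of t, unfolded True]]]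
              unfolding True by blast
          qed
          then show ?thesis using closure_subset by blast
        qed
        from closure_polymat_curve[OF Ugen_M2 pF polymatf_const[OF diagm_carrier(1)] fin this] show ?thesis using F0 by metis
      qed
      ultimately show ?thesis using closure_subset by blast
    next
      case False
      then have n3: "n > 2" using b by linarith
      \<comment> \<open>The trace criterion applied to \<open>F t * F t\<close>. At
        \<open>t = 1\<close> the traces of R^2 and R^4 are both 2, which gives the value 2 (n -
        2).\<close>
      define f where "f t = of_nat n * mtr (F t * F t * (F t * F t)) - mtr (F t * F t) * mtr (F t * F t)" for t
      have pf: "polyf f" unfolding f_def[abs_def]
        using polymatf_mult[OF pF pF] polymatf_mult[OF polymatf_mult[OF pF pF] polymatf_mult[OF pF pF]]
        by (intro polyf_diff polyf_mult polyf_const polyf_mtr)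
      have RR: "(R * R) $$ (i, j) = (if i = j \<and> (i = 0 \<or> i = b) then 1 else 0)" if "i < n" "j < n" for i j
        unfolding R_def using exch_square_entry[OF n b(1) b(3)[symmetric] that] .
      have cc: "R * R \<in> carrier_mat n n" using R by auto
      have two: "(\<Sum>i<n. if i = 0 \<or> i = b then 1 else 0 :: complex) = 2"
      proof -
        have "(\<Sum>i<n. if i = 0 \<or> i = b then 1 else 0 :: complex) = (\<Sum>i<n. (if i = 0 then 1 else 0) + (if i = b then 1 else 0))"
          using b(3) by (intro sum.cong) auto
        also have "\<dots> = 2" unfolding sum.distrib using n b(1) by simp
        finally show ?thesis .
      qed
      have tr1: "mtr (R * R) = 2" unfolding mtr_def two[symmetric] using R by (intro sum.cong) (auto simp: RR simp del: index_mult_mat(1))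
      have "R * R = diagm n (\<lambda>i. if i = 0 \<or> i = b then 1 else 0)"
        using R by (intro eq_matI) (auto simp: RR simp del: index_mult_mat(1))
      then have "(R * R * (R * R)) $$ (i, i) = (if i = 0 \<or> i = b then 1 else 0)" if "i < n" for i
        using diagm_mult_entry(1)[OF cc that that, of "\<lambda>i. if i = 0 \<or> i = b then 1 else 0"] RR[OF that that] by simp
      then have tr2: "mtr (R * R * (R * R)) = 2" unfolding mtr_def two[symmetric] using R by (intro sum.cong) (auto simp del: index_mult_mat(1))
      have "f 1 = 2 * (of_nat n - of_nat 2)" unfolding f_def F1 tr1 tr2 by simp
      moreover have "(of_nat n - of_nat 2 :: complex) \<noteq> 0" using n3 by (metis eq_iff_diff_eq_0 less_irrefl of_nat_eq_iff)
      ultimately have "f 1 \<noteq> 0" by simp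
      then have fin: "finite {t. f t = 0}" by (rule polyf_finite_zeros[OF pf])
      have g: "(F t, diagm n d) \<in> good n \<and> (diagm n d, F t) \<in> good n" if "t \<notin> {t. f t = 0}" for t
      proof -
        have "F t \<in> carrier_mat n n" using pF unfolding polymatf_def by auto
        then have "F t * F t \<in> carrier_mat n n" by auto
        moreover have "of_nat n * mtr (F t * F t * (F t * F t)) \<noteq> mtr (F t * F t) * mtr (F t * F t)"
          using that unfolding f_def by auto
        ultimately obtain x y where "eigenvalue (F t * F t) x" "eigenvalue (F t * F t) y" "x \<noteq> y"
          using two_eigenvalues_if_trace by blast
        from good_if_square_splits[OF IH Zn_swap[OF ZF] this] show ?thesis by simp
      qed
      show ?thesis
        using closure_polymat_curve[OF Ugen_M2 pF polymatf_const[OF diagm_carrier(1)] fin, of d 0]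
          closure_polymat_curve[OF Ugen_M2 polymatf_const[OF diagm_carrier(1)] pF fin, of d 0] g unfolding F0 by blast
    qed
  qed
  then show "(diagm n d, X) \<in> good n" "(X, diagm n d) \<in> good n" by auto
qed

text \<open>Either some Jordan block is nontrivial, or two eigenvalues have different squares, or
  \<open>A\<close> is diagonalizable with eigenvalues \<open>a\<close> and \<open>- a\<close> for a
  single nonzero \<open>a\<close>; these are the cases settled before.\<close>

lemma good_if_nonsingular:
  assumes Z: "(A, B) \<in> Zn n" and n: "0 < n" and det: "det A \<noteq> 0"
  shows "(A, B) \<in> good n" "(B, A) \<in> good n"
proof -
  have c: "A \<in> carrier_mat n n" "B \<in> carrier_mat n n" using Z unfolding Zn_iff by auto
  obtain P Q ev pos sz where j: "inverse_mats n P Q" "jdata n ev pos sz" "A = P * jmat n ev pos sz * Q"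
    by (rule jordan_basis[OF c(1)])
  note a = inverse_matsD[OF j(1)]
  have "det A = det P * det (jmat n ev pos sz) * det Q" unfolding j(3) using a by (simp add: det_mult[of _ n])
  then have "det (jmat n ev pos sz) \<noteq> 0" using det by auto
  then have "prod_list (diag_mat (jmat n ev pos sz)) \<noteq> 0" using det_upper_triangular[OF jmat_upper jmat_carrier(1)] by metis
  then have ev0: "ev i \<noteq> 0" if "i < n" for i
    using that by (auto simp: prod_list_zero_iff diag_mat_def jmat_index image_iff)
  consider i where "i < n" "1 < sz i" | i l where "i < n" "l < n" "ev i * ev i \<noteq> ev l * ev l"
    | "\<And>i. i < n \<Longrightarrow> sz i \<le> 1" "\<And>i l. i < n \<Longrightarrow> l < n \<Longrightarrow> ev i * ev i = ev l * ev l"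
    using not_le by blast
  then have "(A, B) \<in> good n \<and> (B, A) \<in> good n"
  proof cases
    case (1 i) then show ?thesis using good_if_nontrivial_block[OF IH Z j(2,1,3) 1(1) ev0 1(2)] by simp
  next
    case (2 i l)
    from good_if_square_splits[OF IH Z _ _ 2(3)] jordan_square_eigenvalue[OF j(2,1) 2(1), of ev] jordan_square_eigenvalue[OF j(2,1) 2(2), of ev]
    show ?thesis unfolding j(3) by blast
  next
    case 3
    have J: "jmat n ev pos sz = diagm n ev" using 3(1) by (intro eq_matI) (fastforce simp: jmat_index)+
    define X where "X = Q * B * P"
    have X: "cj Q P (A, B) = (diagm n ev, X)" "cj Q P (B, A) = (X, diagm n ev)"
      unfolding cj_def j(3) J X_def using conj_cancel(2)[OF j(1) diagm_carrier(1)] by auto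
    have "(diagm n ev, X) \<in> Zn n" using Zn_cj[OF inverse_mats_sym[OF j(1)] Z] unfolding X(1) .
    from good_if_diagonal[OF this n ev0 3(2)] show ?thesis
      unfolding X[symmetric] using good_cj_iff[OF inverse_mats_sym[OF j(1)]] c unfolding M2_def by blast
  qed
  then show "(A, B) \<in> good n" "(B, A) \<in> good n" by auto
qed

text \<open>If \<open>A\<close> is nilpotent, the parity of the position in a Jordan basis gives an invertible matrix \<open>D\<close>
  anticommuting with \<open>A\<close>, towards which \<open>B\<close> can be moved.\<close>

lemma good_step:
  assumes Z: "(A, B) \<in> Zn n" and n: "0 < n" shows "(A, B) \<in> good n"
proof -
  have c: "A \<in> carrier_mat n n" "B \<in> carrier_mat n n" using Z unfolding Zn_iff by auto
  obtain P Q ev pos sz where j: "inverse_mats n P Q" "jdata n ev pos sz" "A = P * jmat n ev pos sz * Q"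
    by (rule jordan_basis[OF c(1)])
  note a = inverse_matsD[OF j(1)]
  consider "\<And>i. i < n \<Longrightarrow> ev i \<noteq> 0" | i l where "i < n" "l < n" "ev i \<noteq> 0" "ev l = 0" | "\<And>i. i < n \<Longrightarrow> ev i = 0" by blast
  then show ?thesis
  proof cases
    case 1
    have "prod_list (diag_mat (jmat n ev pos sz)) \<noteq> 0"
      using 1 by (auto simp: prod_list_zero_iff diag_mat_def jmat_index image_iff)
    then have "det (jmat n ev pos sz) \<noteq> 0" using det_upper_triangular[OF jmat_upper jmat_carrier(1)] by metis
    moreover have "det P * det Q = 1" using det_mult[OF a(1,2)] a(3) by simp
    ultimately have "det A \<noteq> 0" unfolding j(3) using a by (auto simp: det_mult[of _ n])
    then show ?thesis using good_if_nonsingular(1)[OF Z n] by simp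
  next
    case (2 i l)
    then have ne: "ev i * ev i \<noteq> ev l * ev l" by simp
    from good_if_square_splits(1)[OF IH Z _ _ ne] jordan_square_eigenvalue[OF j(2,1) 2(1), of ev] jordan_square_eigenvalue[OF j(2,1) 2(2), of ev]
    show ?thesis unfolding j(3) by blast
  next
    case 3
    define D where "D = P * diagm n (\<lambda>i. (- 1) ^ pos i) * Q"
    have "(jmat n ev pos sz, diagm n (\<lambda>i. (- 1) ^ pos i)) \<in> Zn n"
    proof (rule Zn_swap, unfold diag_anticommute_iff[OF jmat_carrier(1)], intro allI impI)
      fix i l assume il: "i < n" "l < n"
      show "((- 1) ^ pos i + (- 1) ^ pos l) * jmat n ev pos sz $$ (i, l) = 0"
        using 3[OF il(1)] jdata_next[OF j(2) il(1)] by (auto simp: jmat_index il)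
    qed
    from Zn_cj[OF j(1) this] have ZD: "(A, D) \<in> Zn n" unfolding cj_def j(3) D_def by simp
    have D: "D \<in> carrier_mat n n" unfolding D_def using a by auto
    define F where "F t = (1 - t) \<cdot>\<^sub>m B + t \<cdot>\<^sub>m D" for t
    have pF: "polymatf n F" unfolding F_def[abs_def] using c(2) D by (rule polymatf_line)
    have F0: "F 0 = B" and F1: "F 1 = D" unfolding F_def using c D by (auto intro!: eq_matI)
    have ZF: "(A, F t) \<in> Zn n" for t unfolding F_def using Z ZD by (rule Zn_line)
    have "upper_triangular (diagm n (\<lambda>i. (- 1) ^ pos i))" unfolding upper_triangular_def by auto
    then have "det (diagm n (\<lambda>i. (- 1) ^ pos i)) = prod_list (diag_mat (diagm n (\<lambda>i. (- 1) ^ pos i)))"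
      by (rule det_upper_triangular[OF _ diagm_carrier(1)])
    also have "\<dots> \<noteq> 0" by (auto simp: prod_list_zero_iff diag_mat_def image_iff)
    finally have "det (diagm n (\<lambda>i. (- 1) ^ pos i)) \<noteq> 0" .
    moreover have "det P * det Q = 1" using det_mult[OF a(1,2)] a(3) by simp
    ultimately have "det D \<noteq> 0" unfolding D_def using a by (auto simp: det_mult[of _ n])
    then have fin: "finite {t. det (F t) = 0}" using polyf_finite_zeros[OF polymatf_det[OF pF], of 1] F1 by simp
    \<comment> \<open>Now the invertible matrix is the second one of the pair, which is why the
      nonsingular case was proved for both orders.\<close>
    have "(A, F t) \<in> good n" if "t \<notin> {t. det (F t) = 0}" for t
      using good_if_nonsingular(2)[OF Zn_swap[OF ZF] n] that by simp
    from closure_polymat_curve[OF Ugen_M2 polymatf_const[OF c(1)] pF fin this, of 0] show ?thesis unfolding F0 by simp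
  qed
qed

end

lemma Zn_subset_good: "0 < n \<Longrightarrow> Zn n \<subseteq> good n"
proof (induction n rule: less_induct)
  case (less n)
  show ?case
  proof
    fix x assume "x \<in> Zn n"
    then show "x \<in> good n" using good_step[of n "fst x" "snd x"] less by simp
  qed
qed

subsection \<open>A parametrization of the components\<close>

definition partner :: "nat \<Rightarrow> nat" where
  "partner i = (if even i then i + 1 else i - 1)"

definition Bst :: "nat \<Rightarrow> nat \<Rightarrow> nat \<Rightarrow> (nat \<Rightarrow> complex) \<Rightarrow> complex mat" where
  "Bst n p m z = mat n n (\<lambda>(i, j). if i < 2 * p then (if j = partner i then z i else 0)
     else if i = j \<and> 2 * p + m \<le> i then z i else 0)"

text \<open>Coordinates: the off-diagonal entries of the conjugating matrix (whose diagonal is normalized to \<open>1\<close>),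
  the eigenvalues \<open>a\<close> of the first matrix, and the entries \<open>z\<close> of the second one.\<close>

datatype coord = CG nat nat | CA nat | CZ nat

definition gmat :: "nat \<Rightarrow> (coord \<Rightarrow> complex) \<Rightarrow> complex mat" where
  "gmat n \<theta> = mat n n (\<lambda>(i, j). if i = j then 1 else \<theta> (CG i j))"

definition std :: "nat \<Rightarrow> nat \<Rightarrow> nat \<Rightarrow> (coord \<Rightarrow> complex) \<Rightarrow> complex mat \<times> complex mat" where
  "std n p m \<theta> = (diag_A n p m (\<lambda>i. \<theta> (CA i)), Bst n p m (\<lambda>i. \<theta> (CZ i)))"

text \<open>The values \<open>i + 1\<close> are nonzero with distinct squares, as
  \<open>good_params\<close> and the Hankel determinants require. The zeros make the conjugating
  matrix the identity and the antidiagonal part of the second matrix vanish.\<close>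

definition base :: "nat \<Rightarrow> coord \<Rightarrow> complex" where
  "base p \<kappa> = (case \<kappa> of CG i j \<Rightarrow> 0 | CA i \<Rightarrow> of_nat (i + 1) | CZ i \<Rightarrow> if i < 2 * p then 0 else of_nat (i + 1))"

text \<open>Coordinates outside \<open>X\<close> are frozen at their base values.
  \<open>X = UNIV\<close> gives a dense part of a component, and growing sets \<open>X\<close> give
  the chain for the lower bound of the dimension.\<close>

definition SX :: "nat \<Rightarrow> nat \<Rightarrow> nat \<Rightarrow> coord set \<Rightarrow> (complex mat \<times> complex mat) set" where
  "SX n p m X = {cj (gmat n \<theta>) h (std n p m \<theta>) | \<theta> h. inverse_mats n (gmat n \<theta>) h \<and> (\<forall>\<kappa>. \<kappa> \<notin> X \<longrightarrow> \<theta> \<kappa> = base p \<kappa>)}"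

lemma diag_A_diagm: "diag_A n p m a = diagm n (diag_entry p m a)"
  unfolding diag_A_def diagm_def by simp

lemma Bst_carrier [simp]: "Bst n p m z \<in> carrier_mat n n" "dim_row (Bst n p m z) = n" "dim_col (Bst n p m z) = n"
  unfolding Bst_def by auto

lemma partner_less: "i < 2 * p \<Longrightarrow> partner i < 2 * p"
  unfolding partner_def by (auto elim!: evenE)

lemma partner_partner: "partner (partner i) = i"
  unfolding partner_def by (auto elim!: oddE)

lemma partner_neq: "partner i \<noteq> i"
  unfolding partner_def by (auto elim!: oddE)

lemma diag_entry_partner: "i < 2 * p \<Longrightarrow> diag_entry p m a (partner i) = - diag_entry p m a i"
  using partner_less[of i p] unfolding diag_entry_def partner_def by (auto elim!: evenE oddE)

lemma std_Zn: "(diag_A n p m a, Bst n p m z) \<in> Zn n"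
  unfolding diag_A_diagm diag_anticommute_iff[OF Bst_carrier(1)]
proof (intro allI impI)
  fix i j assume "i < n" "j < n"
  then show "(diag_entry p m a i + diag_entry p m a j) * Bst n p m z $$ (i, j) = 0"
    using diag_entry_partner[of i p m a] by (cases "i < 2 * p") (auto simp: Bst_def, simp add: diag_entry_def)
qed

lemma SX_Zn: "SX n p m X \<subseteq> Zn n"
  unfolding SX_def std_def using Zn_cj std_Zn by auto

lemma SX_M2: "SX n p m X \<subseteq> M2 n"
  using SX_Zn Zn_M2 by blast

lemma SX_mono: "X \<subseteq> Y \<Longrightarrow> SX n p m X \<subseteq> SX n p m Y"
  unfolding SX_def by blast

lemma polymatf_adj:
  assumes "polymatf n F" shows "polymatf n (\<lambda>t. adj_mat (F t))"
  unfolding polymatf_def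
proof (intro conjI allI impI)
  fix t show "adj_mat (F t) \<in> carrier_mat n n" using assms adj_mat(1) unfolding polymatf_def by blast
next
  fix i j assume ij: "i < n" "j < n"
  have "mat_delete (F t) j i = mat (n - 1) (n - 1) (\<lambda>(a, b). F t $$ (insert_index j a, insert_index i b))" for t
  proof -
    have "F t \<in> carrier_mat n n" using assms unfolding polymatf_def by auto
    then show ?thesis unfolding mat_delete_def insert_index_def by (auto intro!: eq_matI)
  qed
  moreover have "polymatf (n - 1) (\<lambda>t. mat (n - 1) (n - 1) (\<lambda>(a, b). F t $$ (insert_index j a, insert_index i b)))"
    using assms ij unfolding polymatf_def insert_index_def by (auto simp del: One_nat_def)
  ultimately have "polyf (\<lambda>t. det (mat_delete (F t) j i))" using polymatf_det by simp
  then have "polyf (\<lambda>t. (- 1) ^ (j + i) * det (mat_delete (F t) j i))" by (intro polyf_mult polyf_const)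
  moreover have "adj_mat (F t) $$ (i, j) = (- 1) ^ (j + i) * det (mat_delete (F t) j i)" for t
  proof -
    have "F t \<in> carrier_mat n n" using assms unfolding polymatf_def by auto
    then show ?thesis using ij unfolding adj_mat_def cofactor_def by auto
  qed
  ultimately show "polyf (\<lambda>t. adj_mat (F t) $$ (i, j))" by simp
qed

lemma inverse_mats_det_nz: "inverse_mats n P Q \<Longrightarrow> det P \<noteq> 0"
  using det_mult[of P n Q] unfolding inverse_mats_def by auto

lemma inverse_mats_unique: "inverse_mats n P Q \<Longrightarrow> inverse_mats n P R \<Longrightarrow> Q = R"
  using inverse_mats_cancel(2)[of n P Q R] unfolding inverse_mats_def by auto

lemma inverse_mats_adj: "inverse_mats n P Q \<Longrightarrow> Q = (1 / det P) \<cdot>\<^sub>m adj_mat P"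
  using inverse_mats_unique[OF _ inverse_mats_det[of P n]] inverse_mats_det_nz unfolding inverse_mats_def by blast

text \<open>By Cramer's rule the inverse is replaced by the adjugate over the determinant, which
  makes conjugation an explicit rational expression in the entries of \<open>g\<close>.\<close>

definition cjad :: "complex mat \<Rightarrow> complex mat \<times> complex mat \<Rightarrow> complex mat \<times> complex mat" where
  "cjad g x = cj g ((1 / det g) \<cdot>\<^sub>m adj_mat g) x"

lemma cj_cjad: "inverse_mats n g h \<Longrightarrow> cj g h x = cjad g x"
  unfolding cjad_def using inverse_mats_adj by metis

lemma rational_curve_cjad:
  assumes g: "polymatf n g" and F: "polymatf n F" and G: "polymatf n G"
  shows "rational_curve n (\<lambda>t. det (g t)) (\<lambda>t. cjad (g t) (F t, G t))"
proof -
  have e: "(g t * X t * ((1 / det (g t)) \<cdot>\<^sub>m adj_mat (g t))) $$ (i, j) = 1 / det (g t) * (g t * X t * adj_mat (g t)) $$ (i, j)"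
    if "i < n" "j < n" "polymatf n X" for X i j t
  proof -
    have c: "g t \<in> carrier_mat n n" "X t \<in> carrier_mat n n" using g that unfolding polymatf_def by auto
    note a = adj_mat(1)[OF c(1)]
    have "g t * X t * ((1 / det (g t)) \<cdot>\<^sub>m adj_mat (g t)) = (1 / det (g t)) \<cdot>\<^sub>m (g t * X t * adj_mat (g t))"
      using a c by (intro mult_smult_distrib) auto
    then show ?thesis using that a c by simp
  qed
  have r: "ratf (\<lambda>t. det (g t)) (\<lambda>t. (g t * X t * ((1 / det (g t)) \<cdot>\<^sub>m adj_mat (g t))) $$ (i, j))"
    if "i < n" "j < n" "polymatf n X" for X i j
    unfolding e[OF that] using polymatf_mult[OF polymatf_mult[OF g that(3)] polymatf_adj[OF g]] that
    by (intro ratf_mult ratf_inverse ratf_polyf) (auto simp: polymatf_def)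
  show ?thesis unfolding rational_curve_def cjad_def cj_def fst_conv snd_conv
    using r F G polymatf_det[OF g] by blast
qed

lemma polyf_diag_entry: "(\<And>i. polyf (\<lambda>t. a t i)) \<Longrightarrow> polyf (\<lambda>t. diag_entry p m (a t) i)"
  unfolding diag_entry_def by (intro polyf_if polyf_uminus polyf_const)

lemma polymatf_diag_A: "(\<And>i. polyf (\<lambda>t. a t i)) \<Longrightarrow> polymatf n (\<lambda>t. diag_A n p m (a t))"
  unfolding diag_A_def by (intro polymatf_mat polyf_if polyf_diag_entry polyf_const)

lemma polymatf_Bst: "(\<And>i. polyf (\<lambda>t. z t i)) \<Longrightarrow> polymatf n (\<lambda>t. Bst n p m (z t))"
  unfolding Bst_def by (intro polymatf_mat polyf_if polyf_const)

lemma polymatf_gmat: "(\<And>\<kappa>. polyf (\<lambda>t. \<theta> t \<kappa>)) \<Longrightarrow> polymatf n (\<lambda>t. gmat n (\<theta> t))"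
  unfolding gmat_def by (intro polymatf_mat polyf_if polyf_const)

lemma SX_irreducible: "zariski_irreducible n (SX n p m X)"
proof (rule irreducible_if_rational_curves[OF SX_M2])
  have "gmat n (base p) = 1\<^sub>m n" unfolding gmat_def base_def by (intro eq_matI) auto
  then have "cj (gmat n (base p)) (1\<^sub>m n) (std n p m (base p)) \<in> SX n p m X"
    unfolding SX_def using inverse_mats_one[of n] by (intro CollectI exI[of _ "base p"] exI[of _ "1\<^sub>m n"]) simp
  then show "SX n p m X \<noteq> {}" by auto
next
  fix x y assume "x \<in> SX n p m X" "y \<in> SX n p m X"
  then obtain \<theta> h \<eta> k where x: "x = cj (gmat n \<theta>) h (std n p m \<theta>)" "inverse_mats n (gmat n \<theta>) h" "\<forall>\<kappa>. \<kappa> \<notin> X \<longrightarrow> \<theta> \<kappa> = base p \<kappa>"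
    and y: "y = cj (gmat n \<eta>) k (std n p m \<eta>)" "inverse_mats n (gmat n \<eta>) k" "\<forall>\<kappa>. \<kappa> \<notin> X \<longrightarrow> \<eta> \<kappa> = base p \<kappa>"
    unfolding SX_def by blast
  \<comment> \<open>The coordinates frozen outside \<open>X\<close> agree at both ends, hence along
    the whole line, so the curve stays in the same family wherever the determinant is
    nonzero.\<close>
  define L where "L t \<kappa> = (1 - t) * \<theta> \<kappa> + t * \<eta> \<kappa>" for t :: complex and \<kappa>
  have pL: "polyf (\<lambda>t. L t \<kappa>)" for \<kappa> unfolding L_def by (intro polyf_add polyf_mult polyf_diff polyf_const polyf_id)
  have L0: "L 0 = \<theta>" and L1: "L 1 = \<eta>" unfolding L_def by auto
  define \<gamma> where "\<gamma> t = cjad (gmat n (L t)) (std n p m (L t))" for t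
  define \<delta> where "\<delta> t = det (gmat n (L t))" for t
  have gc: "gmat n (L t) \<in> carrier_mat n n" for t unfolding gmat_def by auto
  have "rational_curve n \<delta> \<gamma>" unfolding \<gamma>_def \<delta>_def std_def
    by (intro rational_curve_cjad polymatf_gmat polymatf_diag_A polymatf_Bst pL)
  moreover have "\<delta> 0 \<noteq> 0" "\<delta> 1 \<noteq> 0" unfolding \<delta>_def L0 L1 using x(2) y(2) inverse_mats_det_nz by auto
  moreover have "\<gamma> 0 = x" "\<gamma> 1 = y" unfolding \<gamma>_def L0 L1 x y using cj_cjad x(2) y(2) by metis+
  moreover have "\<gamma> t \<in> SX n p m X" if "\<delta> t \<noteq> 0" for t
  proof -
    have "inverse_mats n (gmat n (L t)) ((1 / det (gmat n (L t))) \<cdot>\<^sub>m adj_mat (gmat n (L t)))"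
      using gc that unfolding \<delta>_def by (intro inverse_mats_det) auto
    moreover have "\<forall>\<kappa>. \<kappa> \<notin> X \<longrightarrow> L t \<kappa> = base p \<kappa>" using x(3) y(3) unfolding L_def by (simp add: algebra_simps)
    ultimately show ?thesis unfolding SX_def \<gamma>_def cjad_def by blast
  qed
  ultimately show "\<exists>\<delta> \<gamma> T. rational_curve n \<delta> \<gamma> \<and> \<delta> 0 \<noteq> 0 \<and> \<delta> 1 \<noteq> 0 \<and> \<gamma> 0 = x \<and> \<gamma> 1 = y \<and>
       finite T \<and> (\<forall>t. t \<notin> T \<longrightarrow> \<delta> t \<noteq> 0 \<longrightarrow> \<gamma> t \<in> SX n p m X)"
    by (intro exI[of _ \<delta>] exI[of _ \<gamma>] exI[of _ "{}"]) simp
qed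

section \<open>Comparison of \<open>Zcirc\<close> with the parametrized family\<close>

lemma Zcirc_Zn: "Zcirc n p m r \<subseteq> Zn n"
proof
  fix x assume "x \<in> Zcirc n p m r"
  then obtain g h A B where "inverse_mats n g h" "x = cj g h (A, B)" "(A, B) \<in> Zn n"
    unfolding Zcirc_def inverse_mats_def cj_def by auto
  then show "x \<in> Zn n" using Zn_cj by auto
qed

lemma Zcirc_M2: "Zcirc n p m r \<subseteq> M2 n" using Zcirc_Zn Zn_M2 by blast

lemma cj_mem_Zcirc:
  "inverse_mats n g h \<Longrightarrow> good_params p m a \<Longrightarrow> (diag_A n p m a, B) \<in> Zn n \<Longrightarrow> cj g h (diag_A n p m a, B) \<in> Zcirc n p m r"
  unfolding Zcirc_def inverse_mats_def cj_def fst_conv snd_conv by blast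

lemma good_params_line:
  assumes "\<And>i. polyf (\<lambda>t. a t i)" "good_params p m (a t1)"
  shows "finite {t. \<not> good_params p m (a t)}"
proof -
  define f where "f t = (\<Prod>i<p+m. a t i) * (\<Prod>i<p+m. \<Prod>j<p+m. if i = j then 1 else (a t i - a t j) * (a t i + a t j))" for t
  have pf: "polyf f" unfolding f_def[abs_def]
    by (intro polyf_mult polyf_prod polyf_if polyf_const polyf_diff polyf_add assms(1))
  have iff: "f t \<noteq> 0 \<longleftrightarrow> good_params p m (a t)" for t
    unfolding f_def good_params_def by (auto simp: add_eq_0_iff2)
  have "finite {t. f t = 0}" using polyf_finite_zeros[OF pf, of t1] iff assms(2) by auto
  then show ?thesis using iff by (metis (mono_tags, lifting) Collect_cong)
qed

lemma good_params_exists: "good_params p m (\<lambda>i. of_nat (i + 1))"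
  unfolding good_params_def
proof (intro conjI allI impI)
  fix i j :: nat
  have "(of_nat (i + 1) + of_nat (j + 1) :: complex) = of_nat (i + j + 2)" by simp
  also have "\<dots> \<noteq> 0" by (simp only: of_nat_eq_0_iff)
  finally show "(of_nat (i + 1) :: complex) \<noteq> - of_nat (j + 1)" by (metis add_eq_0_iff2)
qed (simp_all add: of_nat_neq_0 del: of_nat_Suc of_nat_add)

text \<open>Arbitrary eigenvalues lie on a line to 1, 2, 3, ..., and all but finitely many points of
  that line are good parameters. \<open>B\<close> stays fixed, since it anticommutes with the first
  matrix for every \<open>a\<close>.\<close>

lemma std_conj_in_closure_Zcirc:
  assumes gh: "inverse_mats n g h" and Z: "\<And>a. (diag_A n p m a, B) \<in> Zn n"
  shows "cj g h (diag_A n p m a, B) \<in> zariski_closure n (Zcirc n p m r)"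
proof -
  define L where "L t i = (1 - t) * a i + t * of_nat (i + 1)" for t :: complex and i
  have pL: "polyf (\<lambda>t. L t i)" for i unfolding L_def by (intro polyf_add polyf_mult polyf_diff polyf_const polyf_id)
  have L0: "L 0 = a" and L1: "L 1 = (\<lambda>i. of_nat (i + 1))" unfolding L_def by auto
  have fin: "finite {t. \<not> good_params p m (L t)}" using good_params_line[OF pL, of p m 1] good_params_exists L1 by auto
  define F where "F t = g * diag_A n p m (L t) * h" for t
  have B: "B \<in> carrier_mat n n" using Z unfolding Zn_iff by auto
  note gg = inverse_matsD[OF gh]
  have pF: "polymatf n F" unfolding F_def[abs_def] using gg by (intro polymatf_mult polymatf_const polymatf_diag_A pL)
  have mem: "(F t, g * B * h) \<in> zariski_closure n (Zcirc n p m r)" if "t \<notin> {t. \<not> good_params p m (L t)}" for t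
    using cj_mem_Zcirc[OF gh _ Z] that closure_subset[of "Zcirc n p m r" n] unfolding cj_def F_def by auto
  have "polymatf n (\<lambda>t. g * B * h)" using gg B by (intro polymatf_const) auto
  from closure_polymat_curve[OF Zcirc_M2 pF this fin mem, of 0]
  have "(F 0, g * B * h) \<in> zariski_closure n (Zcirc n p m r)" by simp
  then show ?thesis unfolding F_def L0 cj_def by simp
qed

lemma diagonalizable_if_card_eigenvalues:
  assumes X: "X \<in> carrier_mat n n" and card: "card {x. eigenvalue X x} = n"
  obtains P Q d where "inverse_mats n P Q" "X = P * diagm n d * Q"
proof -
  obtain P Q e pos sz where j: "inverse_mats n P Q" "jdata n e pos sz" "X = P * jmat n e pos sz * Q"
    by (rule jordan_basis[OF X])
  have "{x. eigenvalue X x} = e ` {..<n}"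
    unfolding j(3) upper_triangular_eigenvalue[OF jmat_carrier(1) jmat_upper j(1)] by (auto simp: jmat_index)
  then have inj: "inj_on e {..<n}" using card by (intro eq_card_imp_inj_on) auto
  have "jmat n e pos sz = diagm n e"
  proof (rule eq_matI)
    fix i l assume "i < dim_row (diagm n e)" "l < dim_col (diagm n e)"
    then have il: "i < n" "l < n" by auto
    have "\<not> Suc (pos i) < sz i"
    proof
      assume s: "Suc (pos i) < sz i"
      show False using inj_onD[OF inj jdata_next(4)[OF j(2) il(1) s]] jdata_next(1)[OF j(2) il(1) s] il by auto
    qed
    then show "jmat n e pos sz $$ (i, l) = diagm n e $$ (i, l)" using il by (simp add: jmat_index)
  qed auto
  then show ?thesis using that[OF j(1)] j(3) by simp
qed

lemma Bst_dsum:
  assumes "n = (2 * p + m) + r"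
  shows "Bst n p m z = dsum_mat (Bst (2 * p + m) p m z) (diagm r (\<lambda>i. z (i + (2 * p + m))))"
proof (rule eq_matI)
  let ?D = "dsum_mat (Bst (2 * p + m) p m z) (diagm r (\<lambda>i. z (i + (2 * p + m))))"
  have dc: "?D \<in> carrier_mat n n" unfolding assms by (rule dsum_mat_carrier) auto
  show "dim_row (Bst n p m z) = dim_row ?D" "dim_col (Bst n p m z) = dim_col ?D" using dc by auto
  fix i j assume "i < dim_row ?D" "j < dim_col ?D"
  then have ij: "i < (2 * p + m) + r" "j < (2 * p + m) + r" using dc assms by auto
  show "Bst n p m z $$ (i, j) = ?D $$ (i, j)"
    using ij partner_less[of i p] unfolding dsum_mat_index[OF Bst_carrier(1) diagm_carrier(1) ij]
    by (cases "i < 2 * p + m"; cases "j < 2 * p + m") (auto simp: Bst_def assms)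
qed

lemma diag_A_dsum:
  assumes "n = (2 * p + m) + r"
  shows "diag_A n p m a = dsum_mat (diag_A (2 * p + m) p m a) (0\<^sub>m r r)"
proof -
  have z: "0\<^sub>m r r = diagm r (\<lambda>_. 0)" by (intro eq_matI) auto
  have "(\<lambda>i. if i < 2 * p + m then diag_entry p m a i else 0) = diag_entry p m a"
    by (rule ext) (simp add: diag_entry_def)
  then show ?thesis unfolding diag_A_diagm z dsum_diag assms by simp
qed

text \<open>Good eigenvalues force the shape of \<open>B\<close> except on the kernel of
  \<open>A\<close>, where it is an arbitrary block \<open>C\<close>. Spreading the eigenvalues of
  \<open>C\<close> makes it diagonalizable, and a change of basis inside the kernel does not affect
  \<open>A\<close>.\<close>

lemma Zcirc_in_closure_std:
  assumes n: "n = (2 * p + m) + r" and x: "x \<in> Zcirc n p m r"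
    and W: "W \<subseteq> M2 n" "\<And>g h a z. inverse_mats n g h \<Longrightarrow> cj g h (diag_A n p m a, Bst n p m z) \<in> zariski_closure n W"
  shows "x \<in> zariski_closure n W"
proof -
  define q where "q = 2 * p + m"
  have nq: "n = q + r" using n q_def by simp
  obtain g h B a where gh: "inverse_mats n g h" and xeq: "x = cj g h (diag_A n p m a, B)" and Z: "(diag_A n p m a, B) \<in> Zn n"
    and gp: "good_params p m a"
    using x unfolding Zcirc_def inverse_mats_def cj_def by auto
  note gg = inverse_matsD[OF gh]
  have B: "B \<in> carrier_mat n n" using Z unfolding Zn_iff by auto
  have zero: "B $$ (i, j) = 0" if "i < n" "j < n" "diag_entry p m a i + diag_entry p m a j \<noteq> 0" for i j
    using Z that unfolding diag_A_diagm diag_anticommute_iff[OF B] by auto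
  \<comment> \<open>Two diagonal entries of which the first is nonzero can cancel only at partner
    indices. Off the kernel this confines \<open>B\<close> to the positions
    \<open>(i, partner i)\<close>.\<close>
  have nz: "diag_entry p m a i + diag_entry p m a j \<noteq> 0" if ij: "i < q" "\<not> (i < 2 * p \<and> j = partner i)" for i j
  proof -
    have ai: "a k \<noteq> 0" if "k < p + m" for k using gp that unfolding good_params_def by auto
    have aij: "a k \<noteq> a l" "a k \<noteq> - a l" if "k < p + m" "l < p + m" "k \<noteq> l" for k l using gp that unfolding good_params_def by auto
    define k where "k = (if i < 2 * p then i div 2 else i - p)"
    define l where "l = (if j < 2 * p then j div 2 else j - p)"
    have k: "k < p + m" "diag_entry p m a i = a k \<or> diag_entry p m a i = - a k"
      using ij(1) unfolding k_def q_def diag_entry_def by auto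
    have sa: "a k + a k \<noteq> 0" using ai[OF k(1)] by simp
    show ?thesis
    proof (cases "j < q")
      case False
      then have "diag_entry p m a j = 0" unfolding q_def diag_entry_def by auto
      then show ?thesis using k ai[OF k(1)] by auto
    next
      case True
      have l: "l < p + m" "diag_entry p m a j = a l \<or> diag_entry p m a j = - a l"
        using True unfolding l_def q_def diag_entry_def by auto
      show ?thesis
      proof (cases "k = l")
        case False
        then show ?thesis using k l aij[OF k(1) l(1) False] by (auto simp: add_eq_0_iff2 minus_equation_iff[of "a k"])
      next
        case kl: True
        have "diag_entry p m a i = diag_entry p m a j"
        proof (cases "i < 2 * p")
          case i: True
          have j: "j < 2 * p" using kl i True unfolding k_def l_def q_def by (auto split: if_splits)
          have "i div 2 = j div 2" using kl i j unfolding k_def l_def by simp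
          moreover have "j \<noteq> partner i" using ij(2) i by simp
          ultimately have "i = j" unfolding partner_def by (auto elim!: evenE oddE split: if_splits)
          then show ?thesis by simp
        next
          case i: False
          then have "\<not> j < 2 * p" using kl ij(1) unfolding k_def l_def q_def by (auto split: if_splits)
          then have "i = j" using kl i unfolding k_def l_def by auto
          then show ?thesis by simp
        qed
        then show ?thesis using k sa by (auto simp: add_eq_0_iff2)
      qed
    qed
  qed
  define z where "z i = B $$ (i, partner i)" for i
  define C where "C = mat r r (\<lambda>(i, j). B $$ (i + q, j + q))"
  have C: "C \<in> carrier_mat r r" unfolding C_def by auto
  have Bd: "B = dsum_mat (Bst q p m z) C"
  proof (rule eq_matI)
    have dc: "dsum_mat (Bst q p m z) C \<in> carrier_mat n n" unfolding nq by (rule dsum_mat_carrier[OF Bst_carrier(1) C])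
    then show "dim_row B = dim_row (dsum_mat (Bst q p m z) C)" "dim_col B = dim_col (dsum_mat (Bst q p m z) C)" using B by auto
    fix i j assume "i < dim_row (dsum_mat (Bst q p m z) C)" "j < dim_col (dsum_mat (Bst q p m z) C)"
    then have ij: "i < q + r" "j < q + r" using dc nq by auto
    have ijn: "i < n" "j < n" using ij nq by auto
    show "B $$ (i, j) = dsum_mat (Bst q p m z) C $$ (i, j)"
    proof (cases "i < q")
      case iq: True
      show ?thesis
      proof (cases "i < 2 * p \<and> j = partner i")
        case True
        then have "j < q" using partner_less[of i p] unfolding q_def by simp
        then show ?thesis using True iq unfolding dsum_mat_index[OF Bst_carrier(1) C ij] by (simp add: Bst_def z_def)
      next
        case False
        have "B $$ (i, j) = 0" using zero[OF ijn nz[OF iq False]] .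
        then show ?thesis using False iq unfolding dsum_mat_index[OF Bst_carrier(1) C ij] by (auto simp: Bst_def q_def)
      qed
    next
      case iq: False
      show ?thesis
      proof (cases "j < q")
        case True
        have "\<not> (j < 2 * p \<and> i = partner j)" using iq partner_less[of j p] unfolding q_def by auto
        from nz[OF True this] have "B $$ (i, j) = 0" by (intro zero[OF ijn]) (simp add: add.commute)
        then show ?thesis using True iq unfolding dsum_mat_index[OF Bst_carrier(1) C ij] by simp
      next
        case False
        then show ?thesis using iq ij unfolding dsum_mat_index[OF Bst_carrier(1) C ij] by (simp add: C_def)
      qed
    qed
  qed
  obtain P Q e pos sz where j: "inverse_mats r P Q" "jdata r e pos sz" "C = P * jmat r e pos sz * Q"
    by (rule jordan_basis[OF C])
  note pq = inverse_matsD[OF j(1)]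
  \<comment> \<open>The eigenvalues of the kernel block move towards 0, 1, 2, ..., so they are
    distinct for all but finitely many \<open>t\<close>.\<close>
  define E where "E t i = (1 - t) * e i + t * of_nat i" for t :: complex and i :: nat
  define D where "D t = P * jmat r (E t) pos sz * Q" for t
  have pE: "polyf (\<lambda>t. E t i)" for i unfolding E_def by (intro polyf_add polyf_mult polyf_diff polyf_const polyf_id)
  have E0: "E 0 = e" and E1: "E 1 = (\<lambda>i. of_nat i)" unfolding E_def by auto
  have D0: "D 0 = C" unfolding D_def E0 j(3) ..
  have Dc: "D t \<in> carrier_mat r r" for t unfolding D_def using pq by auto
  have pD: "polymatf r D" unfolding D_def[abs_def] jmat_def using pq by (intro polymatf_mult polymatf_const polymatf_mat polyf_if polyf_const pE)
  define f where "f t = (\<Prod>i<r. \<Prod>l<r. if i = l then 1 else E t i - E t l)" for t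
  have pf: "polyf f" unfolding f_def[abs_def] by (intro polyf_prod polyf_if polyf_const polyf_diff pE)
  have "f 1 \<noteq> 0" unfolding f_def E1 by auto
  then have fin: "finite {t. f t = 0}" by (rule polyf_finite_zeros[OF pf])
  define F where "F t = g * dsum_mat (Bst q p m z) (D t) * h" for t
  have pds: "polymatf n (\<lambda>t. dsum_mat (Bst q p m z) (D t))"
    unfolding polymatf_def
  proof (intro conjI allI impI)
    fix t show "dsum_mat (Bst q p m z) (D t) \<in> carrier_mat n n" unfolding nq by (rule dsum_mat_carrier[OF Bst_carrier(1) Dc])
  next
    fix i j assume ij: "i < n" "j < n"
    then have ij': "i < q + r" "j < q + r" using nq by auto
    show "polyf (\<lambda>t. dsum_mat (Bst q p m z) (D t) $$ (i, j))"
      unfolding dsum_mat_index[OF Bst_carrier(1) Dc ij'] using pD ij'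
      by (intro polyf_if polyf_const) (auto simp: polymatf_def)
  qed
  have pF: "polymatf n F" unfolding F_def[abs_def] using gg pds by (intro polymatf_mult polymatf_const)
  have mem: "(g * diag_A n p m a * h, F t) \<in> zariski_closure n W" if t: "t \<notin> {t. f t = 0}" for t
  proof -
    have inj: "inj_on (E t) {..<r}"
    proof (rule inj_onI, rule ccontr)
      fix i l assume il: "i \<in> {..<r}" "l \<in> {..<r}" "E t i = E t l" "i \<noteq> l"
      then have "(if i = l then 1 else E t i - E t l) = 0" by simp
      then have "(\<Prod>l<r. if i = l then 1 else E t i - E t l) = 0" using il(2) by (intro prod_zero) blast+
      then have "f t = 0" unfolding f_def using il(1) by (intro prod_zero) blast+
      then show False using t by simp
    qed
    have "{x. eigenvalue (D t) x} = E t ` {..<r}"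
      unfolding D_def upper_triangular_eigenvalue[OF jmat_carrier(1) jmat_upper j(1)] by (auto simp: jmat_index)
    then have "card {x. eigenvalue (D t) x} = r" using card_image[OF inj] by simp
    from diagonalizable_if_card_eigenvalues[OF Dc this] obtain R S d where rs: "inverse_mats r R S" "D t = R * diagm r d * S" .
    note rr = inverse_matsD[OF rs(1)]
    define z' where "z' i = (if i < q then z i else d (i - q))" for i
    have zq: "Bst q p m z' = Bst q p m z" unfolding Bst_def z'_def q_def by (intro eq_matI) auto
    have Bz: "Bst n p m z' = dsum_mat (Bst q p m z) (diagm r d)"
      using Bst_dsum[OF n, of z'] unfolding q_def[symmetric] zq unfolding z'_def by simp
    \<comment> \<open>This conjugation acts only on the kernel of the first matrix: it fixes that
      matrix and takes the diagonal kernel block \<open>diagm r d\<close> of the second one to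
      \<open>D t\<close>.\<close>
    define G where "G = dsum_mat (1\<^sub>m q) R"
    define H where "H = dsum_mat (1\<^sub>m q) S"
    have GH: "inverse_mats n G H" unfolding G_def H_def nq by (rule dsum_inverse[OF inverse_mats_one rs(1)])
    have dA: "diag_A n p m a = dsum_mat (diag_A q p m a) (0\<^sub>m r r)" using diag_A_dsum[OF n] unfolding q_def by simp
    have dAc: "diag_A q p m a \<in> carrier_mat q q" unfolding diag_A_def by auto
    have "G * diag_A n p m a * H = diag_A n p m a"
      unfolding dA G_def H_def using rr dAc by (simp add: dsum_mat_mult[of _ q _ r])
    moreover have "G * Bst n p m z' * H = dsum_mat (Bst q p m z) (D t)"
      unfolding Bz G_def H_def rs(2) using rr by (simp add: dsum_mat_mult[of _ q _ r])
    ultimately have "cj G H (diag_A n p m a, Bst n p m z') = (diag_A n p m a, dsum_mat (Bst q p m z) (D t))"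
      unfolding cj_def by simp
    moreover have "(diag_A n p m a, Bst n p m z') \<in> M2 n" using std_Zn Zn_M2 by blast
    ultimately have "cj (g * G) (H * h) (diag_A n p m a, Bst n p m z') = (g * diag_A n p m a * h, F t)"
      using cj_cj[OF gh GH] unfolding F_def by (metis cj_def fst_conv snd_conv)
    then show ?thesis using W(2)[OF inverse_mats_mult[OF gh GH], of a z'] by simp
  qed
  have Ac: "diag_A n p m a \<in> carrier_mat n n" unfolding diag_A_def by auto
  then have Ac': "g * diag_A n p m a * h \<in> carrier_mat n n" using gg by auto
  from closure_polymat_curve[OF W(1) polymatf_const[OF Ac'] pF fin mem, of 0]
  have "(g * diag_A n p m a * h, F 0) \<in> zariski_closure n W" by simp
  then show ?thesis unfolding xeq cj_def F_def D0 Bd[symmetric] by simp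
qed

text \<open>A matrix with nonzero diagonal entries is a matrix with unit diagonal times a diagonal
  one, and the diagonal factor only rescales \<open>z\<close>. The line from \<open>g\<close> to the
  identity reaches such matrices for all but finitely many parameters.\<close>

lemma std_conj_in_closure_SX:
  assumes gh: "inverse_mats n g h" and n: "2 * p + m \<le> n"
  shows "cj g h (diag_A n p m a, Bst n p m z) \<in> zariski_closure n (SX n p m UNIV)"
proof -
  note gg = inverse_matsD[OF gh]
  let ?x = "(diag_A n p m a, Bst n p m z)"
  define L where "L t = (1 - t) \<cdot>\<^sub>m g + t \<cdot>\<^sub>m 1\<^sub>m n" for t
  have pL: "polymatf n L" unfolding L_def[abs_def] using gg by (intro polymatf_line) auto
  have L0: "L 0 = g" and L1: "L 1 = 1\<^sub>m n" unfolding L_def using gg by (auto intro!: eq_matI)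
  have Lc: "L t \<in> carrier_mat n n" for t using pL unfolding polymatf_def by auto
  define f where "f t = (\<Prod>i<n. L t $$ (i, i))" for t
  have pf: "polyf f" unfolding f_def[abs_def] using pL by (intro polyf_prod) (auto simp: polymatf_def)
  have "f 1 \<noteq> 0" unfolding f_def L1 by simp
  then have fin: "finite {t. f t = 0}" by (rule polyf_finite_zeros[OF pf])
  define \<gamma> where "\<gamma> t = cjad (L t) ?x" for t
  have rc: "rational_curve n (\<lambda>t. det (L t)) \<gamma>" unfolding \<gamma>_def
    by (intro rational_curve_cjad pL polymatf_const) (auto simp: diag_A_def)
  have x: "?x \<in> M2 n" using std_Zn Zn_M2 by blast
  have mem: "\<gamma> t \<in> zariski_closure n (SX n p m UNIV)" if t: "t \<notin> {t. f t = 0}" "det (L t) \<noteq> 0" for t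
  proof -
    define d where "d i = L t $$ (i, i)" for i
    have d0: "d i \<noteq> 0" if "i < n" for i using t(1) that unfolding f_def d_def by auto
    define di where "di i = 1 / d i" for i
    have DD: "inverse_mats n (diagm n d) (diagm n di)"
      unfolding inverse_mats_def using d0
      by (auto intro!: eq_matI simp: diagm_mult_entry[of _ n] di_def simp del: index_mult_mat(1))
    note dd = inverse_matsD[OF DD]
    define LH where "LH = (1 / det (L t)) \<cdot>\<^sub>m adj_mat (L t)"
    have LH: "inverse_mats n (L t) LH" unfolding LH_def using Lc t(2) by (rule inverse_mats_det)
    define U where "U = L t * diagm n di"
    have U: "inverse_mats n U (diagm n d * LH)" unfolding U_def using LH inverse_mats_sym[OF DD] by (rule inverse_mats_mult)
    have UD: "U * diagm n d = L t" unfolding U_def using inverse_mats_cancel(4)[OF DD Lc] by simp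
    have HD: "diagm n di * (diagm n d * LH) = LH" using inverse_mats_cancel(2)[OF DD] LH unfolding inverse_mats_def by auto
    \<comment> \<open>Conjugation by \<open>diagm n d\<close> scales the entry at
      \<open>(i, partner i)\<close> by \<open>d i / d (partner i)\<close> and leaves diagonal
      entries alone.\<close>
    define z' where "z' i = (if i < 2 * p then d i * z i * di (partner i) else z i)" for i
    have "diagm n d * diag_A n p m a * diagm n di = diag_A n p m a"
    proof (rule eq_matI)
      fix i j assume "i < dim_row (diag_A n p m a)" "j < dim_col (diag_A n p m a)"
      then have ij: "i < n" "j < n" unfolding diag_A_def by auto
      have c: "diag_A n p m a \<in> carrier_mat n n" "diagm n d * diag_A n p m a \<in> carrier_mat n n" unfolding diag_A_def by auto
      show "(diagm n d * diag_A n p m a * diagm n di) $$ (i, j) = diag_A n p m a $$ (i, j)"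
        unfolding diagm_mult_entry(2)[OF c(2) ij] diagm_mult_entry(1)[OF c(1) ij]
        using ij d0[OF ij(1)] by (auto simp: diag_A_def di_def)
    qed (auto simp: diag_A_def)
    moreover have "diagm n d * Bst n p m z * diagm n di = Bst n p m z'"
    proof (rule eq_matI)
      fix i j assume "i < dim_row (Bst n p m z')" "j < dim_col (Bst n p m z')"
      then have ij: "i < n" "j < n" by auto
      have c: "diagm n d * Bst n p m z \<in> carrier_mat n n" by auto
      show "(diagm n d * Bst n p m z * diagm n di) $$ (i, j) = Bst n p m z' $$ (i, j)"
        unfolding diagm_mult_entry(2)[OF c ij] diagm_mult_entry(1)[OF Bst_carrier(1) ij]
        using ij d0[OF ij(1)] by (auto simp: Bst_def di_def z'_def)
    qed auto
    ultimately have "cj (diagm n d) (diagm n di) ?x = (diag_A n p m a, Bst n p m z')" unfolding cj_def by simp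
    then have "cj (L t) LH ?x = cj U (diagm n d * LH) (diag_A n p m a, Bst n p m z')"
      using cj_cj[OF U DD x] unfolding UD HD by simp
    moreover define \<theta> where "\<theta> \<kappa> = (case \<kappa> of CG i j \<Rightarrow> U $$ (i, j) | CA i \<Rightarrow> a i | CZ i \<Rightarrow> z' i)" for \<kappa>
    have "gmat n \<theta> = U"
    proof (rule eq_matI)
      have Uc: "U \<in> carrier_mat n n" using U unfolding inverse_mats_def by auto
      then show "dim_row (gmat n \<theta>) = dim_row U" "dim_col (gmat n \<theta>) = dim_col U" unfolding gmat_def by auto
      fix i j assume "i < dim_row U" "j < dim_col U"
      then have ij: "i < n" "j < n" using Uc by auto
      have "U $$ (i, j) = L t $$ (i, j) * di j" unfolding U_def using diagm_mult_entry(2)[OF Lc ij] .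
      then show "gmat n \<theta> $$ (i, j) = U $$ (i, j)" using ij d0[OF ij(1)] unfolding gmat_def \<theta>_def di_def d_def by auto
    qed
    moreover have "std n p m \<theta> = (diag_A n p m a, Bst n p m z')" unfolding std_def \<theta>_def by simp
    ultimately have "cj (L t) LH ?x \<in> SX n p m UNIV"
      unfolding SX_def using U by (intro CollectI exI[of _ \<theta>] exI[of _ "diagm n d * LH"]) simp
    then show ?thesis using closure_subset unfolding \<gamma>_def cjad_def LH_def by blast
  qed
  have "\<gamma> 0 \<in> zariski_closure n (SX n p m UNIV)"
  proof (rule closure_rational_curve[OF SX_M2 rc fin])
    show "det (L 0) \<noteq> 0" unfolding L0 using inverse_mats_det_nz[OF gh] .
    show "\<gamma> 0 \<in> M2 n" unfolding \<gamma>_def L0 using cj_cjad[OF gh] cj_M2[OF gh x] by metis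
  qed (use mem in auto)
  then show ?thesis unfolding \<gamma>_def L0 using cj_cjad[OF gh] by metis
qed

lemma Zpmr_eq_closure_SX:
  assumes n: "2 * p + m + r = n"
  shows "Zpmr n p m r = zariski_closure n (SX n p m UNIV)"
proof
  have "Zcirc n p m r \<subseteq> zariski_closure n (SX n p m UNIV)"
    using Zcirc_in_closure_std[OF n[symmetric] _ SX_M2 std_conj_in_closure_SX] n by auto
  then show "Zpmr n p m r \<subseteq> zariski_closure n (SX n p m UNIV)" unfolding Zpmr_def by (rule closure_least[OF SX_M2])
  have "SX n p m UNIV \<subseteq> zariski_closure n (Zcirc n p m r)"
    unfolding SX_def std_def using std_conj_in_closure_Zcirc[OF _ std_Zn] by blast
  then show "zariski_closure n (SX n p m UNIV) \<subseteq> Zpmr n p m r" unfolding Zpmr_def by (rule closure_least[OF Zcirc_M2])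
qed

lemma diag_entry_inj:
  assumes gp: "good_params p m a" and ij: "i < 2 * p + m" "j < 2 * p + m" "diag_entry p m a i = diag_entry p m a j"
  shows "i = j"
proof -
  have ai: "a k \<noteq> 0" if "k < p + m" for k using gp that unfolding good_params_def by auto
  have aij: "k = l" if "k < p + m" "l < p + m" "a k = a l \<or> a k = - a l" for k l using gp that unfolding good_params_def by blast
  define k where "k = (if i < 2 * p then i div 2 else i - p)"
  define l where "l = (if j < 2 * p then j div 2 else j - p)"
  have k: "k < p + m" "diag_entry p m a i = (if i < 2 * p \<and> odd i then - a k else a k)"
    using ij(1) unfolding k_def diag_entry_def by auto
  have l: "l < p + m" "diag_entry p m a j = (if j < 2 * p \<and> odd j then - a l else a l)"
    using ij(2) unfolding l_def diag_entry_def by auto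
  have "(if i < 2 * p \<and> odd i then - a k else a k) = (if j < 2 * p \<and> odd j then - a l else a l)"
    using ij(3) k(2) l(2) by simp
  then have "a k = a l \<or> a k = - a l" by (metis minus_minus)
  then have kl: "k = l" by (rule aij[OF k(1) l(1)])
  have "a k \<noteq> - a k" using ai[OF k(1)] by simp
  then have par: "(i < 2 * p \<and> odd i) = (j < 2 * p \<and> odd j)" using ij(3) unfolding k(2) l(2) kl by (auto split: if_splits)
  show ?thesis
  proof (cases "i < 2 * p")
    case True
    then have "j < 2 * p" using kl unfolding k_def l_def by (auto split: if_splits)
    then have "i div 2 = j div 2" "odd i = odd j" using kl True par unfolding k_def l_def by auto
    then show ?thesis by (metis dvd_mult_div_cancel odd_two_times_div_two_succ)
  next
    case False
    then have "\<not> j < 2 * p" using kl ij(1) unfolding k_def l_def by (auto split: if_splits)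
    then show ?thesis using kl False unfolding k_def l_def by auto
  qed
qed

text \<open>\<open>Y\<close> holds one representative of each pair of opposite elements of
  \<open>V\<close>, and \<open>M\<close> the elements whose negative is missing. Their cardinalities
  are \<open>p\<close> and \<open>m\<close>.\<close>

lemma sign_pairing:
  fixes V :: "complex set"
  assumes fin: "finite V" and nz: "0 \<notin> V"
  obtains p m a where "good_params p m a" "bij_betw (diag_entry p m a) {..<2 * p + m} V"
proof -
  \<comment> \<open>A half plane with half of its boundary line: it contains exactly one of
    \<open>x\<close> and \<open>- x\<close> for nonzero \<open>x\<close>.\<close>
  define H where "H x \<longleftrightarrow> Re x > 0 \<or> (Re x = 0 \<and> Im x > 0)" for x
  have H: "H (- x) \<longleftrightarrow> \<not> H x" if "x \<noteq> 0" for x using that unfolding H_def by (auto simp: complex_eq_iff)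
  define Y where "Y = {x \<in> V. - x \<in> V \<and> H x}"
  define M where "M = {x \<in> V. - x \<notin> V}"
  have finYM: "finite Y" "finite M" unfolding Y_def M_def using fin by auto
  obtain y where y: "bij_betw y {..<card Y} Y" using ex_bij_betw_nat_finite[OF finYM(1)] unfolding atLeast0LessThan by auto
  obtain w where w: "bij_betw w {..<card M} M" using ex_bij_betw_nat_finite[OF finYM(2)] unfolding atLeast0LessThan by auto
  define p where "p = card Y"
  define m where "m = card M"
  define a where "a i = (if i < p then y i else w (i - p))" for i
  have aY: "a i \<in> Y" if "i < p" for i using bij_betwE[OF y] that unfolding a_def p_def by simp
  have aM: "a (p + i) \<in> M" if "i < m" for i using bij_betwE[OF w] that unfolding a_def m_def by simp
  have aM': "a i \<in> M" if "p \<le> i" "i < p + m" for i using aM[of "i - p"] that by simp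
  have aV: "a i \<in> V" if "i < p + m" for i
    using aY[of i] aM'[of i] that unfolding Y_def M_def by (cases "i < p") auto
  have YM: "Y \<inter> M = {}" unfolding Y_def M_def by auto
  have gp: "good_params p m a"
    unfolding good_params_def
  proof (intro conjI allI impI)
    fix i assume "i < p + m" then show "a i \<noteq> 0" using aV nz by metis
  next
    fix i j assume ij: "i < p + m" "j < p + m" "i \<noteq> j"
    show "a i \<noteq> a j"
    proof
      assume eq: "a i = a j"
      consider "i < p" "j < p" | "i < p" "p \<le> j" | "p \<le> i" "j < p" | "p \<le> i" "p \<le> j" by linarith
      then show False
      proof cases
        case 1 then show ?thesis using eq ij(3) bij_betw_imp_inj_on[OF y] unfolding a_def p_def inj_on_def by auto
      next
        case 2 then show ?thesis using aY[of i] aM'[of j] ij eq YM by auto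
      next
        case 3 then show ?thesis using aY[of j] aM'[of i] ij eq YM by auto
      next
        case 4
        then have "i - p < m" "j - p < m" "w (i - p) = w (j - p)" "i - p \<noteq> j - p" using ij eq unfolding a_def by auto
        then show ?thesis using bij_betw_imp_inj_on[OF w] unfolding m_def inj_on_def by auto
      qed
    qed
    show "a i \<noteq> - a j"
    proof
      assume eq: "a i = - a j"
      have "- a j \<in> V" "- a i \<in> V" using aV[OF ij(1)] aV[OF ij(2)] eq by auto
      then have "a i \<notin> M" "a j \<notin> M" unfolding M_def by auto
      then have "i < p" "j < p" using aM' ij by (meson not_le)+
      then have "H (a i)" "H (a j)" using aY unfolding Y_def by auto
      moreover have "a j \<noteq> 0" using aV[OF ij(2)] nz by metis
      ultimately show False using H[of "a j"] eq by simp
    qed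
  qed
  have "diag_entry p m a ` {..<2 * p + m} = V"
  proof (intro equalityI subsetI)
    fix x assume "x \<in> diag_entry p m a ` {..<2 * p + m}"
    then obtain i where i: "i < 2 * p + m" "x = diag_entry p m a i" by auto
    show "x \<in> V"
    proof (cases "i < 2 * p")
      case True
      then have "a (i div 2) \<in> Y" by (intro aY) auto
      then show ?thesis using i True unfolding diag_entry_def Y_def by auto
    next
      case False
      then show ?thesis using i aV[of "i - p"] unfolding diag_entry_def by auto
    qed
  next
    fix x assume x: "x \<in> V"
    consider "x \<in> M" | "x \<in> Y" | "- x \<in> Y"
      using x H[of x] nz unfolding M_def Y_def by (cases "x = 0") auto
    then show "x \<in> diag_entry p m a ` {..<2 * p + m}"
    proof cases
      case 1
      then obtain i where "i < m" "x = w i" using w unfolding bij_betw_def m_def by auto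
      then have "x = diag_entry p m a (2 * p + i)" "2 * p + i < 2 * p + m" unfolding diag_entry_def a_def by auto
      then show ?thesis by auto
    next
      case 2
      then obtain i where "i < p" "x = y i" using y unfolding bij_betw_def p_def by auto
      then have "x = diag_entry p m a (2 * i)" "2 * i < 2 * p + m" unfolding diag_entry_def a_def by auto
      then show ?thesis by auto
    next
      case 3
      then obtain i where "i < p" "- x = y i" using y unfolding bij_betw_def p_def by auto
      from this(2) have "x = - y i" by (metis minus_minus)
      with \<open>i < p\<close> have "x = diag_entry p m a (2 * i + 1)" "2 * i + 1 < 2 * p + m" unfolding diag_entry_def a_def by (auto simp: minus_equation_iff)
      then show ?thesis by auto
    qed
  qed
  moreover have "inj_on (diag_entry p m a) {..<2 * p + m}" by (rule inj_onI) (use diag_entry_inj[OF gp] in auto)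
  ultimately show ?thesis using that[OF gp] unfolding bij_betw_def by blast
qed

text \<open>The nonzero eigenvalues of a generic pair are distinct, so \<open>sign_pairing\<close>
  orders them as in \<open>diag_A\<close>. A permutation of the eigenbasis realizes this order, with
  the kernel placed last.\<close>

lemma Ugen_subset_Zcirc: "Ugen n \<subseteq> (\<Union>(p, m, r)\<in>TP n. Zcirc n p m r)"
proof
  fix x assume "x \<in> Ugen n"
  then obtain A B P Q d where x: "x = (A, B)" "(A, B) \<in> Zn n" "inverse_mats n P Q" "A = P * diagm n d * Q"
    and d: "\<And>i j. i < n \<Longrightarrow> j < n \<Longrightarrow> i \<noteq> j \<Longrightarrow> d i \<noteq> 0 \<Longrightarrow> d i \<noteq> d j" unfolding Ugen_def by blast
  define S where "S = {i. i < n \<and> d i \<noteq> 0}"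
  have S: "S \<subseteq> {..<n}" "finite S" unfolding S_def by auto
  have dS: "bij_betw d S (d ` S)" using d unfolding S_def by (intro inj_on_imp_bij_betw inj_onI) blast
  obtain p m a where gp: "good_params p m a" and bij: "bij_betw (diag_entry p m a) {..<2 * p + m} (d ` S)"
    by (rule sign_pairing[of "d ` S"]) (use S in \<open>auto simp: S_def\<close>)
  define q where "q = 2 * p + m"
  have card: "card S = q" using bij_betw_same_card[OF dS] bij_betw_same_card[OF bij] unfolding q_def by simp
  have qn: "q \<le> n" using card_mono[OF _ S(1)] card by simp
  define f where "f = inv_into S d \<circ> diag_entry p m a"
  have f: "bij_betw f {..<q} S" unfolding f_def q_def using bij bij_betw_inv_into[OF dS] by (rule bij_betw_trans)
  have "card {q..<n} = card ({..<n} - S)" using S card by (simp add: card_Diff_subset)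
  from finite_same_card_bij[OF _ _ this] obtain g where g: "bij_betw g {q..<n} ({..<n} - S)" by auto
  define \<sigma> where "\<sigma> i = (if i \<in> {..<q} then f i else g i)" for i
  have "bij_betw \<sigma> ({..<q} \<union> {q..<n}) (S \<union> ({..<n} - S))"
    unfolding \<sigma>_def using f g by (intro bij_betw_disjoint_Un) auto
  moreover have "{..<q} \<union> {q..<n} = {..<n}" "S \<union> ({..<n} - S) = {..<n}" using qn S by auto
  ultimately have \<sigma>: "bij_betw \<sigma> {..<n} {..<n}" by simp
  have ds: "d (\<sigma> i) = diag_entry p m a i" if "i < n" for i
  proof (cases "i < q")
    case True
    then have "diag_entry p m a i \<in> d ` S" using bij_betwE[OF bij] unfolding q_def by auto
    then show ?thesis using True unfolding \<sigma>_def f_def by (simp add: f_inv_into_f)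
  next
    case False
    then have "g i \<in> {..<n} - S" using that bij_betwE[OF g] by auto
    then show ?thesis using False unfolding \<sigma>_def S_def diag_entry_def q_def by auto
  qed
  obtain R T where RT: "inverse_mats n R T" "\<And>X. X \<in> carrier_mat n n \<Longrightarrow> T * X * R = mat n n (\<lambda>(i, j). X $$ (\<sigma> i, \<sigma> j))"
    by (rule reindex_conj[OF \<sigma>]) blast
  have "T * diagm n d * R = diag_A n p m a"
    unfolding RT(2)[OF diagm_carrier(1)] diag_A_diagm
  proof (rule eq_matI)
    fix i j assume "i < dim_row (diagm n (diag_entry p m a))" "j < dim_col (diagm n (diag_entry p m a))"
    then have ij: "i < n" "j < n" by auto
    have "\<sigma> i < n" "\<sigma> j < n" using bij_betwE[OF \<sigma>] ij by auto
    moreover have "\<sigma> i = \<sigma> j \<longleftrightarrow> i = j" using bij_betw_imp_inj_on[OF \<sigma>] ij unfolding inj_on_def by auto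
    ultimately show "mat n n (\<lambda>(i, j). diagm n d $$ (\<sigma> i, \<sigma> j)) $$ (i, j) = diagm n (diag_entry p m a) $$ (i, j)"
      using ij ds by simp
  qed auto
  then have "cj T R (cj Q P (A, B)) = (diag_A n p m a, T * (Q * B * P) * R)"
    unfolding cj_def x(4) using conj_cancel(2)[OF x(3) diagm_carrier(1)] by simp
  moreover define y where "y = (diag_A n p m a, T * (Q * B * P) * R)"
  ultimately have y: "cj T R (cj Q P x) = y" unfolding x(1) by simp
  have xM: "x \<in> M2 n" using x(1,2) Zn_M2 by blast
  have yZ: "y \<in> Zn n" unfolding y[symmetric] using x(1,2) Zn_cj inverse_mats_sym RT(1) x(3) by metis
  have "x = cj P Q (cj R T y)"
    unfolding y[symmetric] using cj_cancel[OF RT(1) cj_M2[OF inverse_mats_sym[OF x(3)] xM]] cj_cancel[OF x(3) xM] by simp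
  also have "\<dots> = cj (P * R) (T * Q) y" using cj_cj[OF x(3) RT(1)] yZ Zn_M2 by blast
  finally have "x \<in> Zcirc n p m (n - q)"
    using cj_mem_Zcirc[OF inverse_mats_mult[OF x(3) RT(1)] gp] yZ unfolding y_def by metis
  moreover have "(p, m, n - q) \<in> TP n" unfolding TP_def using qn q_def by auto
  ultimately show "x \<in> (\<Union>(p, m, r)\<in>TP n. Zcirc n p m r)" by blast
qed

lemma finite_TP: "finite (TP n)"
proof (rule finite_subset)
  show "TP n \<subseteq> {..n} \<times> {..n} \<times> {..n}" unfolding TP_def by auto
qed auto

lemma TP_nonempty: "TP n \<noteq> {}"
proof -
  have "(0, 0, n) \<in> TP n" unfolding TP_def by simp
  then show ?thesis by auto
qed

lemma Zpmr_closed: "zariski_closed n (Zpmr n p m r)"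
  unfolding Zpmr_def by (rule zariski_closed_closure[OF Zcirc_M2])

lemma Zpmr_Zn: "Zpmr n p m r \<subseteq> Zn n"
  unfolding Zpmr_def by (rule closure_minimal[OF zariski_closed_Zn Zcirc_Zn])

lemma Zn_eq_Union:
  assumes "0 < n" shows "Zn n = (\<Union>(p, m, r)\<in>TP n. Zpmr n p m r)"
proof
  have "zariski_closed n (\<Union>t\<in>TP n. (\<lambda>(p, m, r). Zpmr n p m r) t)"
    using finite_TP TP_nonempty Zpmr_closed by (intro zariski_closed_UN) auto
  moreover have "Ugen n \<subseteq> (\<Union>(p, m, r)\<in>TP n. Zpmr n p m r)"
  proof
    fix x assume "x \<in> Ugen n"
    then obtain p m r where "(p, m, r) \<in> TP n" "x \<in> Zcirc n p m r" using Ugen_subset_Zcirc[of n] by auto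
    then show "x \<in> (\<Union>(p, m, r)\<in>TP n. Zpmr n p m r)"
      using closure_subset[of "Zcirc n p m r" n] unfolding Zpmr_def by auto
  qed
  ultimately have "good n \<subseteq> (\<Union>(p, m, r)\<in>TP n. Zpmr n p m r)" by (rule closure_minimal)
  then show "Zn n \<subseteq> (\<Union>(p, m, r)\<in>TP n. Zpmr n p m r)" using Zn_subset_good[OF assms] by blast
  show "(\<Union>(p, m, r)\<in>TP n. Zpmr n p m r) \<subseteq> Zn n" using subsetD[OF Zpmr_Zn] by auto
qed

lemma Zpmr_irreducible: "(p, m, r) \<in> TP n \<Longrightarrow> zariski_irreducible n (Zpmr n p m r)"
  using Zpmr_eq_closure_SX irreducible_closure[OF SX_M2 SX_irreducible] unfolding TP_def by auto

subsection \<open>Odd moments\<close>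

text \<open>A homogeneous system with more unknowns (indexed by \<open>E\<close>) than equations
  (indexed by \<open>M\<close>), solved by Gaussian elimination. It serves both the Hankel
  determinants and the count of monomials.\<close>

lemma homogeneous_solution:
  fixes l :: "'a \<Rightarrow> 'b \<Rightarrow> complex"
  assumes "finite M" "finite E" "card M < card E"
  shows "\<exists>c. (\<exists>e\<in>E. c e \<noteq> 0) \<and> (\<forall>m\<in>M. (\<Sum>e\<in>E. c e * l e m) = 0)"
  using assms
proof (induction M arbitrary: E l rule: finite_induct)
  case empty
  then obtain e where "e \<in> E" by (metis card.empty ex_in_conv less_irrefl)
  then show ?case by (intro exI[of _ "\<lambda>_. 1"]) auto
next
  case (insert m0 M)
  show ?case
  proof (cases "\<forall>e\<in>E. l e m0 = 0")
    case True
    from insert.IH[OF insert.prems(1), of l] insert.prems insert.hyps obtain c where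
      "\<exists>e\<in>E. c e \<noteq> 0" "\<forall>m\<in>M. (\<Sum>e\<in>E. c e * l e m) = 0" by auto
    with True show ?thesis by (intro exI[of _ c]) auto
  next
    case False
    then obtain e0 where e0: "e0 \<in> E" "l e0 m0 \<noteq> 0" by auto
    define F where "F = E - {e0}"
    have F: "finite F" "e0 \<notin> F" "E = insert e0 F" using insert.prems e0 unfolding F_def by auto
    \<comment> \<open>The pivot \<open>l e0 m0\<close> eliminates the unknown \<open>e0\<close> by
      means of the equation \<open>m0\<close>.\<close>
    define l' where "l' e m = l e m - l e m0 / l e0 m0 * l e0 m" for e m
    have "card M < card F" using insert.prems insert.hyps F by simp
    from insert.IH[OF F(1) this, of l'] obtain c where c: "\<exists>e\<in>F. c e \<noteq> 0" "\<And>m. m \<in> M \<Longrightarrow> (\<Sum>e\<in>F. c e * l' e m) = 0" by blast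
    define c' where "c' e = (if e = e0 then - (\<Sum>e\<in>F. c e * (l e m0 / l e0 m0)) else c e)" for e
    have s: "(\<Sum>e\<in>E. c' e * l e m) = (\<Sum>e\<in>F. c e * l' e m)" for m
    proof -
      have "(\<Sum>e\<in>E. c' e * l e m) = c' e0 * l e0 m + (\<Sum>e\<in>F. c' e * l e m)" unfolding F(3) using F by simp
      also have "(\<Sum>e\<in>F. c' e * l e m) = (\<Sum>e\<in>F. c e * l e m)" using F(2) by (intro sum.cong) (auto simp: c'_def)
      also have "c' e0 * l e0 m = - (\<Sum>e\<in>F. c e * (l e m0 / l e0 m0 * l e0 m))"
        unfolding c'_def by (simp add: sum_distrib_right mult.assoc)
      finally show ?thesis unfolding l'_def by (simp add: right_diff_distrib sum_subtractf)
    qed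
    have "l' e m0 = 0" for e unfolding l'_def using e0 by simp
    then have "(\<Sum>e\<in>E. c' e * l e m) = 0" if "m \<in> insert m0 M" for m using s c(2) that by auto
    moreover have "\<exists>e\<in>E. c' e \<noteq> 0" using c(1) F unfolding c'_def by (metis insertCI)
    ultimately show ?thesis by blast
  qed
qed

text \<open>For moments built from nodes s_l = w_l^2 with weights w_l, the matrix is V^T diag(w) V
  with V the Vandermonde matrix of the nodes. For distinct nodes and nonzero weights its determinant
  can thus detect whether at least \<open>m\<close> nodes occur.\<close>

definition hankel :: "nat \<Rightarrow> (nat \<Rightarrow> complex) \<Rightarrow> complex" where
  "hankel m \<mu> = det (mat m m (\<lambda>(i, j). \<mu> (i + j)))"

lemma hankel_zero_iff:
  "hankel m \<mu> = 0 \<longleftrightarrow> (\<exists>c. (\<exists>j<m. c j \<noteq> 0) \<and> (\<forall>i<m. (\<Sum>j<m. c j * \<mu> (i + j)) = 0))"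
proof -
  let ?H = "mat m m (\<lambda>(i, j). \<mu> (i + j))"
  have e: "(?H *\<^sub>v v) $ i = (\<Sum>j<m. v $ j * \<mu> (i + j))" if "v \<in> carrier_vec m" "i < m" for v i
    using that by (auto simp: scalar_prod_def lessThan_atLeast0 mult.commute intro!: sum.cong)
  have "hankel m \<mu> = 0 \<longleftrightarrow> (\<exists>v. v \<in> carrier_vec m \<and> v \<noteq> 0\<^sub>v m \<and> ?H *\<^sub>v v = 0\<^sub>v m)"
    unfolding hankel_def by (rule det_0_iff_vec_prod_zero) auto
  also have "\<dots> \<longleftrightarrow> (\<exists>c. (\<exists>j<m. c j \<noteq> 0) \<and> (\<forall>i<m. (\<Sum>j<m. c j * \<mu> (i + j)) = 0))"
  proof
    assume "\<exists>v. v \<in> carrier_vec m \<and> v \<noteq> 0\<^sub>v m \<and> ?H *\<^sub>v v = 0\<^sub>v m"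
    then obtain v where v: "v \<in> carrier_vec m" "v \<noteq> 0\<^sub>v m" "?H *\<^sub>v v = 0\<^sub>v m" by blast
    have "\<exists>j<m. v $ j \<noteq> 0"
    proof (rule ccontr)
      assume "\<not> ?thesis" then have "v = 0\<^sub>v m" using v(1) by (intro eq_vecI) auto
      with v(2) show False by simp
    qed
    moreover have "(\<Sum>j<m. v $ j * \<mu> (i + j)) = 0" if "i < m" for i
      unfolding e[OF v(1) that, symmetric] v(3) using that by simp
    ultimately show "\<exists>c. (\<exists>j<m. c j \<noteq> 0) \<and> (\<forall>i<m. (\<Sum>j<m. c j * \<mu> (i + j)) = 0)" by blast
  next
    assume "\<exists>c. (\<exists>j<m. c j \<noteq> 0) \<and> (\<forall>i<m. (\<Sum>j<m. c j * \<mu> (i + j)) = 0)"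
    then obtain c where c: "\<exists>j<m. c j \<noteq> 0" "\<And>i. i < m \<Longrightarrow> (\<Sum>j<m. c j * \<mu> (i + j)) = 0" by blast
    have v: "vec m c \<in> carrier_vec m" by simp
    have "?H *\<^sub>v vec m c = 0\<^sub>v m"
    proof (rule eq_vecI)
      fix i assume "i < dim_vec (0\<^sub>v m :: complex vec)"
      then have i: "i < m" by simp
      have "(\<Sum>j<m. vec m c $ j * \<mu> (i + j)) = (\<Sum>j<m. c j * \<mu> (i + j))" by (intro sum.cong) auto
      then show "(?H *\<^sub>v vec m c) $ i = 0\<^sub>v m $ i" unfolding e[OF v i] using c(2)[OF i] i by simp
    qed auto
    moreover have "vec m c \<noteq> 0\<^sub>v m" using c(1) by (metis index_vec index_zero_vec(1))
    ultimately show "\<exists>v. v \<in> carrier_vec m \<and> v \<noteq> 0\<^sub>v m \<and> ?H *\<^sub>v v = 0\<^sub>v m" using v by blast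
  qed
  finally show ?thesis .
qed

lemma moment_sum:
  fixes w :: "'a \<Rightarrow> complex"
  shows "(\<Sum>j<m. c j * (\<Sum>l\<in>I. w l * (w l * w l) ^ (i + j))) = (\<Sum>l\<in>I. w l * (\<Sum>j<m. c j * (w l * w l) ^ j) * (w l * w l) ^ i)"
proof -
  have "(\<Sum>j<m. c j * (\<Sum>l\<in>I. w l * (w l * w l) ^ (i + j))) = (\<Sum>j<m. \<Sum>l\<in>I. c j * (w l * (w l * w l) ^ (i + j)))"
    by (simp add: sum_distrib_left)
  also have "\<dots> = (\<Sum>l\<in>I. \<Sum>j<m. c j * (w l * (w l * w l) ^ (i + j)))" by (rule sum.swap)
  also have "\<dots> = (\<Sum>l\<in>I. w l * (\<Sum>j<m. c j * (w l * w l) ^ j) * (w l * w l) ^ i)"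
    by (intro sum.cong refl) (simp add: sum_distrib_left sum_distrib_right power_add mult_ac)
  finally show ?thesis .
qed

text \<open>A kernel vector of the Hankel matrix is the coefficient vector of a polynomial of degree less than \<open>m\<close>;
  here such a polynomial vanishing at all \<open>w\<^sup>2\<close> exists, in the next lemma it cannot.\<close>

lemma hankel_moments_zero:
  fixes w :: "'a \<Rightarrow> complex"
  assumes "finite I" "card I < m"
  shows "hankel m (\<lambda>k. \<Sum>l\<in>I. w l * (w l * w l) ^ k) = 0"
proof -
  from homogeneous_solution[of I "{..<m}" "\<lambda>j l. (w l * w l) ^ j"] assms obtain c where
    c: "\<exists>j<m. c j \<noteq> 0" "\<And>l. l \<in> I \<Longrightarrow> (\<Sum>j<m. c j * (w l * w l) ^ j) = 0" by auto
  have "(\<Sum>j<m. c j * (\<Sum>l\<in>I. w l * (w l * w l) ^ (i + j))) = 0" for i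
    unfolding moment_sum using c(2) by (intro sum.neutral) auto
  then show ?thesis unfolding hankel_zero_iff using c(1) by blast
qed

lemma hankel_moments_nonzero:
  fixes w :: "'a \<Rightarrow> complex"
  assumes fin: "finite I" "card I = m" and w: "\<And>l. l \<in> I \<Longrightarrow> w l \<noteq> 0" "inj_on (\<lambda>l. w l * w l) I"
  shows "hankel m (\<lambda>k. \<Sum>l\<in>I. w l * (w l * w l) ^ k) \<noteq> 0"
proof
  assume "hankel m (\<lambda>k. \<Sum>l\<in>I. w l * (w l * w l) ^ k) = 0"
  then obtain c where c: "\<exists>j<m. c j \<noteq> 0" "\<And>i. i < m \<Longrightarrow> (\<Sum>j<m. c j * (\<Sum>l\<in>I. w l * (w l * w l) ^ (i + j))) = 0"
    unfolding hankel_zero_iff by blast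
  define s where "s l = w l * w l" for l
  define q where "q = (\<Sum>j<m. monom (c j) j)"
  have q: "poly q x = (\<Sum>j<m. c j * x ^ j)" for x unfolding q_def poly_sum poly_monom ..
  define u where "u l = w l * poly q (s l)" for l
  have m0: "m > 0" using c(1) by auto
  have u: "(\<Sum>l\<in>I. u l * s l ^ i) = 0" if "i < m" for i
    using c(2)[OF that] unfolding moment_sum u_def q s_def .
  have up: "(\<Sum>l\<in>I. u l * poly P (s l)) = 0" if "degree P < m" for P
  proof -
    have "(\<Sum>l\<in>I. u l * poly P (s l)) = (\<Sum>l\<in>I. \<Sum>i\<le>degree P. coeff P i * (u l * s l ^ i))"
      unfolding poly_altdef sum_distrib_left by (simp add: mult_ac)
    also have "\<dots> = (\<Sum>i\<le>degree P. coeff P i * (\<Sum>l\<in>I. u l * s l ^ i))"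
      by (subst sum.swap) (simp add: sum_distrib_left)
    also have "\<dots> = 0" using u that by (intro sum.neutral) auto
    finally show ?thesis .
  qed
  have root: "poly q (s k) = 0" if k: "k \<in> I" for k
  proof -
    \<comment> \<open>The unnormalized Lagrange polynomial, vanishing at every node except
      \<open>s k\<close>. Its degree is below \<open>m\<close>, so \<open>up\<close> isolates the
      single term at \<open>k\<close>.\<close>
    define P where "P = (\<Prod>l\<in>I - {k}. [:- s l, 1:])"
    have "degree P \<le> (\<Sum>l\<in>I - {k}. 1)" unfolding P_def
      using degree_prod_sum_le[of "I - {k}" "\<lambda>l. [:- s l, 1:]"] fin by simp
    then have "degree P < m" using fin k m0 by (simp add: card_Diff_singleton)
    from up[OF this] have "0 = u k * poly P (s k) + (\<Sum>l\<in>I - {k}. u l * poly P (s l))"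
      using fin k by (simp add: sum.remove)
    also have "(\<Sum>l\<in>I - {k}. u l * poly P (s l)) = 0"
      unfolding P_def using fin by (intro sum.neutral) (auto simp: poly_prod)
    finally have "u k * poly P (s k) = 0" by simp
    moreover have "poly P (s k) \<noteq> 0" unfolding P_def poly_prod using fin w(2) k
      by (auto simp: s_def inj_on_def)
    ultimately show ?thesis unfolding u_def using w(1)[OF k] by simp
  qed
  \<comment> \<open>The \<open>m\<close> distinct nodes are roots of a polynomial of degree at most
    \<open>m - 1\<close>.\<close>
  have "q = 0"
  proof (rule ccontr)
    assume "q \<noteq> 0"
    have "degree q \<le> m - 1" unfolding q_def by (intro degree_sum_le) (auto intro: order_trans[OF degree_monom_le])
    moreover have "card (s ` I) = m" using card_image[of s I] w(2) fin unfolding s_def by simp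
    moreover have "s ` I \<subseteq> {x. poly q x = 0}" using root by auto
    ultimately show False using card_mono[OF poly_roots_finite[OF \<open>q \<noteq> 0\<close>], of "s ` I"] card_poly_roots_bound[OF \<open>q \<noteq> 0\<close>] m0 by linarith
  qed
  moreover have "coeff q j = c j" if "j < m" for j unfolding q_def coeff_sum using that by (simp add: coeff_monom)
  ultimately show False using c(1) by auto
qed

text \<open>The odd power X^(2k+1), built from X^2 because the square is diagonal in both
  applications.\<close>

fun opow :: "complex mat \<Rightarrow> nat \<Rightarrow> complex mat" where
  "opow X 0 = X"
| "opow X (Suc k) = opow X k * (X * X)"

lemma opow_carrier: "X \<in> carrier_mat n n \<Longrightarrow> opow X k \<in> carrier_mat n n"
  by (induction k) auto

lemma opow_conj:
  assumes "inverse_mats n P Q" "X \<in> carrier_mat n n"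
  shows "opow (P * X * Q) k = P * opow X k * Q"
proof (induction k)
  case (Suc k)
  have "opow (P * X * Q) (Suc k) = (P * opow X k * Q) * (P * (X * X) * Q)" unfolding opow.simps Suc conj_mult[OF assms assms(2)] ..
  also have "\<dots> = P * opow X (Suc k) * Q"
    using assms(2) opow_carrier[OF assms(2)] unfolding opow.simps by (intro conj_mult[OF assms(1)]) auto
  finally show ?case .
qed simp

lemma opow_diagonal_square:
  assumes "X \<in> carrier_mat n n" "X * X = diagm n c" "i < n" "j < n"
  shows "opow X k $$ (i, j) = X $$ (i, j) * c j ^ k"
proof (induction k)
  case (Suc k)
  show ?case unfolding opow.simps assms(2) diagm_mult_entry(2)[OF opow_carrier[OF assms(1)] assms(3,4)] Suc by simp
qed simp

lemma mtr_opow_diagonal_square: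
  assumes "X \<in> carrier_mat n n" "X * X = diagm n c"
  shows "mtr (opow X k) = (\<Sum>i<n. X $$ (i, i) * c i ^ k)"
  using opow_carrier[OF assms(1), of k] unfolding mtr_def by (auto simp: opow_diagonal_square[OF assms] intro!: sum.cong)

lemma sum_partner_cancel:
  fixes f :: "nat \<Rightarrow> complex"
  assumes "\<And>i. i < 2 * p \<Longrightarrow> f (partner i) = - f i" shows "(\<Sum>i<2 * p. f i) = 0"
proof -
  have "bij_betw partner {..<2 * p} {..<2 * p}"
    by (rule bij_betw_byWitness[where f' = partner]) (auto simp: partner_partner partner_less)
  then have "(\<Sum>i<2 * p. f i) = (\<Sum>i<2 * p. f (partner i))" using sum.reindex_bij_betw by metis
  also have "\<dots> = - (\<Sum>i<2 * p. f i)" using assms by (simp add: sum_negf)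
  finally show ?thesis by simp
qed

text \<open>Partners contribute opposite odd powers and cancel, and the kernel contributes zero.
  Only the \<open>m\<close> unpaired eigenvalues remain.\<close>

lemma mtr_diag_A:
  assumes "2 * p + m \<le> n"
  shows "mtr (opow (diag_A n p m a) k) = (\<Sum>l\<in>{p..<p+m}. a l * (a l * a l) ^ k)"
proof -
  let ?d = "diag_entry p m a"
  have "diag_A n p m a * diag_A n p m a = diagm n (\<lambda>i. ?d i * ?d i)"
    unfolding diag_A_diagm by (rule eq_matI) (auto simp: diagm_mult_entry[of _ n] simp del: index_mult_mat(1))
  moreover have "diag_A n p m a \<in> carrier_mat n n" unfolding diag_A_def by auto
  ultimately have "mtr (opow (diag_A n p m a) k) = (\<Sum>i<n. diag_A n p m a $$ (i, i) * (?d i * ?d i) ^ k)"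
    using mtr_opow_diagonal_square by blast
  also have "\<dots> = (\<Sum>i<n. ?d i * (?d i * ?d i) ^ k)" by (intro sum.cong) (auto simp: diag_A_def)
  also have "{..<n} = {..<2 * p} \<union> {2 * p..<2 * p + m} \<union> {2 * p + m..<n}" using assms by auto
  also have "(\<Sum>i\<in>{..<2 * p} \<union> {2 * p..<2 * p + m} \<union> {2 * p + m..<n}. ?d i * (?d i * ?d i) ^ k) =
     (\<Sum>i<2 * p. ?d i * (?d i * ?d i) ^ k) + (\<Sum>i\<in>{2 * p..<2 * p + m}. ?d i * (?d i * ?d i) ^ k) + (\<Sum>i\<in>{2 * p + m..<n}. ?d i * (?d i * ?d i) ^ k)"
    by (subst sum.union_disjoint, force, force, force, subst sum.union_disjoint) auto
  also have "(\<Sum>i<2 * p. ?d i * (?d i * ?d i) ^ k) = 0"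
    by (rule sum_partner_cancel) (simp add: diag_entry_partner)
  also have "(\<Sum>i\<in>{2 * p + m..<n}. ?d i * (?d i * ?d i) ^ k) = 0" by (intro sum.neutral) (auto simp: diag_entry_def)
  also have "(\<Sum>i\<in>{2 * p..<2 * p + m}. ?d i * (?d i * ?d i) ^ k) = (\<Sum>l\<in>{p..<p+m}. a l * (a l * a l) ^ k)"
    by (rule sum.reindex_bij_witness[of _ "\<lambda>l. l + p" "\<lambda>i. i - p"]) (auto simp: diag_entry_def)
  finally show ?thesis by simp
qed

text \<open>A block with rows (0, z) and (z', 0) squares to the scalar z z'. The test
  \<open>partner i < n\<close> covers a block cut off at \<open>n\<close>, since no relation between
  \<open>p\<close> and \<open>n\<close> is assumed.\<close>

lemma Bst_square:
  "Bst n p m z * Bst n p m z = diagm n (\<lambda>i. if i < 2 * p then if partner i < n then z i * z (partner i) else 0 else if 2 * p + m \<le> i then z i * z i else 0)"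
  (is "_ = diagm n ?c")
proof (rule eq_matI)
  fix i j assume "i < dim_row (diagm n ?c)" "j < dim_col (diagm n ?c)"
  then have ij: "i < n" "j < n" by auto
  have "(Bst n p m z * Bst n p m z) $$ (i, j) = (\<Sum>l<n. Bst n p m z $$ (i, l) * Bst n p m z $$ (l, j))"
    using ij by (intro mat_mult_entry) auto
  also have "\<dots> = (\<Sum>l<n. if l = (if i < 2 * p then partner i else i) then
      (if i < 2 * p then z i else if 2 * p + m \<le> i then z i else 0) * Bst n p m z $$ (l, j) else 0)"
    using ij by (intro sum.cong) (auto simp: Bst_def)
  also have "\<dots> = diagm n ?c $$ (i, j)"
    using ij partner_less[of i p] by (auto simp: Bst_def partner_partner)
  finally show "(Bst n p m z * Bst n p m z) $$ (i, j) = diagm n ?c $$ (i, j)" .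
qed auto

text \<open>Odd powers of the antidiagonal blocks have zero diagonal, so the trace sees only the
  entries on the kernel of the first matrix.\<close>

lemma mtr_Bst:
  assumes "2 * p + m \<le> n"
  shows "mtr (opow (Bst n p m z) k) = (\<Sum>l\<in>{2 * p + m..<n}. z l * (z l * z l) ^ k)"
proof -
  let ?c = "\<lambda>i. if i < 2 * p then if partner i < n then z i * z (partner i) else 0 else if 2 * p + m \<le> i then z i * z i else 0"
  have "mtr (opow (Bst n p m z) k) = (\<Sum>i<n. Bst n p m z $$ (i, i) * ?c i ^ k)"
    by (rule mtr_opow_diagonal_square[OF Bst_carrier(1) Bst_square])
  also have "\<dots> = (\<Sum>i<n. if i \<in> {2 * p + m..<n} then z i * (z i * z i) ^ k else 0)"
    using partner_neq partner_neq[symmetric] by (intro sum.cong) (auto simp: Bst_def)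
  also have "\<dots> = (\<Sum>l\<in>{2 * p + m..<n}. z l * (z l * z l) ^ k)"
    by (subst sum.inter_restrict[symmetric]) (auto intro!: sum.cong)
  finally show ?thesis .
qed

lemma poly_mat_opow: "poly_mat n F \<Longrightarrow> poly_mat n (\<lambda>x. opow (F x) k)"
  by (induction k) (auto intro: poly_mat_mult)

lemma poly_fun_hankel:
  assumes "poly_mat n F"
  obtains f where "f \<in> poly_fun n" "\<And>x. x \<in> M2 n \<Longrightarrow> hankel m (\<lambda>k. mtr (opow (F x) k)) = f x"
proof -
  have "\<exists>f\<in>poly_fun n. \<forall>x\<in>M2 n. mtr (opow (F x) k) = f x" for k
  proof -
    have P: "poly_mat n (\<lambda>x. opow (F x) k)" using assms by (rule poly_mat_opow)
    have "\<forall>i. \<exists>f. i < n \<longrightarrow> f \<in> poly_fun n \<and> (\<forall>x\<in>M2 n. opow (F x) k $$ (i, i) = f x)"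
      using P unfolding poly_mat_def by meson
    from choice[OF this] obtain f where
      f: "\<And>i. i < n \<Longrightarrow> f i \<in> poly_fun n" "\<And>i x. i < n \<Longrightarrow> x \<in> M2 n \<Longrightarrow> opow (F x) k $$ (i, i) = f i x" by auto
    have "mtr (opow (F x) k) = (\<Sum>i<n. f i x)" if "x \<in> M2 n" for x
    proof -
      have "opow (F x) k \<in> carrier_mat n n" using P that unfolding poly_mat_def by blast
      then show ?thesis unfolding mtr_def using f(2) that by auto
    qed
    moreover have "(\<lambda>x. \<Sum>i<n. f i x) \<in> poly_fun n" using f(1) by (intro poly_fun_sum) auto
    ultimately show ?thesis by (intro bexI[of _ "\<lambda>x. \<Sum>i<n. f i x"]) auto
  qed
  then obtain \<mu> where \<mu>: "\<And>k. \<mu> k \<in> poly_fun n" "\<And>k x. x \<in> M2 n \<Longrightarrow> mtr (opow (F x) k) = \<mu> k x" by metis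
  show ?thesis
  proof (rule that)
    show "(\<lambda>x. det (mat m m (\<lambda>(i, j). \<mu> (i + j) x))) \<in> poly_fun n" by (intro poly_mat_fun_det \<mu>)
    show "hankel m (\<lambda>k. mtr (opow (F x) k)) = det (mat m m (\<lambda>(i, j). \<mu> (i + j) x))" if "x \<in> M2 n" for x
      unfolding hankel_def using \<mu>(2)[OF that] by simp
  qed
qed

lemma base_point_SX: "std n p m (base p) \<in> SX n p m X"
proof -
  have g: "gmat n (base p) = 1\<^sub>m n" unfolding gmat_def base_def by (intro eq_matI) auto
  have "std n p m (base p) \<in> M2 n" unfolding std_def using std_Zn Zn_M2 by blast
  then have "std n p m (base p) = cj (gmat n (base p)) (1\<^sub>m n) (std n p m (base p))"
    unfolding g cj_def M2_def by (cases "std n p m (base p)") auto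
  then show ?thesis unfolding SX_def using inverse_mats_one[of n] g
    by (intro CollectI exI[of _ "base p"] exI[of _ "1\<^sub>m n"]) simp
qed

lemma of_nat_square_inj: "inj_on (\<lambda>l. of_nat (l + 1) * of_nat (l + 1) :: complex) I"
proof (rule inj_onI)
  fix x y assume "(of_nat (x + 1) * of_nat (x + 1) :: complex) = of_nat (y + 1) * of_nat (y + 1)"
  then have "(x + 1)\<^sup>2 = (y + 1)\<^sup>2" unfolding of_nat_mult[symmetric] of_nat_eq_iff power2_eq_square .
  then show "x = y" using power_eq_iff_eq_base[of 2 "x + 1" "y + 1"] by simp
qed

text \<open>The base point has \<open>m\<close> unpaired eigenvalues with distinct nonzero squares,
  so its \<open>m\<close>-th Hankel determinant is nonzero. With fewer unpaired eigenvalues,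
  \<open>m' < m\<close>, that determinant vanishes on the whole family and hence on its closure. The
  second matrix treats \<open>r\<close> in the same way.\<close>

lemma Zpmr_subset_imp:
  assumes t: "2 * p + m + r = n" "2 * p' + m' + r' = n" and sub: "Zpmr n p m r \<subseteq> Zpmr n p' m' r'"
  shows "m \<le> m'" "r \<le> r'"
proof -
  have mem: "std n p m (base p) \<in> zariski_closure n (SX n p' m' UNIV)"
    using base_point_SX[of n p m UNIV] closure_subset sub unfolding Zpmr_eq_closure_SX[OF t(1)] Zpmr_eq_closure_SX[OF t(2)] by blast
  have M: "std n p m (base p) \<in> M2 n" unfolding std_def using std_Zn Zn_M2 by blast
  show "m \<le> m'"
  proof (rule ccontr)
    assume "\<not> m \<le> m'"
    obtain f where f: "f \<in> poly_fun n" "\<And>x. x \<in> M2 n \<Longrightarrow> hankel m (\<lambda>k. mtr (opow (fst x) k)) = f x"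
      by (rule poly_fun_hankel[OF poly_mat_fst]) blast
    have "f y = 0" if "y \<in> SX n p' m' UNIV" for y
    proof -
      obtain \<theta> h where y: "y = cj (gmat n \<theta>) h (std n p' m' \<theta>)" "inverse_mats n (gmat n \<theta>) h" using \<open>y \<in> _\<close> unfolding SX_def by auto
      have c: "diag_A n p' m' (\<lambda>i. \<theta> (CA i)) \<in> carrier_mat n n" unfolding diag_A_def by auto
      have "f y = hankel m (\<lambda>k. \<Sum>l\<in>{p'..<p'+m'}. \<theta> (CA l) * (\<theta> (CA l) * \<theta> (CA l)) ^ k)"
        unfolding f(2)[OF subsetD[OF SX_M2 that], symmetric] unfolding y(1) cj_def std_def fst_conv opow_conj[OF y(2) c]
          mtr_conj[OF y(2) opow_carrier[OF c]] using t by (simp add: mtr_diag_A)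
      then show ?thesis using \<open>\<not> m \<le> m'\<close> by (simp add: hankel_moments_zero)
    qed
    then have "f (std n p m (base p)) = 0" using zero_on_closure[OF SX_M2 f(1) _ mem] by blast
    moreover have "f (std n p m (base p)) = hankel m (\<lambda>k. \<Sum>l\<in>{p..<p+m}. base p (CA l) * (base p (CA l) * base p (CA l)) ^ k)"
      unfolding f(2)[OF M, symmetric] unfolding std_def fst_conv using t by (simp add: mtr_diag_A)
    moreover have "\<dots> \<noteq> 0"
      by (rule hankel_moments_nonzero) (use of_nat_square_inj in \<open>auto simp: base_def simp del: of_nat_Suc of_nat_add\<close>)
    ultimately show False by simp
  qed
  show "r \<le> r'"
  proof (rule ccontr)
    assume "\<not> r \<le> r'"
    obtain f where f: "f \<in> poly_fun n" "\<And>x. x \<in> M2 n \<Longrightarrow> hankel r (\<lambda>k. mtr (opow (snd x) k)) = f x"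
      by (rule poly_fun_hankel[OF poly_mat_snd]) blast
    have "f y = 0" if "y \<in> SX n p' m' UNIV" for y
    proof -
      obtain \<theta> h where y: "y = cj (gmat n \<theta>) h (std n p' m' \<theta>)" "inverse_mats n (gmat n \<theta>) h" using \<open>y \<in> _\<close> unfolding SX_def by auto
      have "f y = hankel r (\<lambda>k. \<Sum>l\<in>{2 * p' + m'..<n}. \<theta> (CZ l) * (\<theta> (CZ l) * \<theta> (CZ l)) ^ k)"
        unfolding f(2)[OF subsetD[OF SX_M2 that], symmetric] unfolding y(1) cj_def std_def snd_conv opow_conj[OF y(2) Bst_carrier(1)]
          mtr_conj[OF y(2) opow_carrier[OF Bst_carrier(1)]] using t by (simp add: mtr_Bst)
      then show ?thesis using \<open>\<not> r \<le> r'\<close> t by (auto intro!: hankel_moments_zero)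
    qed
    then have "f (std n p m (base p)) = 0" using zero_on_closure[OF SX_M2 f(1) _ mem] by blast
    moreover have "f (std n p m (base p)) = hankel r (\<lambda>k. \<Sum>l\<in>{2 * p + m..<n}. base p (CZ l) * (base p (CZ l) * base p (CZ l)) ^ k)"
      unfolding f(2)[OF M, symmetric] unfolding std_def snd_conv using t by (simp add: mtr_Bst)
    moreover have "\<dots> \<noteq> 0"
    proof (rule hankel_moments_nonzero)
      show "inj_on (\<lambda>l. base p (CZ l) * base p (CZ l)) {2 * p + m..<n}"
        using of_nat_square_inj[of "{2 * p + m..<n}"] by (auto simp: base_def inj_on_def simp del: of_nat_Suc of_nat_add)
    qed (use t in \<open>auto simp: base_def simp del: of_nat_Suc of_nat_add\<close>)
    ultimately show False by simp
  qed
qed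

subsection \<open>Upper bound for the dimension\<close>

text \<open>A relation bounding the degree from above, closed under raising the bound: functions
  need no chosen polynomial representation, and sums can be brought to a common bound.\<close>

inductive pdeg :: "nat \<Rightarrow> nat \<Rightarrow> (complex mat \<times> complex mat \<Rightarrow> complex) \<Rightarrow> bool" for n where
  pd_const: "pdeg n 0 (\<lambda>x. c)"
| pd_coordA: "i < n \<Longrightarrow> j < n \<Longrightarrow> pdeg n 1 (\<lambda>x. fst x $$ (i, j))"
| pd_coordB: "i < n \<Longrightarrow> j < n \<Longrightarrow> pdeg n 1 (\<lambda>x. snd x $$ (i, j))"
| pd_add: "pdeg n d f \<Longrightarrow> pdeg n d g \<Longrightarrow> pdeg n d (\<lambda>x. f x + g x)"
| pd_mult: "pdeg n d f \<Longrightarrow> pdeg n e g \<Longrightarrow> pdeg n (d + e) (\<lambda>x. f x * g x)"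
| pd_mono: "pdeg n d f \<Longrightarrow> d \<le> e \<Longrightarrow> pdeg n e f"

lemma pdeg_poly_fun: "pdeg n d f \<Longrightarrow> f \<in> poly_fun n"
  by (induction rule: pdeg.induct) (auto intro: poly_fun.intros)

lemma poly_fun_pdeg: "f \<in> poly_fun n \<Longrightarrow> \<exists>d. pdeg n d f"
proof (induction rule: poly_fun.induct)
  case (pf_add f g)
  then obtain d e where "pdeg n d f" "pdeg n e g" by auto
  then have "pdeg n (max d e) f" "pdeg n (max d e) g" by (auto intro: pd_mono)
  then show ?case by (blast intro: pd_add)
qed (blast intro: pdeg.intros)+

lemma pdeg_power: "pdeg n d f \<Longrightarrow> pdeg n (k * d) (\<lambda>x. f x ^ k)"
proof (induction k)
  case 0 show ?case using pd_const[of n 1] by simp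
next
  case (Suc k) then show ?case using pd_mult[of n d f "k * d" "\<lambda>x. f x ^ k"] by simp
qed

lemma sum_mod_blocks:
  fixes f :: "nat \<Rightarrow> 'a :: comm_monoid_add"
  shows "(\<Sum>i<Q * M. f i) = (\<Sum>q<Q. \<Sum>j<M. f (q * M + j))"
proof -
  have "(\<Sum>i<Q * M. f i) = (\<Sum>q<Q. sum f {q * M..<q * M + M})" by (rule sum.nat_group[symmetric])
  also have "\<dots> = (\<Sum>q<Q. \<Sum>j<M. f (q * M + j))"
  proof (rule sum.cong[OF refl])
    fix q show "sum f {q * M..<q * M + M} = (\<Sum>j<M. f (q * M + j))"
      by (rule sum.reindex_bij_witness[of _ "\<lambda>j. q * M + j" "\<lambda>i. i - q * M"]) auto
  qed
  finally show ?thesis .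
qed

definition indep_on :: "(complex mat \<times> complex mat) set \<Rightarrow> nat \<Rightarrow> (nat \<Rightarrow> complex mat \<times> complex mat \<Rightarrow> complex) \<Rightarrow> bool" where
  "indep_on Y T F \<longleftrightarrow> (\<forall>c. (\<forall>x\<in>Y. (\<Sum>i<T. c i * F i x) = 0) \<longrightarrow> (\<forall>i<T. c i = 0))"

lemma irreducible_mult_zero:
  assumes "Y \<subseteq> M2 n" "zariski_irreducible n Y" "f \<in> poly_fun n" "g \<in> poly_fun n" "\<And>x. x \<in> Y \<Longrightarrow> f x * g x = 0"
  shows "(\<forall>x\<in>Y. f x = 0) \<or> (\<forall>x\<in>Y. g x = 0)"
  using assms(2-5) unfolding irreducible_iff_no_zero_divisors[OF assms(1)] by simp

text \<open>In a linear relation, take the lowest power of \<open>g\<close> that occurs.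
  Irreducibility of \<open>Y'\<close> allows cancelling it, and restriction to \<open>Y\<close>,
  where \<open>g\<close> vanishes, leaves a relation among the \<open>F\<close> alone. The index
  \<open>i\<close> encodes the pair of quotient and remainder by \<open>Suc N\<close>.\<close>

lemma indep_on_step:
  assumes Y: "Y \<subseteq> Y'" "Y' \<subseteq> M2 n" and irr: "zariski_irreducible n Y'"
    and g: "g \<in> poly_fun n" "\<And>x. x \<in> Y \<Longrightarrow> g x = 0" "y \<in> Y'" "g y \<noteq> 0"
    and F: "\<And>i. i < Q \<Longrightarrow> F i \<in> poly_fun n" "indep_on Y Q F"
  shows "indep_on Y' (Q * Suc N) (\<lambda>i x. F (i div Suc N) x * g x ^ (i mod Suc N))"
  unfolding indep_on_def
proof (rule allI, rule impI)
  fix c assume c: "\<forall>x\<in>Y'. (\<Sum>i<Q * Suc N. c i * (F (i div Suc N) x * g x ^ (i mod Suc N))) = 0"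
  define C where "C q j = c (q * Suc N + j)" for q j
  have c': "(\<Sum>q<Q. \<Sum>j<Suc N. C q j * (F q x * g x ^ j)) = 0" if "x \<in> Y'" for x
  proof -
    have "(\<Sum>i<Q * Suc N. c i * (F (i div Suc N) x * g x ^ (i mod Suc N))) =
       (\<Sum>q<Q. \<Sum>j<Suc N. c (q * Suc N + j) * (F ((q * Suc N + j) div Suc N) x * g x ^ ((q * Suc N + j) mod Suc N)))"
      by (rule sum_mod_blocks)
    also have "\<dots> = (\<Sum>q<Q. \<Sum>j<Suc N. C q j * (F q x * g x ^ j))"
    proof (intro sum.cong refl)
      fix q j assume "j \<in> {..<Suc N}"
      moreover have "(q * M + j) div M = q" "(q * M + j) mod M = j" if "j < M" for M using that by simp_all
      ultimately have "(q * Suc N + j) div Suc N = q" "(q * Suc N + j) mod Suc N = j" by blast+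
      then show "c (q * Suc N + j) * (F ((q * Suc N + j) div Suc N) x * g x ^ ((q * Suc N + j) mod Suc N)) = C q j * (F q x * g x ^ j)"
        unfolding C_def by presburger
    qed
    finally show ?thesis using c that by simp
  qed
  have main: "\<forall>q<Q. \<forall>j<j0. C q j = 0" if "j0 \<le> Suc N" for j0
    using that
  proof (induction j0)
    case (Suc j0)
    then have IH: "C q j = 0" if "q < Q" "j < j0" for q j using that by auto
    define R where "R x = (\<Sum>q<Q. \<Sum>j\<in>{j0..<Suc N}. C q j * (F q x * g x ^ (j - j0)))" for x
    have gR: "g x ^ j0 * R x = 0" if x: "x \<in> Y'" for x
    proof -
      have "g x ^ j0 * R x = (\<Sum>q<Q. \<Sum>j\<in>{j0..<Suc N}. C q j * (F q x * (g x ^ j0 * g x ^ (j - j0))))"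
        unfolding R_def sum_distrib_left by (intro sum.cong refl) (simp only: mult_ac)
      also have "\<dots> = (\<Sum>q<Q. \<Sum>j\<in>{j0..<Suc N}. C q j * (F q x * g x ^ j))"
        by (intro sum.cong refl) (simp add: power_add[symmetric])
      also have "\<dots> = (\<Sum>q<Q. \<Sum>j<Suc N. C q j * (F q x * g x ^ j))"
      proof (rule sum.cong[OF refl], rule sum.mono_neutral_left)
        fix q assume q: "q \<in> {..<Q}"
        show "\<forall>j\<in>{..<Suc N} - {j0..<Suc N}. C q j * (F q x * g x ^ j) = 0"
        proof
          fix j assume "j \<in> {..<Suc N} - {j0..<Suc N}"
          then have "q < Q" "j < j0" using q by auto
          then show "C q j * (F q x * g x ^ j) = 0" using IH[of q j] by simp
        qed
      qed auto
      finally show ?thesis using c'[OF x] by simp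
    qed
    have Rp: "R \<in> poly_fun n" unfolding R_def[abs_def]
      using F(1) pdeg_poly_fun[OF pdeg_power] poly_fun_pdeg[OF g(1)]
      by (intro poly_fun_sum pf_mult pf_const) (auto)
    have "(\<lambda>x. g x ^ j0) \<in> poly_fun n" using poly_fun_pdeg[OF g(1)] pdeg_poly_fun[OF pdeg_power] by auto
    from irreducible_mult_zero[OF Y(2) irr this Rp gR]
    have "(\<forall>x\<in>Y'. g x ^ j0 = 0) \<or> (\<forall>x\<in>Y'. R x = 0)" .
    then have R0: "R x = 0" if "x \<in> Y'" for x using that g(3,4) by auto
    \<comment> \<open>Where \<open>g\<close> vanishes, only the summand \<open>j = j0\<close> of
      \<open>R\<close> survives, with the power 0^0 = 1.\<close>
    have "(\<Sum>q<Q. C q j0 * F q x) = 0" if x: "x \<in> Y" for x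
    proof -
      have gx: "g x = 0" using g(2)[OF x] .
      have "R x = (\<Sum>q<Q. \<Sum>j\<in>{j0..<Suc N}. if j = j0 then C q j0 * F q x else 0)"
        unfolding R_def gx by (intro sum.cong refl) auto
      also have "\<dots> = (\<Sum>q<Q. C q j0 * F q x)"
        using Suc.prems by (intro sum.cong refl, subst sum.delta) auto
      finally show ?thesis using R0[OF subsetD[OF Y(1) x]] by simp
    qed
    then have "\<forall>q<Q. C q j0 = 0" using F(2) unfolding indep_on_def by (auto dest: spec[of _ "\<lambda>q. C q j0"])
    then show ?case using IH by (auto simp: less_Suc_eq)
  qed simp
  show "\<forall>i<Q * Suc N. c i = 0"
  proof (intro allI impI)
    fix i assume "i < Q * Suc N"
    then have "i div Suc N < Q" by (simp add: less_mult_imp_div_less)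
    then have "C (i div Suc N) (i mod Suc N) = 0" using main[of "Suc N"] by simp
    then show "c i = 0" unfolding C_def by (simp add: div_mult_mod_eq del: mult_Suc_right)
  qed
qed

text \<open>The family consists of the monomials in the functions \<open>g i\<close> with exponents at most \<open>N\<close>.\<close>

lemma chain_independent_family:
  assumes "\<And>i. i \<le> k \<Longrightarrow> zariski_irreducible n (Y i)" "\<And>i. i \<le> k \<Longrightarrow> Y i \<subseteq> M2 n"
    and "\<And>i. i < k \<Longrightarrow> Y i \<subseteq> Y (Suc i)"
    and "\<And>i. i < k \<Longrightarrow> pdeg n d (g i)" "\<And>i x. i < k \<Longrightarrow> x \<in> Y i \<Longrightarrow> g i x = 0" "\<And>i. i < k \<Longrightarrow> \<exists>y\<in>Y (Suc i). g i y \<noteq> 0"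
  shows "\<exists>F. (\<forall>i<Suc N ^ k. pdeg n (k * (N * d)) (F i)) \<and> indep_on (Y k) (Suc N ^ k) F"
  using assms
proof (induction k)
  case 0
  have "Y 0 \<noteq> {}" using 0(1)[of 0] unfolding zariski_irreducible_def by auto
  then have "indep_on (Y 0) 1 (\<lambda>i x. 1)" unfolding indep_on_def by auto
  then show ?case using pd_const[of n 1] by (intro exI[of _ "\<lambda>i x. 1"]) simp
next
  case (Suc k)
  have "\<exists>F. (\<forall>i<Suc N ^ k. pdeg n (k * (N * d)) (F i)) \<and> indep_on (Y k) (Suc N ^ k) F"
    using Suc.prems by (intro Suc.IH) auto
  then obtain F where F: "\<forall>i<Suc N ^ k. pdeg n (k * (N * d)) (F i)" "indep_on (Y k) (Suc N ^ k) F"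
    by blast
  obtain y where y: "y \<in> Y (Suc k)" "g k y \<noteq> 0" using Suc.prems(6)[of k] by auto
  define G where "G i x = F (i div Suc N) x * g k x ^ (i mod Suc N)" for i x
  have "indep_on (Y (Suc k)) (Suc N ^ k * Suc N) G"
    unfolding G_def
  proof (rule indep_on_step[where Y = "Y k" and g = "g k" and y = y and n = n])
    show "g k \<in> poly_fun n" using Suc.prems(4)[of k] pdeg_poly_fun by simp
    show "\<And>i. i < Suc N ^ k \<Longrightarrow> F i \<in> poly_fun n" using F(1) pdeg_poly_fun by blast
  qed (use Suc.prems F y in auto)
  moreover have "pdeg n (Suc k * (N * d)) (G i)" if i: "i < Suc N ^ k * Suc N" for i
  proof -
    have "i div Suc N < Suc N ^ k" using i by (simp add: less_mult_imp_div_less)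
    then have 1: "pdeg n (k * (N * d)) (F (i div Suc N))" using F(1) by blast
    have "pdeg n ((i mod Suc N) * d) (\<lambda>x. g k x ^ (i mod Suc N))" using Suc.prems(4)[of k] by (intro pdeg_power) simp
    moreover have "(i mod Suc N) * d \<le> N * d" using mod_less_divisor[of "Suc N" i] by (intro mult_le_mono1) simp
    ultimately have "pdeg n (N * d) (\<lambda>x. g k x ^ (i mod Suc N))" by (rule pd_mono)
    from pd_mult[OF 1 this] show ?thesis unfolding G_def[abs_def] by (simp add: add.commute)
  qed
  ultimately show ?case by (intro exI[of _ G]) (simp add: mult.commute del: mult_Suc_right mult_Suc)
qed

section \<open>Polynomials in the coordinates with bounded exponents\<close>

definition expset :: "coord set \<Rightarrow> nat \<Rightarrow> (coord \<Rightarrow> nat) set" where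
  "expset K M = K \<rightarrow>\<^sub>E {..M}"

definition monom_fun :: "coord set \<Rightarrow> (coord \<Rightarrow> nat) \<Rightarrow> (coord \<Rightarrow> complex) \<Rightarrow> complex" where
  "monom_fun K e \<theta> = (\<Prod>\<kappa>\<in>K. \<theta> \<kappa> ^ e \<kappa>)"

text \<open>\<open>M\<close> bounds the exponent of each coordinate separately, not the total
  degree: the spanning set then has exactly \<open>Suc M ^ card K\<close> exponent vectors, and
  bounds add under multiplication.\<close>

definition inspan :: "coord set \<Rightarrow> nat \<Rightarrow> ((coord \<Rightarrow> complex) \<Rightarrow> complex) \<Rightarrow> bool" where
  "inspan K M \<phi> \<longleftrightarrow> (\<exists>c. \<forall>\<theta>. \<phi> \<theta> = (\<Sum>e\<in>expset K M. c e * monom_fun K e \<theta>))"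

lemma finite_expset: "finite K \<Longrightarrow> finite (expset K M)"
  unfolding expset_def by (intro finite_PiE) auto

lemma card_expset: "finite K \<Longrightarrow> card (expset K M) = Suc M ^ card K"
  unfolding expset_def by (simp add: card_PiE)

lemma inspan_monom:
  assumes "finite K" "e \<in> expset K M" shows "inspan K M (\<lambda>\<theta>. c * monom_fun K e \<theta>)"
proof -
  have "c * monom_fun K e \<theta> = (\<Sum>e'\<in>expset K M. (if e' = e then c else 0) * monom_fun K e' \<theta>)" for \<theta>
    using assms finite_expset[of K M] by (simp add: if_distrib[of "\<lambda>x. x * _"] cong: if_cong)
  then show ?thesis unfolding inspan_def by (intro exI[of _ "\<lambda>e'. if e' = e then c else 0"]) simp
qed

lemma inspan_const: "finite K \<Longrightarrow> inspan K M (\<lambda>\<theta>. c)"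
  using inspan_monom[of K "\<lambda>\<kappa>\<in>K. 0" M c] by (auto simp: expset_def monom_fun_def)

lemma inspan_coord:
  assumes "finite K" "\<kappa> \<in> K" shows "inspan K 1 (\<lambda>\<theta>. \<theta> \<kappa>)"
proof -
  have "monom_fun K (\<lambda>x\<in>K. if x = \<kappa> then 1 else 0) \<theta> = \<theta> \<kappa>" for \<theta>
  proof -
    have "monom_fun K (\<lambda>x\<in>K. if x = \<kappa> then 1 else 0) \<theta> = (\<Prod>x\<in>K. if x = \<kappa> then \<theta> x else 1)"
      unfolding monom_fun_def by (intro prod.cong) auto
    then show ?thesis using assms by simp
  qed
  moreover have "(\<lambda>x\<in>K. if x = \<kappa> then 1 else 0) \<in> expset K 1" unfolding expset_def by auto
  ultimately show ?thesis using inspan_monom[OF assms(1), of "\<lambda>x\<in>K. if x = \<kappa> then 1 else 0" 1 1] by simp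
qed

lemma inspan_add: "inspan K M \<phi> \<Longrightarrow> inspan K M \<psi> \<Longrightarrow> inspan K M (\<lambda>\<theta>. \<phi> \<theta> + \<psi> \<theta>)"
proof -
  assume "inspan K M \<phi>" "inspan K M \<psi>"
  then obtain c d where "\<And>\<theta>. \<phi> \<theta> = (\<Sum>e\<in>expset K M. c e * monom_fun K e \<theta>)" "\<And>\<theta>. \<psi> \<theta> = (\<Sum>e\<in>expset K M. d e * monom_fun K e \<theta>)"
    unfolding inspan_def by blast
  then show ?thesis unfolding inspan_def by (intro exI[of _ "\<lambda>e. c e + d e"]) (simp add: sum.distrib distrib_right)
qed

lemma inspan_if: "(b \<Longrightarrow> inspan K M \<phi>) \<Longrightarrow> (\<not> b \<Longrightarrow> inspan K M \<psi>) \<Longrightarrow> inspan K M (\<lambda>\<theta>. if b then \<phi> \<theta> else \<psi> \<theta>)"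
  by (cases b) simp_all

lemma inspan_sum: "finite K \<Longrightarrow> (\<And>i. i \<in> I \<Longrightarrow> inspan K M (\<phi> i)) \<Longrightarrow> inspan K M (\<lambda>\<theta>. \<Sum>i\<in>I. \<phi> i \<theta>)"
  by (induction I rule: infinite_finite_induct) (auto intro: inspan_add inspan_const)

lemma inspan_mult:
  assumes K: "finite K" and "inspan K M \<phi>" "inspan K M' \<psi>" shows "inspan K (M + M') (\<lambda>\<theta>. \<phi> \<theta> * \<psi> \<theta>)"
proof -
  from assms obtain c d where \<phi>: "\<And>\<theta>. \<phi> \<theta> = (\<Sum>e\<in>expset K M. c e * monom_fun K e \<theta>)"
    and \<psi>: "\<And>\<theta>. \<psi> \<theta> = (\<Sum>e\<in>expset K M'. d e * monom_fun K e \<theta>)" unfolding inspan_def by blast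
  define s where "s e e' = (\<lambda>\<kappa>\<in>K. e \<kappa> + e' \<kappa>)" for e e' :: "coord \<Rightarrow> nat"
  have s: "s e e' \<in> expset K (M + M')" if "e \<in> expset K M" "e' \<in> expset K M'" for e e'
    using that unfolding s_def expset_def by (auto intro!: add_mono simp: PiE_iff)
  have m: "monom_fun K e \<theta> * monom_fun K e' \<theta> = monom_fun K (s e e') \<theta>" for e e' \<theta>
    unfolding monom_fun_def s_def prod.distrib[symmetric] by (intro prod.cong refl) (simp add: power_add)
  have "\<phi> \<theta> * \<psi> \<theta> = (\<Sum>e\<in>expset K M. \<Sum>e'\<in>expset K M'. (c e * d e') * monom_fun K (s e e') \<theta>)" for \<theta>
    unfolding \<phi> \<psi> sum_product m[symmetric] by (intro sum.cong refl) (simp add: mult_ac)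
  then show ?thesis using K s by (simp only:) (intro inspan_sum inspan_monom)
qed

lemma inspan_mono: "finite K \<Longrightarrow> inspan K M \<phi> \<Longrightarrow> M \<le> M' \<Longrightarrow> inspan K M' \<phi>"
  using inspan_mult[of K M \<phi> "M' - M" "\<lambda>_. 1"] inspan_const[of K "M' - M" 1] by simp

lemma inspan_uminus: "finite K \<Longrightarrow> inspan K M \<phi> \<Longrightarrow> inspan K M (\<lambda>\<theta>. - \<phi> \<theta>)"
  using inspan_mult[of K 0 "\<lambda>_. - 1" M \<phi>] inspan_const[of K 0 "- 1"] by simp

lemma inspan_prod:
  assumes "finite K" "\<And>i. i \<in> I \<Longrightarrow> inspan K M (\<phi> i)" shows "inspan K (card I * M) (\<lambda>\<theta>. \<Prod>i\<in>I. \<phi> i \<theta>)"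
  using assms(2)
proof (induction I rule: infinite_finite_induct)
  case (insert i I)
  then show ?case using inspan_mult[OF assms(1), of M "\<phi> i" "card I * M" "\<lambda>\<theta>. \<Prod>i\<in>I. \<phi> i \<theta>"] by simp
qed (use inspan_const[OF assms(1)] in auto)

lemma inspan_power: "finite K \<Longrightarrow> inspan K M \<phi> \<Longrightarrow> inspan K (k * M) (\<lambda>\<theta>. \<phi> \<theta> ^ k)"
  using inspan_prod[of K "{..<k}" M "\<lambda>_. \<phi>"] by simp

lemma inspan_det:
  assumes K: "finite K" and F: "\<And>\<theta>. F \<theta> \<in> carrier_mat k k"
    "\<And>i j. i < k \<Longrightarrow> j < k \<Longrightarrow> inspan K 1 (\<lambda>\<theta>. F \<theta> $$ (i, j))"
  shows "inspan K k (\<lambda>\<theta>. det (F \<theta>))"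
  unfolding det_def'[OF F(1)]
proof (rule inspan_sum[OF K])
  fix p assume p: "p \<in> {p. p permutes {0..<k}}"
  have "inspan K 1 (\<lambda>\<theta>. F \<theta> $$ (i, p i))" if "i \<in> {0..<k}" for i
    using p that permutes_in_image[of p "{0..<k}" i] by (intro F(2)) auto
  from inspan_prod[OF K this, of "{0..<k}" "\<lambda>i. i"]
  have "inspan K k (\<lambda>\<theta>. \<Prod>i = 0..<k. F \<theta> $$ (i, p i))" by simp
  from inspan_mult[OF K inspan_const[OF K, of 0 "signof p"] this]
  show "inspan K k (\<lambda>\<theta>. signof p * (\<Prod>i = 0..<k. F \<theta> $$ (i, p i)))" by simp
qed

text \<open>Only the coordinates on which \<open>gmat\<close> and \<open>std\<close> depend for
  \<open>2 p + m \<le> n\<close>. The \<open>m\<close> unpaired indices carry no \<open>CZ\<close>,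
  because the second matrix vanishes there.\<close>

definition coords :: "nat \<Rightarrow> nat \<Rightarrow> nat \<Rightarrow> coord set" where
  "coords n p m = (\<lambda>(i, j). CG i j) ` {(i, j). i < n \<and> j < n \<and> i \<noteq> j} \<union> CA ` {..<p + m} \<union> CZ ` ({..<2 * p} \<union> {2 * p + m..<n})"

lemma finite_coords: "finite (coords n p m)"
proof -
  have "finite {(i, j). i < n \<and> j < n \<and> i \<noteq> j}" by (rule finite_subset[of _ "{..<n} \<times> {..<n}"]) auto
  then show ?thesis unfolding coords_def by auto
qed

lemma card_coords:
  assumes "2 * p + m + r = n" shows "card (coords n p m) = n ^ 2 + p"
proof -
  let ?G = "{(i, j). i < n \<and> j < n \<and> i \<noteq> j}"
  have "?G = {..<n} \<times> {..<n} - (\<lambda>i. (i, i)) ` {..<n}" by auto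
  moreover have "card ((\<lambda>i. (i, i)) ` {..<n}) = n" by (simp add: card_image inj_on_def)
  ultimately have G: "card ?G = n * n - n" by (simp add: card_Diff_subset image_subset_iff)
  have finG: "finite ?G" by (rule finite_subset[of _ "{..<n} \<times> {..<n}"]) auto
  have c1: "card ((\<lambda>(i, j). CG i j) ` ?G) = n * n - n" unfolding G[symmetric] by (intro card_image) (auto simp: inj_on_def)
  have c2: "card (CA ` {..<p + m}) = p + m" by (simp add: card_image inj_on_def)
  have "card ({..<2 * p} \<union> {2 * p + m..<n}) = 2 * p + r" using assms by (subst card_Un_disjoint) auto
  then have c3: "card (CZ ` ({..<2 * p} \<union> {2 * p + m..<n})) = 2 * p + r" by (simp add: card_image inj_on_def)
  have "card (coords n p m) = (n * n - n) + (p + m) + (2 * p + r)"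
    unfolding coords_def using finG by (subst card_Un_disjoint, force, force, force, subst card_Un_disjoint) (auto simp: c1 c2 c3)
  moreover have "n \<le> n * n" by (cases n) auto
  ultimately show ?thesis using assms by (simp add: power2_eq_square)
qed

context
  fixes n p m :: nat
  assumes n: "2 * p + m \<le> n"
begin

abbreviation "K \<equiv> coords n p m"

lemma inspan_gmat: "i < n \<Longrightarrow> j < n \<Longrightarrow> inspan K 1 (\<lambda>\<theta>. gmat n \<theta> $$ (i, j))"
proof (cases "i = j")
  case False
  assume "i < n" "j < n"
  then have "CG i j \<in> K" using False unfolding coords_def by auto
  then show ?thesis using inspan_coord[OF finite_coords] \<open>i < n\<close> \<open>j < n\<close> False unfolding gmat_def by simp
qed (simp add: gmat_def inspan_const finite_coords)

lemma inspan_std: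
  assumes "i < n" "j < n"
  shows "inspan K 1 (\<lambda>\<theta>. fst (std n p m \<theta>) $$ (i, j))" "inspan K 1 (\<lambda>\<theta>. snd (std n p m \<theta>) $$ (i, j))"
proof -
  have c: "inspan K 1 (\<lambda>\<theta>. \<theta> (CA l))" if "l < p + m" for l using that by (intro inspan_coord finite_coords) (auto simp: coords_def)
  have z: "inspan K 1 (\<lambda>\<theta>. 0)" by (rule inspan_const[OF finite_coords])
  have u: "inspan K 1 (\<lambda>\<theta>. - \<theta> (CA l))" if "l < p + m" for l using c[OF that] by (rule inspan_uminus[OF finite_coords])
  show "inspan K 1 (\<lambda>\<theta>. fst (std n p m \<theta>) $$ (i, j))"
    using c[of "i div 2"] u[of "i div 2"] c[of "i - p"] z assms unfolding std_def diag_A_def diag_entry_def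
    by (cases "i = j"; cases "i < 2 * p"; cases "even i"; cases "i < 2 * p + m") simp_all
  have c': "inspan K 1 (\<lambda>\<theta>. \<theta> (CZ i))" if "i < 2 * p \<or> 2 * p + m \<le> i"
    using that assms by (intro inspan_coord finite_coords) (auto simp: coords_def)
  show "inspan K 1 (\<lambda>\<theta>. snd (std n p m \<theta>) $$ (i, j))"
  proof -
    have "snd (std n p m \<theta>) $$ (i, j) = (if i < 2 * p then if j = partner i then \<theta> (CZ i) else 0
        else if i = j \<and> 2 * p + m \<le> i then \<theta> (CZ i) else 0)" for \<theta>
      unfolding std_def Bst_def using assms by simp
    then show ?thesis by (simp only:) (intro inspan_if c' z; simp)
  qed
qed

lemma gmat_carrier: "gmat n \<theta> \<in> carrier_mat n n"
  unfolding gmat_def by auto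

lemma inspan_adj:
  assumes ij: "i < n" "j < n" shows "inspan K n (\<lambda>\<theta>. adj_mat (gmat n \<theta>) $$ (i, j))"
proof -
  have e: "adj_mat (gmat n \<theta>) $$ (i, j) = (- 1) ^ (j + i) * det (mat_delete (gmat n \<theta>) j i)" for \<theta>
    using ij gmat_carrier[of \<theta>] unfolding adj_mat_def cofactor_def by auto
  have "inspan K (n - 1) (\<lambda>\<theta>. det (mat_delete (gmat n \<theta>) j i))"
  proof (rule inspan_det[OF finite_coords])
    show "mat_delete (gmat n \<theta>) j i \<in> carrier_mat (n - 1) (n - 1)" for \<theta> using gmat_carrier by (rule mat_delete_carrier)
    fix a b assume ab: "a < n - 1" "b < n - 1"
    have "mat_delete (gmat n \<theta>) j i $$ (a, b) = gmat n \<theta> $$ (insert_index j a, insert_index i b)" for \<theta>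
      using ab gmat_carrier[of \<theta>] unfolding mat_delete_def insert_index_def by auto
    moreover have "insert_index j a < n" "insert_index i b < n" using ab ij unfolding insert_index_def by auto
    ultimately show "inspan K 1 (\<lambda>\<theta>. mat_delete (gmat n \<theta>) j i $$ (a, b))" using inspan_gmat by simp
  qed
  then have "inspan K n (\<lambda>\<theta>. det (mat_delete (gmat n \<theta>) j i))" by (rule inspan_mono[OF finite_coords]) simp
  from inspan_mult[OF finite_coords inspan_const[OF finite_coords, where M = 0 and c = "(- 1) ^ (j + i)"] this]
  show ?thesis unfolding e by simp
qed

text \<open>An entry of the conjugated pair, times the determinant, is a sum of products of an entry
  of \<open>gmat\<close>, one of \<open>std\<close> and one of the adjugate, with exponent bounds 1,
  1 and \<open>n\<close>; hence \<open>n + 2\<close> per degree. Raising the degree bound multiplies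
  by further powers of the determinant, whose own bound \<open>n\<close> fits as well.\<close>

lemma pullback_inspan:
  assumes "pdeg n d f"
  shows "\<exists>\<phi>. inspan K (d * (n + 2)) \<phi> \<and>
    (\<forall>\<theta>. det (gmat n \<theta>) \<noteq> 0 \<longrightarrow> det (gmat n \<theta>) ^ d * f (cjad (gmat n \<theta>) (std n p m \<theta>)) = \<phi> \<theta>)"
  using assms
proof (induction rule: pdeg.induct)
  case (pd_const c)
  show ?case by (rule exI[of _ "\<lambda>_. c"]) (simp add: inspan_const finite_coords)
next
  case (pd_add d f g)
  then obtain \<phi> \<psi> where "inspan K (d * (n + 2)) \<phi>" "inspan K (d * (n + 2)) \<psi>"
    "\<And>\<theta>. det (gmat n \<theta>) \<noteq> 0 \<Longrightarrow> det (gmat n \<theta>) ^ d * f (cjad (gmat n \<theta>) (std n p m \<theta>)) = \<phi> \<theta>"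
    "\<And>\<theta>. det (gmat n \<theta>) \<noteq> 0 \<Longrightarrow> det (gmat n \<theta>) ^ d * g (cjad (gmat n \<theta>) (std n p m \<theta>)) = \<psi> \<theta>" by blast
  then show ?case by (intro exI[of _ "\<lambda>\<theta>. \<phi> \<theta> + \<psi> \<theta>"]) (auto intro: inspan_add simp: distrib_left)
next
  case (pd_mult d f e g)
  then obtain \<phi> \<psi> where "inspan K (d * (n + 2)) \<phi>" "inspan K (e * (n + 2)) \<psi>"
    and eq: "\<And>\<theta>. det (gmat n \<theta>) \<noteq> 0 \<Longrightarrow> det (gmat n \<theta>) ^ d * f (cjad (gmat n \<theta>) (std n p m \<theta>)) = \<phi> \<theta>"
    "\<And>\<theta>. det (gmat n \<theta>) \<noteq> 0 \<Longrightarrow> det (gmat n \<theta>) ^ e * g (cjad (gmat n \<theta>) (std n p m \<theta>)) = \<psi> \<theta>" by blast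
  then have "inspan K ((d + e) * (n + 2)) (\<lambda>\<theta>. \<phi> \<theta> * \<psi> \<theta>)"
    using inspan_mult[OF finite_coords] unfolding distrib_right by blast
  moreover have "det (gmat n \<theta>) ^ (d + e) * (f (cjad (gmat n \<theta>) (std n p m \<theta>)) * g (cjad (gmat n \<theta>) (std n p m \<theta>))) = \<phi> \<theta> * \<psi> \<theta>"
    if "det (gmat n \<theta>) \<noteq> 0" for \<theta>
    unfolding eq(1)[OF that, symmetric] eq(2)[OF that, symmetric] by (simp add: power_add mult_ac)
  ultimately show ?case by blast
next
  case (pd_mono d f e)
  then obtain \<phi> where \<phi>: "inspan K (d * (n + 2)) \<phi>"
    "\<And>\<theta>. det (gmat n \<theta>) \<noteq> 0 \<Longrightarrow> det (gmat n \<theta>) ^ d * f (cjad (gmat n \<theta>) (std n p m \<theta>)) = \<phi> \<theta>" by blast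
  have "inspan K n (\<lambda>\<theta>. det (gmat n \<theta>))" by (rule inspan_det[OF finite_coords gmat_carrier inspan_gmat])
  then have "inspan K (n + 2) (\<lambda>\<theta>. det (gmat n \<theta>))" by (rule inspan_mono[OF finite_coords]) simp
  from inspan_mult[OF finite_coords inspan_power[OF finite_coords this, of "e - d"] \<phi>(1)]
  have "inspan K (e * (n + 2)) (\<lambda>\<theta>. det (gmat n \<theta>) ^ (e - d) * \<phi> \<theta>)"
    unfolding distrib_right[symmetric] using pd_mono.hyps(2) by simp
  moreover have "det (gmat n \<theta>) ^ e * f (cjad (gmat n \<theta>) (std n p m \<theta>)) = det (gmat n \<theta>) ^ (e - d) * \<phi> \<theta>"
    if "det (gmat n \<theta>) \<noteq> 0" for \<theta>
    unfolding \<phi>(2)[OF that, symmetric] mult.assoc[symmetric] power_add[symmetric] using pd_mono.hyps(2) by simp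
  ultimately show ?case by blast
next
  have *: "\<exists>\<phi>. inspan K (1 * (n + 2)) \<phi> \<and> (\<forall>\<theta>. det (gmat n \<theta>) \<noteq> 0 \<longrightarrow>
       det (gmat n \<theta>) ^ 1 * (gmat n \<theta> * X \<theta> * ((1 / det (gmat n \<theta>)) \<cdot>\<^sub>m adj_mat (gmat n \<theta>))) $$ (i, j) = \<phi> \<theta>)"
    if ij: "i < n" "j < n" and X: "\<And>\<theta>. X \<theta> \<in> carrier_mat n n"
      "\<And>i j. i < n \<Longrightarrow> j < n \<Longrightarrow> inspan K 1 (\<lambda>\<theta>. X \<theta> $$ (i, j))" for X i j
  proof (intro exI conjI allI impI)
    have a: "adj_mat (gmat n \<theta>) \<in> carrier_mat n n" for \<theta> using gmat_carrier by (rule adj_mat(1))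
    have "(gmat n \<theta> * X \<theta> * adj_mat (gmat n \<theta>)) $$ (i, j) =
      (\<Sum>l<n. (\<Sum>k<n. gmat n \<theta> $$ (i, k) * X \<theta> $$ (k, l)) * adj_mat (gmat n \<theta>) $$ (l, j))" for \<theta>
    proof -
      have gX: "gmat n \<theta> * X \<theta> \<in> carrier_mat n n" using gmat_carrier X(1) by (rule mult_carrier_mat)
      show ?thesis unfolding mat_mult_entry[OF gX a ij]
        by (intro sum.cong refl) (simp add: mat_mult_entry[OF gmat_carrier X(1) ij(1)] del: index_mult_mat(1))
    qed
    moreover have "inspan K (1 * (n + 2)) (\<lambda>\<theta>. \<Sum>l<n. (\<Sum>k<n. gmat n \<theta> $$ (i, k) * X \<theta> $$ (k, l)) * adj_mat (gmat n \<theta>) $$ (l, j))"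
    proof (rule inspan_sum[OF finite_coords])
      fix l assume "l \<in> {..<n}"
      then have l: "l < n" by simp
      have "inspan K (1 + 1) (\<lambda>\<theta>. \<Sum>k<n. gmat n \<theta> $$ (i, k) * X \<theta> $$ (k, l))"
        using ij l X(2) by (intro inspan_sum inspan_mult finite_coords inspan_gmat) auto
      from inspan_mult[OF finite_coords this inspan_adj[OF l ij(2)]]
      show "inspan K (1 * (n + 2)) (\<lambda>\<theta>. (\<Sum>k<n. gmat n \<theta> $$ (i, k) * X \<theta> $$ (k, l)) * adj_mat (gmat n \<theta>) $$ (l, j))" by simp
    qed
    ultimately show "inspan K (1 * (n + 2)) (\<lambda>\<theta>. (gmat n \<theta> * X \<theta> * adj_mat (gmat n \<theta>)) $$ (i, j))" by simp
    fix \<theta> assume "det (gmat n \<theta>) \<noteq> 0"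
    moreover have "gmat n \<theta> * X \<theta> * ((1 / det (gmat n \<theta>)) \<cdot>\<^sub>m adj_mat (gmat n \<theta>)) = (1 / det (gmat n \<theta>)) \<cdot>\<^sub>m (gmat n \<theta> * X \<theta> * adj_mat (gmat n \<theta>))"
      using a gmat_carrier X(1) by (intro mult_smult_distrib mult_carrier_mat)
    moreover have "gmat n \<theta> * X \<theta> * adj_mat (gmat n \<theta>) \<in> carrier_mat n n" using a gmat_carrier X(1) by (intro mult_carrier_mat)
    note c = carrier_matD[OF this]
    ultimately show "det (gmat n \<theta>) ^ 1 * (gmat n \<theta> * X \<theta> * ((1 / det (gmat n \<theta>)) \<cdot>\<^sub>m adj_mat (gmat n \<theta>))) $$ (i, j) =
       (gmat n \<theta> * X \<theta> * adj_mat (gmat n \<theta>)) $$ (i, j)"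
      using ij c by (simp del: index_mult_mat)
  qed
  {
    case (pd_coordA i j)
    show ?case unfolding cjad_def cj_def fst_conv
      using pd_coordA by (intro * inspan_std(1)) (auto simp: std_def diag_A_def)
  next
    case (pd_coordB i j)
    show ?case unfolding cjad_def cj_def snd_conv
      using pd_coordB by (intro * inspan_std(2)) (auto simp: std_def)
  }
qed

text \<open>With more functions than monomials, some nontrivial combination has zero pullback. Since
  the determinant is nonzero on the family, clearing denominators loses nothing.\<close>

lemma not_independent_on_SX:
  assumes F: "\<And>i. i < T \<Longrightarrow> pdeg n d (F i)" and T: "Suc (d * (n + 2)) ^ card K < T"
  shows "\<exists>c. (\<exists>i<T. c i \<noteq> 0) \<and> (\<forall>x\<in>SX n p m UNIV. (\<Sum>i<T. c i * F i x) = 0)"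
proof -
  let ?E = "expset K (d * (n + 2))"
  have "\<forall>i. \<exists>l. i < T \<longrightarrow> (\<forall>\<theta>. det (gmat n \<theta>) \<noteq> 0 \<longrightarrow>
     det (gmat n \<theta>) ^ d * F i (cjad (gmat n \<theta>) (std n p m \<theta>)) = (\<Sum>e\<in>?E. l e * monom_fun K e \<theta>))"
    using pullback_inspan[OF F] unfolding inspan_def by metis
  from choice[OF this] obtain l where l: "\<And>i \<theta>. i < T \<Longrightarrow> det (gmat n \<theta>) \<noteq> 0 \<Longrightarrow>
     det (gmat n \<theta>) ^ d * F i (cjad (gmat n \<theta>) (std n p m \<theta>)) = (\<Sum>e\<in>?E. l i e * monom_fun K e \<theta>)" by blast
  have "card ?E < card {..<T}" using T card_expset[OF finite_coords] by simp
  from homogeneous_solution[OF finite_expset[OF finite_coords] _ this, of l] obtain c where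
    c: "\<exists>i<T. c i \<noteq> 0" "\<And>e. e \<in> ?E \<Longrightarrow> (\<Sum>i<T. c i * l i e) = 0" by auto
  have "(\<Sum>i<T. c i * F i x) = 0" if x: "x \<in> SX n p m UNIV" for x
  proof -
    obtain \<theta> h where \<theta>: "x = cj (gmat n \<theta>) h (std n p m \<theta>)" "inverse_mats n (gmat n \<theta>) h" using x unfolding SX_def by auto
    have x': "x = cjad (gmat n \<theta>) (std n p m \<theta>)" using \<theta> cj_cjad by metis
    have d0: "det (gmat n \<theta>) \<noteq> 0" using inverse_mats_det_nz[OF \<theta>(2)] .
    have "det (gmat n \<theta>) ^ d * (\<Sum>i<T. c i * F i x) = (\<Sum>i<T. c i * (det (gmat n \<theta>) ^ d * F i x))"
      by (simp add: sum_distrib_left mult_ac)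
    also have "\<dots> = (\<Sum>i<T. c i * (\<Sum>e\<in>?E. l i e * monom_fun K e \<theta>))"
      unfolding x' using l d0 by (intro sum.cong refl) simp
    also have "\<dots> = (\<Sum>i<T. \<Sum>e\<in>?E. c i * l i e * monom_fun K e \<theta>)" by (simp add: sum_distrib_left mult.assoc)
    also have "\<dots> = (\<Sum>e\<in>?E. \<Sum>i<T. c i * l i e * monom_fun K e \<theta>)" by (rule sum.swap)
    also have "\<dots> = (\<Sum>e\<in>?E. (\<Sum>i<T. c i * l i e) * monom_fun K e \<theta>)" by (simp add: sum_distrib_right)
    also have "\<dots> = 0" using c(2) by (intro sum.neutral) auto
    finally show ?thesis using d0 by simp
  qed
  with c(1) show ?thesis by blast
qed

lemma chain_length_le:
  assumes ch: "\<And>i. i \<le> k \<Longrightarrow> zariski_closed n (Y i)" "\<And>i. i \<le> k \<Longrightarrow> zariski_irreducible n (Y i)"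
    "\<And>i. i < k \<Longrightarrow> Y i \<subset> Y (Suc i)" and top: "Y k \<subseteq> zariski_closure n (SX n p m UNIV)"
  shows "k \<le> card K"
proof (rule ccontr)
  assume "\<not> k \<le> card K"
  then have k: "Suc (card K) \<le> k" by simp
  have M2: "Y i \<subseteq> M2 n" if "i \<le> k" for i using zariski_closed_subset[OF ch(1)[OF that]] .
  have "\<forall>i. \<exists>f. i < k \<longrightarrow> f \<in> poly_fun n \<and> (\<forall>x\<in>Y i. f x = 0) \<and> (\<exists>y\<in>Y (Suc i). f y \<noteq> 0)"
  proof (intro allI)
    fix i
    show "\<exists>f. i < k \<longrightarrow> f \<in> poly_fun n \<and> (\<forall>x\<in>Y i. f x = 0) \<and> (\<exists>y\<in>Y (Suc i). f y \<noteq> 0)"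
    proof (cases "i < k")
      case True
      from ch(3)[OF True] obtain y where y: "y \<in> Y (Suc i)" "y \<notin> Y i" by blast
      have "zariski_closed n (Y i)" using ch(1) True by simp
      then obtain F where F: "F \<subseteq> poly_fun n" "Y i = {x \<in> M2 n. \<forall>f\<in>F. f x = 0}" unfolding zariski_closed_def by blast
      have "y \<in> M2 n" using M2[of "Suc i"] y True by auto
      then obtain f where "f \<in> F" "f y \<noteq> 0" using y(2) unfolding F(2) by auto
      moreover have "\<forall>x\<in>Y i. f x = 0" using \<open>f \<in> F\<close> unfolding F(2) by auto
      ultimately show ?thesis using F(1) y(1) by blast
    qed simp
  qed
  from choice[OF this] obtain g where g: "\<And>i. i < k \<Longrightarrow> g i \<in> poly_fun n" "\<And>i x. i < k \<Longrightarrow> x \<in> Y i \<Longrightarrow> g i x = 0"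
    "\<And>i. i < k \<Longrightarrow> \<exists>y\<in>Y (Suc i). g i y \<noteq> 0" by blast
  have "\<forall>i. \<exists>d. i < k \<longrightarrow> pdeg n d (g i)" using poly_fun_pdeg g(1) by blast
  from choice[OF this] obtain dg where dg: "\<And>i. i < k \<Longrightarrow> pdeg n (dg i) (g i)" by blast
  define d where "d = (\<Sum>i<k. dg i)"
  have d: "pdeg n d (g i)" if "i < k" for i
    using pd_mono[OF dg[OF that]] member_le_sum[of i "{..<k}" dg] that unfolding d_def by simp
  \<comment> \<open>With D = card K, the choice N = c^D gives (c (N + 1))^D = N (N + 1)^D. This is
    strictly below (N + 1)^(D + 1), the least number of independent functions if k exceeds
    D.\<close>
  define c where "c = Suc (k * d * (n + 2))"
  define N where "N = c ^ card K"
  obtain F where F: "\<forall>i<Suc N ^ k. pdeg n (k * (N * d)) (F i)" "indep_on (Y k) (Suc N ^ k) F"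
    using chain_independent_family[of k n Y d g N] ch(2,3) M2 d g(2,3) by blast
  have "Suc (k * (N * d) * (n + 2)) \<le> c * Suc N" unfolding c_def by (simp add: algebra_simps)
  then have "Suc (k * (N * d) * (n + 2)) ^ card K \<le> (c * Suc N) ^ card K" by (rule power_mono) simp
  also have "\<dots> = N * Suc N ^ card K" unfolding N_def by (simp only: power_mult_distrib)
  also have "\<dots> < Suc N * Suc N ^ card K" by simp
  also have "\<dots> = Suc N ^ Suc (card K)" by simp
  also have "\<dots> \<le> Suc N ^ k" using k by (intro power_increasing) auto
  finally have "Suc (k * (N * d) * (n + 2)) ^ card K < Suc N ^ k" .
  from not_independent_on_SX[OF _ this] F(1) obtain e where e: "\<exists>i<Suc N ^ k. e i \<noteq> 0"
    "\<And>x. x \<in> SX n p m UNIV \<Longrightarrow> (\<Sum>i<Suc N ^ k. e i * F i x) = 0" by blast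
  have "(\<lambda>x. \<Sum>i<Suc N ^ k. e i * F i x) \<in> poly_fun n"
    using F(1) pdeg_poly_fun by (intro poly_fun_sum pf_mult pf_const) auto
  from zero_on_closure[OF SX_M2 this e(2)] top have "\<forall>x\<in>Y k. (\<Sum>i<Suc N ^ k. e i * F i x) = 0" by blast
  then show False using F(2) e(1) unfolding indep_on_def by blast
qed

end

subsection \<open>Lower bound for the dimension\<close>

text \<open>Serves to write spectral projections as polynomials in the two matrices.\<close>

fun mprod :: "nat \<Rightarrow> complex mat \<Rightarrow> complex mat \<Rightarrow> complex list \<Rightarrow> complex mat" where
  "mprod n X D [] = D"
| "mprod n X D (l # ls) = mprod n X D ls * (X + (- l) \<cdot>\<^sub>m 1\<^sub>m n)"

lemma mprod_carrier: "X \<in> carrier_mat n n \<Longrightarrow> D \<in> carrier_mat n n \<Longrightarrow> mprod n X D ls \<in> carrier_mat n n"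
  by (induction ls) auto

lemma poly_mat_mprod: "poly_mat n F \<Longrightarrow> poly_mat n G \<Longrightarrow> poly_mat n (\<lambda>x. mprod n (F x) (G x) ls)"
  by (induction ls) (auto intro!: poly_mat_mult poly_mat_add poly_mat_const)

lemma conj_shift:
  assumes "inverse_mats n P Q" "X \<in> carrier_mat n n"
  shows "P * X * Q + c \<cdot>\<^sub>m 1\<^sub>m n = P * (X + c \<cdot>\<^sub>m 1\<^sub>m n) * Q"
proof -
  note a = inverse_matsD[OF assms(1)]
  have "P * (c \<cdot>\<^sub>m 1\<^sub>m n) * Q = c \<cdot>\<^sub>m (P * 1\<^sub>m n * Q)" using a(1,2) by (intro smult_conj[symmetric]) auto
  also have "P * 1\<^sub>m n * Q = 1\<^sub>m n" using a by simp
  finally have "c \<cdot>\<^sub>m 1\<^sub>m n = P * (c \<cdot>\<^sub>m 1\<^sub>m n) * Q" by simp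
  then show ?thesis using conj_add[OF a(1,2) assms(2), of "c \<cdot>\<^sub>m 1\<^sub>m n"] by simp
qed

lemma mprod_conj:
  assumes "inverse_mats n P Q" "X \<in> carrier_mat n n" "D \<in> carrier_mat n n"
  shows "mprod n (P * X * Q) (P * D * Q) ls = P * mprod n X D ls * Q"
proof (induction ls)
  case (Cons l ls)
  show ?case unfolding mprod.simps Cons conj_shift[OF assms(1,2)]
    using assms mprod_carrier[OF assms(2,3)] by (intro conj_mult) auto
qed simp

lemma mprod_diag:
  assumes X: "X \<in> carrier_mat n n" "\<And>i j. i < n \<Longrightarrow> j < n \<Longrightarrow> \<psi> i \<noteq> 0 \<Longrightarrow> X $$ (i, j) = (if i = j then x i else 0)"
  shows "mprod n X (diagm n \<psi>) ls = diagm n (\<lambda>i. \<psi> i * (\<Prod>l\<leftarrow>ls. x i - l))"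
proof (induction ls)
  case Nil show ?case by (auto intro!: eq_matI)
next
  case (Cons l ls)
  show ?case unfolding mprod.simps Cons
  proof (rule eq_matI)
    fix i j assume "i < dim_row (diagm n (\<lambda>i. \<psi> i * (\<Prod>l\<leftarrow>l # ls. x i - l)))" "j < dim_col (diagm n (\<lambda>i. \<psi> i * (\<Prod>l\<leftarrow>l # ls. x i - l)))"
    then have ij: "i < n" "j < n" by auto
    have c: "X + (- l) \<cdot>\<^sub>m 1\<^sub>m n \<in> carrier_mat n n" using X(1) by auto
    show "(diagm n (\<lambda>i. \<psi> i * (\<Prod>l\<leftarrow>ls. x i - l)) * (X + (- l) \<cdot>\<^sub>m 1\<^sub>m n)) $$ (i, j) =
        diagm n (\<lambda>i. \<psi> i * (\<Prod>l\<leftarrow>l # ls. x i - l)) $$ (i, j)"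
      unfolding diagm_mult_entry(1)[OF c ij] using X(1) X(2)[OF ij] ij by (cases "\<psi> i = 0") auto
  qed (use X in auto)
qed

lemma det_zero_if_zero_row:
  assumes "A \<in> carrier_mat n n" "i < n" "\<And>j. j < n \<Longrightarrow> A $$ (i, j) = 0" shows "det A = (0 :: complex)"
  unfolding det_def'[OF assms(1)]
proof (rule sum.neutral, rule ballI)
  fix p assume "p \<in> {p. p permutes {0..<n}}"
  then have "p i < n" using permutes_in_image[of p "{0..<n}" i] assms(2) by auto
  then have "(\<Prod>j = 0..<n. A $$ (j, p j)) = 0" using assms(2,3) by (intro prod_zero) (auto intro!: bexI[of _ i])
  then show "signof p * (\<Prod>j = 0..<n. A $$ (j, p j)) = 0" by simp
qed

lemma det_diagm: "det (diagm n d) = (\<Prod>i<n. d i)"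
proof -
  have "upper_triangular (diagm n d)" unfolding upper_triangular_def by auto
  then have "det (diagm n d) = prod_list (diag_mat (diagm n d))" by (rule det_upper_triangular[OF _ diagm_carrier(1)])
  also have "diag_mat (diagm n d) = map d [0..<n]" unfolding diag_mat_def by (intro map_cong) auto
  also have "prod_list (map d [0..<n]) = (\<Prod>i<n. d i)"
    by (subst prod.distinct_set_conv_list[symmetric]) (auto simp: lessThan_atLeast0)
  finally show ?thesis .
qed

lemma det_conj_shift:
  assumes "inverse_mats n P Q" "X \<in> carrier_mat n n"
  shows "det (P * X * Q + c \<cdot>\<^sub>m 1\<^sub>m n) = det (X + c \<cdot>\<^sub>m 1\<^sub>m n)"
proof -
  note a = inverse_matsD[OF assms(1)]
  have "det P * det Q = 1" using det_mult[OF a(1,2)] a(3) by simp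
  then show ?thesis unfolding conj_shift[OF assms] using a assms(2)
    by (simp add: det_mult[of _ n] mult.commute mult.left_commute)
qed

text \<open>The order in which coordinates are released. Entries of the conjugating matrix are
  detected by spectral projections that assume known eigenvalues, so they precede \<open>a\<close>
  and the high \<open>z\<close>. The low \<open>z\<close> come first, since they can be read off
  while the conjugating matrix is still the identity. The last two stages are detected by
  conjugation invariants.\<close>

fun stage :: "nat \<Rightarrow> coord \<Rightarrow> nat" where
  "stage p (CG i j) = 1"
| "stage p (CA i) = 2"
| "stage p (CZ i) = (if i < 2 * p then 0 else 3)"

context
  fixes n p m :: nat
  assumes n: "2 * p + m \<le> n"
begin

abbreviation "q \<equiv> 2 * p + m"

definition bA :: "nat \<Rightarrow> complex" where "bA = diag_entry p m (\<lambda>i. base p (CA i))"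

definition bB :: "nat \<Rightarrow> complex" where "bB l = base p (CZ l)"

text \<open>Where \<open>a\<close> and the high \<open>z\<close> have their base values, this is a multiple of the projection to the
  \<open>j\<close>-th eigenline.\<close>

definition proj :: "nat \<Rightarrow> complex mat \<times> complex mat \<Rightarrow> complex mat" where
  "proj j x = (if j < q then mprod n (fst x) (fst x) (map bA (filter (\<lambda>l. l \<noteq> j) [0..<q]))
     else mprod n (snd x) (mprod n (fst x) (1\<^sub>m n) (map bA [0..<q])) (map bB (filter (\<lambda>l. l \<noteq> j) [q..<n])))"

lemma poly_mat_proj: "poly_mat n (proj j)"
  unfolding proj_def by (cases "j < q") (auto intro!: poly_mat_mprod poly_mat_fst poly_mat_snd poly_mat_const)

lemma proj_cj:
  assumes "inverse_mats n P Q" "x \<in> M2 n" shows "proj j (cj P Q x) = P * proj j x * Q"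
proof -
  have c: "fst x \<in> carrier_mat n n" "snd x \<in> carrier_mat n n" using assms(2) unfolding M2_def by auto
  have "P * 1\<^sub>m n * Q = 1\<^sub>m n" using inverse_matsD[OF assms(1)] by simp
  then have "mprod n (P * fst x * Q) (1\<^sub>m n) ls = P * mprod n (fst x) (1\<^sub>m n) ls * Q" for ls
    using mprod_conj[OF assms(1) c(1), of "1\<^sub>m n" ls] by simp
  then show ?thesis unfolding proj_def cj_def
    using mprod_conj[OF assms(1) c(1) c(1)] mprod_conj[OF assms(1) c(2) mprod_carrier[OF c(1), of "1\<^sub>m n"]] by auto
qed

lemma base_good_params: "good_params p m (\<lambda>i. base p (CA i))"
  using good_params_exists[of p m] unfolding base_def by simp

lemma bA_inj: "i < q \<Longrightarrow> j < q \<Longrightarrow> bA i = bA j \<Longrightarrow> i = j"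
  unfolding bA_def by (rule diag_entry_inj[OF base_good_params])

lemma bA_nonzero: "i < q \<Longrightarrow> bA i \<noteq> 0"
  using base_good_params unfolding bA_def diag_entry_def good_params_def by auto

lemma bA_zero: "q \<le> i \<Longrightarrow> bA i = 0"
  unfolding bA_def diag_entry_def by auto

lemma proj_std:
  assumes a: "\<And>i. \<theta> (CA i) = base p (CA i)" and z: "\<And>i. q \<le> i \<Longrightarrow> \<theta> (CZ i) = bB i" and j: "j < n"
  obtains c where "c \<noteq> 0" "proj j (std n p m \<theta>) = diagm n (\<lambda>i. if i = j then c else 0)"
proof -
  have A: "fst (std n p m \<theta>) = diagm n bA" unfolding std_def fst_conv diag_A_diagm bA_def a ..
  have dA: "mprod n (diagm n bA) (diagm n \<psi>) ls = diagm n (\<lambda>i. \<psi> i * (\<Prod>l\<leftarrow>ls. bA i - l))" for \<psi> ls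
    by (rule mprod_diag) auto
  show ?thesis
  proof (cases "j < q")
    case True
    let ?ls = "map bA (filter (\<lambda>l. l \<noteq> j) [0..<q])"
    \<comment> \<open>The leading factor \<open>bA i\<close> comes from starting the product with
      the first matrix itself and kills its kernel; the remaining factors kill the other nonzero
      eigenvalues.\<close>
    define f where "f i = bA i * (\<Prod>l\<leftarrow>?ls. bA i - l)" for i
    have "proj j (std n p m \<theta>) = diagm n f" unfolding proj_def A using True dA unfolding f_def by simp
    moreover have "f i = 0" if "i \<noteq> j" "i < n" for i
    proof (cases "i < q")
      case True
      then have "bA i \<in> set ?ls" using that by auto
      then have "(\<Prod>l\<leftarrow>?ls. bA i - l) = 0" by (force simp: prod_list_zero_iff)
      then show ?thesis unfolding f_def by simp
    next
      case False then show ?thesis using bA_zero unfolding f_def by simp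
    qed
    moreover have "f j \<noteq> 0"
      unfolding f_def using bA_nonzero[OF True] bA_inj[OF True] by (auto simp: prod_list_zero_iff)
    moreover from calculation(2) have "diagm n f = diagm n (\<lambda>i. if i = j then f j else 0)" by (intro eq_matI) auto
    ultimately show ?thesis using that[of "f j"] by simp
  next
    case False
    \<comment> \<open>\<open>\<psi>\<close> is nonzero exactly on the kernel indices. Starting from
      it removes the antidiagonal part of the second matrix, whose entries are unrestricted, before
      the diagonal entries are separated.\<close>
    define \<psi> where "\<psi> i = (\<Prod>l\<leftarrow>map bA [0..<q]. bA i - l)" for i
    let ?ls = "map bB (filter (\<lambda>l. l \<noteq> j) [q..<n])"
    define f where "f i = \<psi> i * (\<Prod>l\<leftarrow>?ls. bB i - l)" for i
    have 1: "1\<^sub>m n = diagm n (\<lambda>i. 1)" by (rule eq_matI) auto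
    have psi: "mprod n (diagm n bA) (1\<^sub>m n) (map bA [0..<q]) = diagm n \<psi>" unfolding 1 dA \<psi>_def by simp
    have psi0: "\<psi> i = 0" if "i < q" for i using that unfolding \<psi>_def by (force simp: prod_list_zero_iff)
    have psi1: "\<psi> i \<noteq> 0" if "q \<le> i" for i using bA_zero[OF that] bA_nonzero unfolding \<psi>_def by (auto simp: prod_list_zero_iff)
    have "mprod n (snd (std n p m \<theta>)) (diagm n \<psi>) ?ls = diagm n f" unfolding f_def
    proof (rule mprod_diag)
      show "snd (std n p m \<theta>) \<in> carrier_mat n n" unfolding std_def by simp
      fix i l assume "i < n" "l < n" "\<psi> i \<noteq> 0"
      then show "snd (std n p m \<theta>) $$ (i, l) = (if i = l then bB i else 0)"
        using psi0[of i] z[of i] unfolding std_def Bst_def by auto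
    qed
    then have "proj j (std n p m \<theta>) = diagm n f" unfolding proj_def A psi using False by simp
    moreover have "f i = 0" if "i \<noteq> j" "i < n" for i
    proof (cases "i < q")
      case True then show ?thesis using psi0 unfolding f_def by simp
    next
      case False
      then have "bB i \<in> set ?ls" using that by auto
      then have "(\<Prod>l\<leftarrow>?ls. bB i - l) = 0" by (force simp: prod_list_zero_iff)
      then show ?thesis unfolding f_def by simp
    qed
    moreover have "f j \<noteq> 0"
      unfolding f_def using psi1[of j] False by (auto simp: prod_list_zero_iff bB_def base_def simp del: of_nat_Suc of_nat_add)
    moreover from calculation(2) have "diagm n f = diagm n (\<lambda>i. if i = j then f j else 0)" by (intro eq_matI) auto
    ultimately show ?thesis using that[of "f j"] by simp
  qed
qed

lemma std_M2: "std n p m \<theta> \<in> M2 n"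
  unfolding std_def using std_Zn Zn_M2 by blast

lemma SX_special_point:
  assumes "\<And>i j. \<kappa> \<noteq> CG i j"
  shows "std n p m ((base p)(\<kappa> := c)) \<in> SX n p m (insert \<kappa> X)"
proof -
  have g: "gmat n ((base p)(\<kappa> := c)) = 1\<^sub>m n" using assms unfolding gmat_def by (intro eq_matI) (auto simp: base_def)
  have "std n p m ((base p)(\<kappa> := c)) = cj (gmat n ((base p)(\<kappa> := c))) (1\<^sub>m n) (std n p m ((base p)(\<kappa> := c)))"
    unfolding g cj_def using std_M2[of "(base p)(\<kappa> := c)"] unfolding M2_def by (cases "std n p m ((base p)(\<kappa> := c))") auto
  then show ?thesis unfolding SX_def using inverse_mats_one[of n] g
    by (intro CollectI exI[of _ "(base p)(\<kappa> := c)"] exI[of _ "1\<^sub>m n"]) auto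
qed

text \<open>Shows that releasing one more coordinate strictly enlarges the closure. Every case uses
  a function that is zero while \<open>\<kappa>\<close> is frozen and nonzero at one explicit point
  where only \<open>\<kappa>\<close> differs from the base point.\<close>

lemma separating_function:
  assumes k: "\<kappa> \<in> coords n p m" "\<kappa> \<notin> X" and X: "\<And>\<kappa>'. \<kappa>' \<in> X \<Longrightarrow> stage p \<kappa>' \<le> stage p \<kappa>"
  shows "\<exists>f\<in>poly_fun n. (\<forall>x\<in>SX n p m X. f x = 0) \<and> (\<exists>x\<in>SX n p m (insert \<kappa> X). f x \<noteq> 0)"
proof -
  consider (zl) i where "\<kappa> = CZ i" "i < 2 * p" | (g) i j where "\<kappa> = CG i j" "i < n" "j < n" "i \<noteq> j"
    | (a) i where "\<kappa> = CA i" "i < p + m" | (zh) i where "\<kappa> = CZ i" "q \<le> i" "i < n"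
    using k(1) unfolding coords_def by auto
  then show ?thesis
  proof cases
    case (zl i)
    have i: "i < n" "partner i < n" using zl(2) partner_less[OF zl(2)] n by auto
    show ?thesis
    proof (intro bexI[of _ "\<lambda>x. snd x $$ (i, partner i)"] conjI ballI)
      show "(\<lambda>x. snd x $$ (i, partner i)) \<in> poly_fun n" using i by (rule pf_coordB)
      have z: "snd (std n p m \<theta>) $$ (i, partner i) = \<theta> (CZ i)" for \<theta> using i zl(2) unfolding std_def Bst_def by simp
      fix x assume "x \<in> SX n p m X"
      then obtain \<theta> h where x: "x = cj (gmat n \<theta>) h (std n p m \<theta>)" "inverse_mats n (gmat n \<theta>) h" "\<forall>\<kappa>. \<kappa> \<notin> X \<longrightarrow> \<theta> \<kappa> = base p \<kappa>"
        unfolding SX_def by auto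
      \<comment> \<open>Stage 0 precedes all others, so no entry of the conjugating matrix has been
        released and the pair is still in standard form.\<close>
      have "CG a b \<notin> X" for a b using X[of "CG a b"] zl by auto
      then have g1: "gmat n \<theta> = 1\<^sub>m n" using x(3) unfolding gmat_def by (intro eq_matI) (auto simp: base_def)
      then have "h = 1\<^sub>m n" using inverse_mats_unique[OF _ inverse_mats_one] x(2) by auto
      then have "snd x = snd (std n p m \<theta>)" unfolding x(1) g1 cj_def std_def by simp
      then show "snd x $$ (i, partner i) = 0" using z x(3) k(2) zl by (simp add: base_def)
    next
      have "snd (std n p m ((base p)(\<kappa> := 1))) $$ (i, partner i) \<noteq> 0" using i zl unfolding std_def Bst_def by simp
      then show "\<exists>x\<in>SX n p m (insert \<kappa> X). snd x $$ (i, partner i) \<noteq> 0"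
        using SX_special_point[of \<kappa> 1 X] zl(1) by blast
    qed
  next
    case (g i j)
    obtain f where f: "f \<in> poly_fun n" "\<And>x. x \<in> M2 n \<Longrightarrow> proj j x $$ (i, j) = f x"
      using poly_mat_entry[OF poly_mat_proj g(2,3)] by metis
    \<comment> \<open>Up to a nonzero scalar, \<open>proj j\<close> of the pair is column
      \<open>j\<close> of the conjugating matrix times row \<open>j\<close> of its inverse, so its
      entry at \<open>(i, j)\<close> has \<open>\<theta> (CG i j)\<close> as a factor. The
      eigenvalue coordinates belong to later stages and still have their base values.\<close>
    have val: "\<exists>c. c \<noteq> 0 \<and> f (cj (gmat n \<theta>) h (std n p m \<theta>)) = \<theta> (CG i j) * (c * h $$ (j, j))"
      if \<theta>: "inverse_mats n (gmat n \<theta>) h" "\<forall>\<kappa>'. \<kappa>' \<notin> insert \<kappa> X \<longrightarrow> \<theta> \<kappa>' = base p \<kappa>'" for \<theta> h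
    proof -
      have nX: "CA l \<notin> insert \<kappa> X" "q \<le> l \<Longrightarrow> CZ l \<notin> insert \<kappa> X" for l using X[of "CA l"] X[of "CZ l"] g(1) by auto
      obtain c where c: "c \<noteq> 0" "proj j (std n p m \<theta>) = diagm n (\<lambda>i. if i = j then c else 0)"
        by (rule proj_std[of \<theta> j]) (use \<theta>(2) nX g(3) in \<open>auto simp: bB_def\<close>)
      note gh = inverse_matsD[OF \<theta>(1)]
      have gD: "gmat n \<theta> * diagm n (\<lambda>i. if i = j then c else 0) \<in> carrier_mat n n" using gh by auto
      have "f (cj (gmat n \<theta>) h (std n p m \<theta>)) = (gmat n \<theta> * diagm n (\<lambda>i. if i = j then c else 0) * h) $$ (i, j)"
        unfolding f(2)[OF cj_M2[OF \<theta>(1) std_M2], symmetric] proj_cj[OF \<theta>(1) std_M2] c(2) ..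
      also have "\<dots> = (\<Sum>l<n. gmat n \<theta> $$ (i, l) * (if l = j then c else 0) * h $$ (l, j))"
        unfolding mat_mult_entry[OF gD gh(2) g(2,3)] using g(2) by (intro sum.cong refl) (simp add: diagm_mult_entry(2)[OF gh(1)] del: index_mult_mat(1))
      also have "\<dots> = (\<Sum>l<n. if l = j then gmat n \<theta> $$ (i, j) * c * h $$ (j, j) else 0)" by (intro sum.cong) auto
      also have "\<dots> = \<theta> (CG i j) * (c * h $$ (j, j))" using g unfolding gmat_def by simp
      finally show ?thesis using c(1) by blast
    qed
    show ?thesis
    proof (intro bexI[of _ f] conjI ballI)
      show "f \<in> poly_fun n" by (rule f)
      fix x assume "x \<in> SX n p m X"
      then obtain \<theta> h where x: "x = cj (gmat n \<theta>) h (std n p m \<theta>)" "inverse_mats n (gmat n \<theta>) h" "\<forall>\<kappa>. \<kappa> \<notin> X \<longrightarrow> \<theta> \<kappa> = base p \<kappa>"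
        unfolding SX_def by auto
      have "\<theta> (CG i j) = 0" using x(3) k(2) g(1) by (simp add: base_def)
      then show "f x = 0" using val[OF x(2)] x by auto
    next
      define \<theta> where "\<theta> = (base p)(\<kappa> := 1)"
      \<comment> \<open>The conjugating matrix at this point is elementary; its inverse flips the
        sign of the off-diagonal entry and keeps the diagonal entry at \<open>j\<close> equal to
        1.\<close>
      define h :: "complex mat" where "h = mat n n (\<lambda>(a, b). if a = b then 1 else if a = i \<and> b = j then - 1 else 0)"
      have gm: "gmat n \<theta> = mat n n (\<lambda>(a, b). if a = b then 1 else if a = i \<and> b = j then 1 else 0)"
        unfolding gmat_def \<theta>_def using g by (intro cong_mat) (auto simp: base_def)
      have c: "gmat n \<theta> \<in> carrier_mat n n" "h \<in> carrier_mat n n" unfolding gm h_def by auto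
      have "gmat n \<theta> * h = 1\<^sub>m n"
      proof (rule eq_matI)
        fix a b assume "a < dim_row (1\<^sub>m n :: complex mat)" "b < dim_col (1\<^sub>m n :: complex mat)"
        then have ab: "a < n" "b < n" by auto
        have "(gmat n \<theta> * h) $$ (a, b) = (\<Sum>l<n. gmat n \<theta> $$ (a, l) * h $$ (l, b))" by (rule mat_mult_entry[OF c ab])
        also have "\<dots> = (\<Sum>l<n. (if l = a then h $$ (a, b) else 0) + (if l = j then if a = i then h $$ (j, b) else 0 else 0))"
          using ab g by (intro sum.cong) (auto simp: gm)
        also have "\<dots> = h $$ (a, b) + (if a = i then h $$ (j, b) else 0)" unfolding sum.distrib using ab g by simp
        also have "\<dots> = 1\<^sub>m n $$ (a, b)" using ab g unfolding h_def by auto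
        finally show "(gmat n \<theta> * h) $$ (a, b) = 1\<^sub>m n $$ (a, b)" .
      qed (use c in auto)
      then have gh: "inverse_mats n (gmat n \<theta>) h" using c mat_mult_left_right_inverse[OF c] unfolding inverse_mats_def by auto
      have \<theta>X: "\<forall>\<kappa>'. \<kappa>' \<notin> insert \<kappa> X \<longrightarrow> \<theta> \<kappa>' = base p \<kappa>'" unfolding \<theta>_def by auto
      have "h $$ (j, j) = 1" "\<theta> (CG i j) = 1" using g unfolding h_def \<theta>_def by auto
      then have "f (cj (gmat n \<theta>) h (std n p m \<theta>)) \<noteq> 0" using val[OF gh \<theta>X] by auto
      moreover have "cj (gmat n \<theta>) h (std n p m \<theta>) \<in> SX n p m (insert \<kappa> X)" unfolding SX_def using gh \<theta>X by blast
      ultimately show "\<exists>x\<in>SX n p m (insert \<kappa> X). f x \<noteq> 0" by blast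
    qed
  next
    case (a i)
    \<comment> \<open>A diagonal position carrying \<open>a i\<close>, inverse to the indexing in
      \<open>diag_entry\<close>. While \<open>a i\<close> is frozen, its base value is an eigenvalue
      and the shifted determinant vanishes.\<close>
    define l where "l = (if i < p then 2 * i else p + i)"
    have l: "l < n" "diag_entry p m b l = b i" for b
      using a(2) n unfolding l_def diag_entry_def by auto
    have "poly_mat n (\<lambda>x. fst x + (- base p (CA i)) \<cdot>\<^sub>m 1\<^sub>m n)"
      by (intro poly_mat_add poly_mat_fst poly_mat_const) auto
    from poly_mat_det[OF this] obtain f where f: "f \<in> poly_fun n"
      "\<And>x. x \<in> M2 n \<Longrightarrow> det (fst x + (- base p (CA i)) \<cdot>\<^sub>m 1\<^sub>m n) = f x" by metis
    have val: "det (fst (std n p m \<theta>) + (- base p (CA i)) \<cdot>\<^sub>m 1\<^sub>m n) = (\<Prod>k<n. diag_entry p m (\<lambda>i. \<theta> (CA i)) k - base p (CA i))" for \<theta>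
      unfolding det_diagm[symmetric] std_def fst_conv diag_A_diagm by (intro arg_cong[where f = det] eq_matI) auto
    have c: "fst (std n p m \<theta>) \<in> carrier_mat n n" for \<theta> using std_M2[of \<theta>] unfolding M2_def by auto
    show ?thesis
    proof (intro bexI[of _ f] conjI ballI)
      show "f \<in> poly_fun n" by (rule f)
      fix x assume "x \<in> SX n p m X"
      then obtain \<theta> h where x: "x = cj (gmat n \<theta>) h (std n p m \<theta>)" "inverse_mats n (gmat n \<theta>) h" "\<forall>\<kappa>. \<kappa> \<notin> X \<longrightarrow> \<theta> \<kappa> = base p \<kappa>"
        unfolding SX_def by auto
      have "f x = (\<Prod>k<n. diag_entry p m (\<lambda>i. \<theta> (CA i)) k - base p (CA i))"
        unfolding x(1) unfolding f(2)[OF cj_M2[OF x(2) std_M2], symmetric] unfolding val[symmetric] cj_def fst_conv det_conj_shift[OF x(2) c] ..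
      moreover have "diag_entry p m (\<lambda>i. \<theta> (CA i)) l - base p (CA i) = 0" unfolding l(2) using x(3) k(2) a(1) by simp
      ultimately show "f x = 0" using l(1) by (auto intro!: prod_zero bexI[of _ l])
    next
      \<comment> \<open>The new value exceeds the base value \<open>i + 1\<close>, the other
        eigenvalue coordinates differ from it, and negatives are excluded by positivity. So
        \<open>i + 1\<close> is no longer an eigenvalue.\<close>
      define \<theta> where "\<theta> = (base p)(\<kappa> := of_nat (n + p + m + 1))"
      have "diag_entry p m (\<lambda>i. \<theta> (CA i)) t - base p (CA i) \<noteq> 0" for t
      proof -
        have \<theta>k: "\<theta> (CA k) = of_nat (if k = i then n + p + m + 1 else k + 1)" for k unfolding \<theta>_def a(1) by (simp add: base_def)
        have ne: "\<theta> (CA k) \<noteq> base p (CA i)" for k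
          unfolding \<theta>k using a(2) n by (auto simp: base_def simp del: of_nat_Suc of_nat_add simp flip: of_nat_Suc)
        have ne': "- \<theta> (CA k) \<noteq> base p (CA i)" for k
        proof
          assume h: "- \<theta> (CA k) = base p (CA i)"
          have "base p (CA i) + \<theta> (CA k) = 0" unfolding h[symmetric] by simp
          moreover have "base p (CA i) = of_nat (i + 1)" unfolding base_def by simp
          ultimately have "of_nat (i + 1) + of_nat (if k = i then n + p + m + 1 else k + 1) = (0 :: complex)" unfolding \<theta>k by simp
          then show False unfolding of_nat_add[symmetric] of_nat_eq_0_iff by simp
        qed
        have "base p (CA i) \<noteq> 0" unfolding base_def by (simp del: of_nat_Suc of_nat_add)
        then show ?thesis using ne ne' unfolding diag_entry_def by auto
      qed
      then have "det (fst (std n p m \<theta>) + (- base p (CA i)) \<cdot>\<^sub>m 1\<^sub>m n) \<noteq> 0" unfolding val by simp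
      then have "f (std n p m \<theta>) \<noteq> 0" using f(2)[OF std_M2] by simp
      then show "\<exists>x\<in>SX n p m (insert \<kappa> X). f x \<noteq> 0"
        using SX_special_point[of \<kappa> "of_nat (n + p + m + 1)" X] a(1) unfolding \<theta>_def by blast
    qed
  next
    case (zh i)
    have "poly_mat n (\<lambda>x. snd x + (- base p (CZ i)) \<cdot>\<^sub>m 1\<^sub>m n)"
      by (intro poly_mat_add poly_mat_snd poly_mat_const) auto
    from poly_mat_det[OF this] obtain f where f: "f \<in> poly_fun n"
      "\<And>x. x \<in> M2 n \<Longrightarrow> det (snd x + (- base p (CZ i)) \<cdot>\<^sub>m 1\<^sub>m n) = f x" by metis
    have c: "snd (std n p m \<theta>) \<in> carrier_mat n n" for \<theta> using std_M2[of \<theta>] unfolding M2_def by auto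
    show ?thesis
    proof (intro bexI[of _ f] conjI ballI)
      show "f \<in> poly_fun n" by (rule f)
      fix x assume "x \<in> SX n p m X"
      then obtain \<theta> h where x: "x = cj (gmat n \<theta>) h (std n p m \<theta>)" "inverse_mats n (gmat n \<theta>) h" "\<forall>\<kappa>. \<kappa> \<notin> X \<longrightarrow> \<theta> \<kappa> = base p \<kappa>"
        unfolding SX_def by auto
      have "f x = det (snd (std n p m \<theta>) + (- base p (CZ i)) \<cdot>\<^sub>m 1\<^sub>m n)"
        unfolding x(1) unfolding f(2)[OF cj_M2[OF x(2) std_M2], symmetric] unfolding cj_def snd_conv det_conj_shift[OF x(2) c] ..
      also have "\<dots> = 0"
      proof (rule det_zero_if_zero_row[OF _ zh(3)])
        show "snd (std n p m \<theta>) + (- base p (CZ i)) \<cdot>\<^sub>m 1\<^sub>m n \<in> carrier_mat n n" using c by auto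
        fix j assume "j < n"
        then show "(snd (std n p m \<theta>) + (- base p (CZ i)) \<cdot>\<^sub>m 1\<^sub>m n) $$ (i, j) = 0"
          using zh x(3) k(2) unfolding std_def Bst_def by auto
      qed
      finally show "f x = 0" .
    next
      \<comment> \<open>The base values of the kernel entries are \<open>t + 1\<close> with
        \<open>t < n\<close>, hence at most \<open>n\<close>; the value \<open>n + 1\<close> is
        different from all of them.\<close>
      define \<theta> where "\<theta> = (base p)(\<kappa> := of_nat (n + 1))"
      define d where "d t = (if t < q then 0 else \<theta> (CZ t))" for t
      have "snd (std n p m \<theta>) + (- base p (CZ i)) \<cdot>\<^sub>m 1\<^sub>m n = diagm n (\<lambda>t. d t - base p (CZ i))"
        using zh unfolding std_def Bst_def d_def \<theta>_def by (intro eq_matI) (auto simp: base_def)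
      then have "det (snd (std n p m \<theta>) + (- base p (CZ i)) \<cdot>\<^sub>m 1\<^sub>m n) = (\<Prod>t<n. d t - base p (CZ i))" by (simp add: det_diagm)
      moreover have "d t - base p (CZ i) \<noteq> 0" if "t < n" for t
        using zh that unfolding d_def \<theta>_def by (auto simp: base_def simp del: of_nat_Suc of_nat_add simp flip: of_nat_Suc)
      ultimately have "f (std n p m \<theta>) \<noteq> 0" using f(2)[OF std_M2] by simp
      then show "\<exists>x\<in>SX n p m (insert \<kappa> X). f x \<noteq> 0"
        using SX_special_point[of \<kappa> "of_nat (n + 1)" X] zh(1) unfolding \<theta>_def by blast
    qed
  qed
qed

lemma chain_exists:
  defines "D \<equiv> card (coords n p m)"
  shows "\<exists>ch. (\<forall>i\<le>D. zariski_closed n (ch i) \<and> zariski_irreducible n (ch i) \<and> ch i \<subseteq> zariski_closure n (SX n p m UNIV)) \<and>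
     (\<forall>i<D. ch i \<subset> ch (Suc i))"
proof -
  obtain xs where xs: "set xs = coords n p m" "distinct xs" using finite_distinct_list[OF finite_coords] by blast
  \<comment> \<open>Sorting by stage ensures that each prefix contains no coordinate of a later
    stage than the next one, as \<open>separating_function\<close> demands.\<close>
  define L where "L = sort_key (stage p) xs"
  have L: "set L = coords n p m" "distinct L" "sorted (map (stage p) L)" "length L = D"
    using xs distinct_card[OF xs(2)] unfolding L_def D_def by auto
  define ch where "ch k = zariski_closure n (SX n p m (set (take k L)))" for k
  have "ch k \<subset> ch (Suc k)" if k: "k < D" for k
  proof -
    have ins: "set (take (Suc k) L) = insert (L ! k) (set (take k L))" using k L(4) by (simp add: take_Suc_conv_app_nth)
    have "L ! k \<notin> set (take k L)" using L(2) k L(4) by (metis distinct_take distinct.simps(2) id_take_nth_drop distinct_append disjoint_insert(1) list.set(2))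
    moreover have "stage p \<kappa>' \<le> stage p (L ! k)" if "\<kappa>' \<in> set (take k L)" for \<kappa>'
    proof -
      obtain i where i: "i < k" "\<kappa>' = L ! i" using \<open>\<kappa>' \<in> _\<close> k L(4) by (auto simp: in_set_conv_nth)
      then show ?thesis using sorted_nth_mono[OF L(3), of i k] k L(4) by simp
    qed
    moreover have "L ! k \<in> coords n p m" using k L(1,4) nth_mem by metis
    ultimately obtain f x where f: "f \<in> poly_fun n" "\<And>x. x \<in> SX n p m (set (take k L)) \<Longrightarrow> f x = 0"
      "x \<in> SX n p m (set (take (Suc k) L))" "f x \<noteq> 0"
      using separating_function[of "L ! k" "set (take k L)"] unfolding ins by blast
    have "x \<in> ch (Suc k)" using f(3) closure_subset unfolding ch_def by blast
    moreover have "x \<notin> ch k" using zero_on_closure[OF SX_M2 f(1,2)] f(4) unfolding ch_def by blast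
    moreover have "ch k \<subseteq> ch (Suc k)" unfolding ch_def ins by (intro closure_mono SX_mono) auto
    ultimately show ?thesis by blast
  qed
  moreover have "zariski_closed n (ch k)" "zariski_irreducible n (ch k)" "ch k \<subseteq> zariski_closure n (SX n p m UNIV)" for k
    unfolding ch_def using zariski_closed_closure[OF SX_M2] irreducible_closure[OF SX_M2 SX_irreducible] closure_mono[OF SX_mono] by auto
  ultimately show ?thesis by blast
qed

lemma zariski_dim_closure_SX: "zariski_dim n (zariski_closure n (SX n p m UNIV)) = enat (card (coords n p m))"
proof -
  let ?Y = "zariski_closure n (SX n p m UNIV)"
  let ?K = "{k. \<exists>ch :: nat \<Rightarrow> (complex mat \<times> complex mat) set.
     (\<forall>i\<le>k. zariski_closed n (ch i) \<and> zariski_irreducible n (ch i) \<and> ch i \<subseteq> ?Y) \<and> (\<forall>i<k. ch i \<subset> ch (Suc i))}"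
  have mem: "card (coords n p m) \<in> ?K" using chain_exists by blast
  have le: "k \<le> card (coords n p m)" if k: "k \<in> ?K" for k
  proof -
    from k obtain ch where "\<forall>i\<le>k. zariski_closed n (ch i) \<and> zariski_irreducible n (ch i) \<and> ch i \<subseteq> ?Y" "\<forall>i<k. ch i \<subset> ch (Suc i)"
      by blast
    then show ?thesis using chain_length_le[OF n, of k ch] by blast
  qed
  show ?thesis unfolding zariski_dim_def
  proof (intro antisym Sup_least Sup_upper imageI mem)
    fix x assume "x \<in> enat ` ?K"
    then obtain k where "k \<in> ?K" "x = enat k" by (rule imageE)
    with le show "x \<le> enat (card (coords n p m))" by simp
  qed
qed

end

lemma zariski_dim_Zpmr: "(p, m, r) \<in> TP n \<Longrightarrow> zariski_dim n (Zpmr n p m r) = enat (n ^ 2 + p)"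
  using zariski_dim_closure_SX[of p m n] card_coords[of p m r n] Zpmr_eq_closure_SX[of p m r n] unfolding TP_def by auto

lemma zariski_dim_mono: "Y \<subseteq> Y' \<Longrightarrow> zariski_dim n Y \<le> zariski_dim n Y'"
  unfolding zariski_dim_def by (intro Sup_subset_mono image_mono) blast

text \<open>Moments bound \<open>m\<close> and \<open>r\<close>, dimension bounds \<open>p\<close>.
  Since 2p + m + r is \<open>n\<close> for both triples, the three inequalities must be
  equalities.\<close>

lemma Zpmr_subset_iff:
  assumes "(p, m, r) \<in> TP n" "(p', m', r') \<in> TP n" "Zpmr n p m r \<subseteq> Zpmr n p' m' r'"
  shows "(p, m, r) = (p', m', r')"
proof -
  have "m \<le> m'" "r \<le> r'" using Zpmr_subset_imp[OF _ _ assms(3)] assms(1,2) unfolding TP_def by auto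
  moreover have "p \<le> p'" using zariski_dim_mono[OF assms(3), of n] assms(1,2) by (simp add: zariski_dim_Zpmr)
  ultimately show ?thesis using assms(1,2) unfolding TP_def by auto
qed

text \<open>An irreducible subset of a finite union of closed sets lies in one of them, so only the
  \<open>C i\<close> can be maximal; the absence of inclusions makes each of them so.\<close>

lemma irreducible_components_finite_union:
  assumes fin: "finite I" and C: "\<And>i. i \<in> I \<Longrightarrow> zariski_closed n (C i)" "\<And>i. i \<in> I \<Longrightarrow> zariski_irreducible n (C i)"
    and anti: "\<And>i j. i \<in> I \<Longrightarrow> j \<in> I \<Longrightarrow> C i \<subseteq> C j \<Longrightarrow> i = j"
  shows "irreducible_components n (\<Union>i\<in>I. C i) = C ` I"
proof (intro equalityI subsetI)
  fix Y assume "Y \<in> irreducible_components n (\<Union>i\<in>I. C i)"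
  then have Y: "Y \<subseteq> (\<Union>i\<in>I. C i)" "zariski_irreducible n Y"
    "\<And>Y'. Y \<subseteq> Y' \<Longrightarrow> Y' \<subseteq> (\<Union>i\<in>I. C i) \<Longrightarrow> zariski_irreducible n Y' \<Longrightarrow> Y' = Y" unfolding irreducible_components_def by auto
  from irreducible_subset_UN[OF fin C(1) Y(2,1)] obtain i where i: "i \<in> I" "Y \<subseteq> C i" by blast
  then have "C i = Y" using C(2) by (intro Y(3)) auto
  then show "Y \<in> C ` I" using i by auto
next
  fix Y assume "Y \<in> C ` I"
  then obtain i where i: "i \<in> I" "Y = C i" by auto
  have "Y' = C i" if Y': "C i \<subseteq> Y'" "Y' \<subseteq> (\<Union>i\<in>I. C i)" "zariski_irreducible n Y'" for Y'
  proof -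
    from irreducible_subset_UN[OF fin C(1) Y'(3,2)] obtain j where j: "j \<in> I" "Y' \<subseteq> C j" by blast
    then have "i = j" using anti i Y' by blast
    then show ?thesis using j Y' by blast
  qed
  then show "Y \<in> irreducible_components n (\<Union>i\<in>I. C i)" unfolding irreducible_components_def i(2) using i C(2) by blast
qed

theorem theorem5p6:
  fixes n :: nat
  assumes "n \<ge> 1"
  shows "irreducible_components n (Zn n) = (\<lambda>(p, m, r). Zpmr n p m r) ` TP n
    \<and> inj_on (\<lambda>(p, m, r). Zpmr n p m r) (TP n)
    \<and> Zn n = (\<Union>(p, m, r)\<in>TP n. Zpmr n p m r)
    \<and> (\<forall>(p, m, r)\<in>TP n. zariski_dim n (Zpmr n p m r) = enat (n ^ 2 + p))"
proof (intro conjI)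
  have anti: "t = t'" if "t \<in> TP n" "t' \<in> TP n" "(\<lambda>(p, m, r). Zpmr n p m r) t \<subseteq> (\<lambda>(p, m, r). Zpmr n p m r) t'" for t t'
    using that Zpmr_subset_iff by (cases t; cases t') auto
  show U: "Zn n = (\<Union>(p, m, r)\<in>TP n. Zpmr n p m r)" using Zn_eq_Union assms by simp
  have "irreducible_components n (\<Union>t\<in>TP n. (\<lambda>(p, m, r). Zpmr n p m r) t) = (\<lambda>(p, m, r). Zpmr n p m r) ` TP n"
  proof (rule irreducible_components_finite_union[OF finite_TP])
    show "zariski_closed n ((\<lambda>(p, m, r). Zpmr n p m r) t)" if "t \<in> TP n" for t using Zpmr_closed by (cases t) auto
    show "zariski_irreducible n ((\<lambda>(p, m, r). Zpmr n p m r) t)" if "t \<in> TP n" for t using that Zpmr_irreducible by (cases t) auto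
  qed (rule anti)
  then show "irreducible_components n (Zn n) = (\<lambda>(p, m, r). Zpmr n p m r) ` TP n" unfolding U .
  show "inj_on (\<lambda>(p, m, r). Zpmr n p m r) (TP n)" by (rule inj_onI, rule anti) auto
  show "\<forall>(p, m, r)\<in>TP n. zariski_dim n (Zpmr n p m r) = enat (n ^ 2 + p)" using zariski_dim_Zpmr by blast
qed

end
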